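(* Let $(M^n,g)$, $n\ge 3$, be a (pseudo) Riemannian manifold and consider the Poisson equation $\Delta_gu+f(u)=0$ on $M^n$. 1) For an arbitrary $f(u)$, any Lie point symmetry of the equation is a variational symmetry; that is, the isometry group of $(M^n,g)$ and the variational symmetry group of the equation coincide. 2) If $f(u)=e^u$, the only variational symmetries are the isometries of $(M^n,g)$. 3) If $f(u)=u^p$, $p\ne0$, $p\neq1$, the symmetry $$X=\xi^i(x)\frac{\partial}{\partial x^i}+\frac{\mu}{1-p}\,u\,\frac{\partial}{\partial u},\qquad \mathcal L_\xi g_{ij}=\mu g_{ij},\quad \mu=\text{const},$$ is variational if and only if $p=\frac{n+2}{n-2}$, that is, $p+1$ equals the critical Sobolev exponent. 3.1) If $f(u)=u^p$ with $p=\frac{n+2}{n-2}$, $n\ne 6$, then the symmetry generated by $$X=\xi^i(x)\frac{\partial}{\partial x^i}+\frac{2-n}{4}\mu\,u\,\frac{\partial}{\partial u},\qquad \mathcal L_\xi g_{ij}=\mu g_{ij},\quad\Delta_g\mu=0,$$ is a divergence symmetry. 3.2) If $f(u)=u^p$ with $p=2$ and $n=6$, then the symmetry generated by $$X=\xi^i(x)\frac{\partial}{\partial x^i}+\Big(-\mu u+\tfrac12\Delta_g\mu\Big)\frac{\partial}{\partial u},\qquad \mathcal L_\xi g_{ij}=\mu g_{ij},\quad\Delta_g^2\mu=0,$$ is a divergence symmetry. 4) In the linear cases: 4.1) If $f(u)=0$, the symmetry $$X=\xi^i(x)\frac{\partial}{\partial x^i}+\Big[\Big(\tfrac{2-n}{4}\mu+c\Big)u+b(x)\Big]\frac{\partial}{\partial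 u},\qquad \mathcal L_\xi g_{ij}=\mu g_{ij},\ \Delta_g\mu=0,\ \Delta_gb=0,\ c=\text{const},$$ is a Noether symmetry if and only if $c=0$. 4.2) If $f(u)=k$, $k\ne0$ constant, the symmetry $$X=\xi^i(x)\frac{\partial}{\partial x^i}+\Big[\Big(\tfrac{n-2}{n+2}\big(\tfrac1k\Delta_g b-c\big)+c\Big)u+b(x)\Big]\frac{\partial}{\partial u},\qquad \mathcal L_\xi g_{ij}=\tfrac{4}{n+2}\big(c-\tfrac1k\Delta_gb\big)g_{ij},\ \Delta_g^2b=0,\ c=\text{const},$$ is a Noether symmetry if and only if $b=c=0$. 4.3) If $f(u)=u$, the symmetry $$X=\xi^i(x)\frac{\partial}{\partial x^i}+\Big[\Big(\tfrac{2-n}{4}\mu+c\Big)u+b(x)\Big]\frac{\partial}{\partial u},\qquad \mathcal L_\xi g_{ij}=\mu g_{ij},\ \tfrac{2-n}{4}\Delta_g\mu+\mu=0,\ \Delta_gb+b=0,\ c=\text{const},$$ is a Noether symmetry if and only if $c=0$.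
   Context: $M^n$ carries a (pseudo) Riemannian metric $g=(g_{ij})$ in local coordinates $(x^i)$; the summation convention is used. $\Delta_gu=g^{ij}\nabla_i\nabla_ju$ is the Laplace–Beltrami operator; $\mathcal L_\xi$ is the Lie derivative with respect to $\xi=\xi^i(x)\frac{\partial}{\partial x^i}$; $f$ is a smooth function; $\mu$ and $b$ are smooth functions on $M$ (with $\mu$ constant where indicated). The equation is $H:=g^{ij}u_{ij}-\Gamma^iu_i+f(u)=0$ with $\Gamma^i=g^{pq}\Gamma^i_{pq}$. A Lie point symmetry is (generated by) a vector field $X=\xi^i(x,u)\partial_{x^i}+\eta(x,u)\partial_u$ on $M\times\mathbb R$ whose second prolongation satisfies $X^{(2)}H=0$ whenever $H=0$; groups are identified with their Lie algebras of infinitesimal generators. In part 1, "for an arbitrary $f$" refers to those $X$ which are Lie point symmetries for every smooth $f$. The equation is the Euler–Lagrange equation of the Lagrangian $L=\frac{\sqrt g}{2}g^{ij}u_iu_j-F(u)\sqrt g$, $F'=f$. Let $D_i=\partial_{x^i}+u_i\partial_u+u_{ij}\partial_{u_j}+\cdots$ be the total derivative and $X^{(1)}$ the first prolongation of $X$. A Lie point symmetry $X$ is a variational symmetry if $X^{(1)}L+L\,D_i\xi^i=0$; it is a divergence symmetry if $X^{(1)}L+L\,D_i\xi^i=D_i\varphi^i$ for some tuple $\varphi=(\varphi^i)$. A Noether symmetry is a variational or divergence symmetry.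
   Formalization: In 3) the claim reads: variational iff μ=0 or p=(n+2)/(n-2), with F=u^{p+1}/(p+1) for p≠-1. In 4.2), F=ku: Noether implies c=0, and b=c=0 iff X is variational or a divergence symmetry with φ vanishing at the zero jet, since with c=0 and b≠0 (e.g. ∂_u on flat space) X is Noether. *)

theory Defs
  imports "HOL-Analysis.Analysis" "HOL-Library.Multiset" "HOL-Library.Groups_Big_Fun"
begin

section \<open>Smooth functions between normed spaces\<close>

text \<open>Meant for open \<open>S\<close>.\<close>

primrec Ck_on :: "nat \<Rightarrow> 'a::real_normed_vector set \<Rightarrow> ('a \<Rightarrow> 'b::real_normed_vector) \<Rightarrow> bool" where
  "Ck_on 0 S f \<longleftrightarrow> continuous_on S f"
| "Ck_on (Suc k) S f \<longleftrightarrow>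
     (\<forall>x\<in>S. f differentiable (at x)) \<and> (\<forall>v. Ck_on k S (\<lambda>x. frechet_derivative f (at x) v))"

definition smooth_on :: "'a::real_normed_vector set \<Rightarrow> ('a \<Rightarrow> 'b::real_normed_vector) \<Rightarrow> bool" where
  "smooth_on S f \<longleftrightarrow> (\<forall>k. Ck_on k S f)"

definition pd :: "'n::finite \<Rightarrow> (real^'n \<Rightarrow> real) \<Rightarrow> real^'n \<Rightarrow> real" where
  "pd i h x = deriv (\<lambda>t. h (x + t *\<^sub>R axis i 1)) 0"

definition primitive_on :: "real set \<Rightarrow> (real \<Rightarrow> real) \<Rightarrow> (real \<Rightarrow> real) \<Rightarrow> bool" where
  "primitive_on J f F \<longleftrightarrow> (\<forall>u\<in>J. (F has_real_derivative f u) (at u))"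

section \<open>Pseudo-Riemannian manifolds\<close>

text \<open>
  A manifold is given by a smooth atlas on an open subset of a second countable Hausdorff space;
  its points are the points covered by the charts.  Geometric objects are given by their component
  functions in the charts, subject to the usual transformation laws.
\<close>

type_synonym ('m, 'n) chart = "'m set \<times> ('m \<Rightarrow> real^'n)"
type_synonym ('m, 'n, 'b) local_expr = "('m, 'n) chart \<Rightarrow> real^'n \<Rightarrow> 'b"

definition coord_dom :: "('m, 'n::finite) chart \<Rightarrow> (real^'n) set" where
  "coord_dom c = snd c ` fst c"

definition coord_inv :: "('m, 'n::finite) chart \<Rightarrow> real^'n \<Rightarrow> 'm" where
  "coord_inv c = inv_into (fst c) (snd c)"

definition is_chart :: "('m::topological_space, 'n::finite) chart \<Rightarrow> bool" where
  "is_chart c \<longleftrightarrow> open (fst c) \<and> open (coord_dom c) \<and>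
     homeomorphism (fst c) (coord_dom c) (snd c) (coord_inv c)"

definition transition :: "('m, 'n::finite) chart \<Rightarrow> ('m, 'n) chart \<Rightarrow> real^'n \<Rightarrow> real^'n" where
  "transition c d = snd d \<circ> coord_inv c"

definition overlap :: "('m, 'n::finite) chart \<Rightarrow> ('m, 'n) chart \<Rightarrow> (real^'n) set" where
  "overlap c d = snd c ` (fst c \<inter> fst d)"

definition jac :: "('m, 'n::finite) chart \<Rightarrow> ('m, 'n) chart \<Rightarrow> real^'n \<Rightarrow> real^'n^'n" where
  "jac c d x = matrix (frechet_derivative (transition c d) (at x))"

definition carrier :: "('m, 'n::finite) chart set \<Rightarrow> 'm set" where
  "carrier A = (\<Union>c\<in>A. fst c)"

definition smooth_manifold :: "('m::{t2_space,second_countable_topology}, 'n::finite) chart set \<Rightarrow> bool" where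
  "smooth_manifold A \<longleftrightarrow> carrier A \<noteq> {} \<and> (\<forall>c\<in>A. is_chart c) \<and>
     (\<forall>c\<in>A. \<forall>d\<in>A. smooth_on (overlap c d) (transition c d))"

definition pseudo_riemannian_manifold ::
  "('m::{t2_space,second_countable_topology}, 'n::finite) chart set \<Rightarrow>
   ('m, 'n, real^'n^'n) local_expr \<Rightarrow> bool" where
  "pseudo_riemannian_manifold A g \<longleftrightarrow> smooth_manifold A \<and>
     (\<forall>c\<in>A. smooth_on (coord_dom c) (g c) \<and>
        (\<forall>x\<in>coord_dom c. transpose (g c x) = g c x \<and> invertible (g c x))) \<and>
     (\<forall>c\<in>A. \<forall>d\<in>A. \<forall>x\<in>overlap c d.
        g c x = transpose (jac c d x) ** g d (transition c d x) ** jac c d x)"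

definition loc :: "('m \<Rightarrow> 'b) \<Rightarrow> ('m, 'n::finite, 'b) local_expr" where
  "loc h c x = h (coord_inv c x)"

definition smooth_scalar :: "('m, 'n::finite) chart set \<Rightarrow> ('m \<Rightarrow> real) \<Rightarrow> bool" where
  "smooth_scalar A h \<longleftrightarrow> (\<forall>c\<in>A. smooth_on (coord_dom c) (loc h c))"

definition vector_field :: "('m, 'n::finite) chart set \<Rightarrow> ('m, 'n, real^'n) local_expr \<Rightarrow> bool" where
  "vector_field A \<xi> \<longleftrightarrow> (\<forall>c\<in>A. smooth_on (coord_dom c) (\<xi> c)) \<and>
     (\<forall>c\<in>A. \<forall>d\<in>A. \<forall>x\<in>overlap c d. \<xi> d (transition c d x) = jac c d x *v \<xi> c x)"

definition vanishes :: "('m, 'n::finite) chart set \<Rightarrow> ('m, 'n, real) local_expr \<Rightarrow> bool" where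
  "vanishes A h \<longleftrightarrow> (\<forall>c\<in>A. \<forall>x\<in>coord_dom c. h c x = 0)"

subsection \<open>Christoffel symbols, Laplace-Beltrami operator, Lie derivative of the metric\<close>

text \<open>In a fixed chart, \<open>g\<close> is the component matrix \<open>(g\<^sub>i\<^sub>j)\<close>.\<close>

definition ginv :: "(real^'n \<Rightarrow> real^'n^'n) \<Rightarrow> 'n::finite \<Rightarrow> 'n \<Rightarrow> real^'n \<Rightarrow> real" where
  "ginv g i j x = matrix_inv (g x) $ i $ j"

definition christoffel :: "(real^'n \<Rightarrow> real^'n^'n) \<Rightarrow> 'n::finite \<Rightarrow> 'n \<Rightarrow> 'n \<Rightarrow> real^'n \<Rightarrow> real" where
  "christoffel g i p q x = (1/2) * (\<Sum>l\<in>UNIV. ginv g i l x *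
     (pd p (\<lambda>y. g y $ l $ q) x + pd q (\<lambda>y. g y $ l $ p) x - pd l (\<lambda>y. g y $ p $ q) x))"

definition christoffel_trace :: "(real^'n \<Rightarrow> real^'n^'n) \<Rightarrow> 'n::finite \<Rightarrow> real^'n \<Rightarrow> real" where
  "christoffel_trace g i x = (\<Sum>p\<in>UNIV. \<Sum>q\<in>UNIV. ginv g p q x * christoffel g i p q x)"

definition hessian :: "(real^'n \<Rightarrow> real^'n^'n) \<Rightarrow> (real^'n \<Rightarrow> real) \<Rightarrow> 'n::finite \<Rightarrow> 'n \<Rightarrow> real^'n \<Rightarrow> real" where
  "hessian g h i j x = pd i (pd j h) x - (\<Sum>k\<in>UNIV. christoffel g k i j x * pd k h x)"

definition laplace_beltrami ::
  "('m, 'n::finite, real^'n^'n) local_expr \<Rightarrow> ('m, 'n, real) local_expr \<Rightarrow> ('m, 'n, real) local_expr" where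
  "laplace_beltrami g h c x = (\<Sum>i\<in>UNIV. \<Sum>j\<in>UNIV. ginv (g c) i j x * hessian (g c) (h c) i j x)"

definition lie_metric ::
  "(real^'n \<Rightarrow> real^'n^'n) \<Rightarrow> (real^'n \<Rightarrow> real^'n) \<Rightarrow> 'n::finite \<Rightarrow> 'n \<Rightarrow> real^'n \<Rightarrow> real" where
  "lie_metric g \<xi> i j x = (\<Sum>k\<in>UNIV. \<xi> x $ k * pd k (\<lambda>y. g y $ i $ j) x
     + g x $ k $ j * pd i (\<lambda>y. \<xi> y $ k) x + g x $ i $ k * pd j (\<lambda>y. \<xi> y $ k) x)"

definition conformal_field ::
  "('m, 'n::finite) chart set \<Rightarrow> ('m, 'n, real^'n^'n) local_expr \<Rightarrow> ('m, 'n, real^'n) local_expr \<Rightarrow>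
   ('m, 'n, real) local_expr \<Rightarrow> bool" where
  "conformal_field A g \<xi> \<mu> \<longleftrightarrow> vector_field A \<xi> \<and>
     (\<forall>c\<in>A. \<forall>x\<in>coord_dom c. \<forall>i j. lie_metric (g c) (\<xi> c) i j x = \<mu> c x * g c x $ i $ j)"

section \<open>Jets and differential functions\<close>

text \<open>
  A jet assigns to the multiset of indices \<open>{#i\<^sub>1, \<dots>, i\<^sub>r#}\<close> the jet coordinate
  \<open>u\<^sub>i\<^sub>1\<^sub>\<dots>\<^sub>i\<^sub>r\<close>; thus \<open>u\<close> itself is the coordinate of \<open>{#}\<close>, and \<open>u\<^sub>i\<^sub>j = u\<^sub>j\<^sub>i\<close> is built in.
\<close>

type_synonym 'n jet = "'n multiset \<Rightarrow> real"
type_synonym 'n dfun = "real^'n \<Rightarrow> 'n jet \<Rightarrow> real"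

definition pd_x :: "'n::finite \<Rightarrow> 'n dfun \<Rightarrow> 'n dfun" where
  "pd_x i P x j = pd i (\<lambda>y. P y j) x"

definition pd_u :: "'n::finite multiset \<Rightarrow> 'n dfun \<Rightarrow> 'n dfun" where
  "pd_u I P x j = deriv (\<lambda>t. P x (j(I := t))) (j I)"

text \<open>The sum has finitely many nonzero terms, as \<open>P\<close> is to have finite order.\<close>

definition total_deriv :: "'n::finite \<Rightarrow> 'n dfun \<Rightarrow> 'n dfun" where
  "total_deriv i P x j = pd_x i P x j + Sum_any (\<lambda>I. j (add_mset i I) * pd_u I P x j)"

definition jet_dom :: "(real^'n) set \<Rightarrow> real set \<Rightarrow> ((real^'n) \<times> 'n::finite jet) set" where
  "jet_dom V J = {(x, j). x \<in> V \<and> j {#} \<in> J}"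

text \<open>
  For functions of finitely many of the coordinates, continuity for the product topology on jets is
  joint continuity in these coordinates, and smoothness is existence and continuity of all iterated
  partial derivatives.
\<close>

primrec jet_Ck :: "nat \<Rightarrow> (real^'n) set \<Rightarrow> real set \<Rightarrow> 'n::finite dfun \<Rightarrow> bool" where
  "jet_Ck 0 V J P \<longleftrightarrow> continuous_on (jet_dom V J) (\<lambda>(x, j). P x j)"
| "jet_Ck (Suc k) V J P \<longleftrightarrow> continuous_on (jet_dom V J) (\<lambda>(x, j). P x j) \<and>
     (\<forall>(x, j)\<in>jet_dom V J.
        (\<forall>i. (\<lambda>t. P (x + t *\<^sub>R axis i 1) j) differentiable (at 0)) \<and>
        (\<forall>I. (\<lambda>t. P x (j(I := t))) differentiable (at (j I)))) \<and>
     (\<forall>i. jet_Ck k V J (pd_x i P)) \<and> (\<forall>I. jet_Ck k V J (pd_u I P))"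

definition differential_function :: "(real^'n) set \<Rightarrow> real set \<Rightarrow> 'n::finite dfun \<Rightarrow> bool" where
  "differential_function V J P \<longleftrightarrow>
     (\<exists>r. \<forall>x\<in>V. \<forall>j j'. j {#} \<in> J \<longrightarrow> (\<forall>I. size I \<le> r \<longrightarrow> j I = j' I) \<longrightarrow> P x j = P x j') \<and>
     (\<forall>k. jet_Ck k V J P)"

subsection \<open>Prolongation of vector fields\<close>

text \<open>
  In a chart, the vector field is \<open>\<xi>\<^sup>i(x,u) \<partial>\<^sub>i + \<eta>(x,u) \<partial>\<^sub>u\<close>.  Its prolongation coefficients are
  \<open>\<eta>\<^sub>i = D\<^sub>i \<eta> - u\<^sub>k D\<^sub>i \<xi>\<^sup>k\<close> and \<open>\<eta>\<^sub>i\<^sub>l = D\<^sub>l \<eta>\<^sub>i - u\<^sub>i\<^sub>k D\<^sub>l \<xi>\<^sup>k\<close>.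
\<close>

definition xi_fun :: "(real^'n \<Rightarrow> real \<Rightarrow> real^'n) \<Rightarrow> 'n \<Rightarrow> 'n::finite dfun" where
  "xi_fun \<xi> k x j = \<xi> x (j {#}) $ k"

definition eta_fun :: "(real^'n \<Rightarrow> real \<Rightarrow> real) \<Rightarrow> 'n::finite dfun" where
  "eta_fun \<eta> x j = \<eta> x (j {#})"

definition eta1 ::
  "(real^'n \<Rightarrow> real \<Rightarrow> real^'n) \<Rightarrow> (real^'n \<Rightarrow> real \<Rightarrow> real) \<Rightarrow> 'n \<Rightarrow> 'n::finite dfun" where
  "eta1 \<xi> \<eta> i x j = total_deriv i (eta_fun \<eta>) x j
     - (\<Sum>k\<in>UNIV. j {#k#} * total_deriv i (xi_fun \<xi> k) x j)"

definition eta2 ::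
  "(real^'n \<Rightarrow> real \<Rightarrow> real^'n) \<Rightarrow> (real^'n \<Rightarrow> real \<Rightarrow> real) \<Rightarrow> 'n \<Rightarrow> 'n \<Rightarrow> 'n::finite dfun" where
  "eta2 \<xi> \<eta> i l x j = total_deriv l (eta1 \<xi> \<eta> i) x j
     - (\<Sum>k\<in>UNIV. j {#i, k#} * total_deriv l (xi_fun \<xi> k) x j)"

definition prolong1 ::
  "(real^'n \<Rightarrow> real \<Rightarrow> real^'n) \<Rightarrow> (real^'n \<Rightarrow> real \<Rightarrow> real) \<Rightarrow> 'n::finite dfun \<Rightarrow> 'n dfun" where
  "prolong1 \<xi> \<eta> P x j = (\<Sum>k\<in>UNIV. xi_fun \<xi> k x j * pd_x k P x j) + eta_fun \<eta> x j * pd_u {#} P x j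
     + (\<Sum>i\<in>UNIV. eta1 \<xi> \<eta> i x j * pd_u {#i#} P x j)"

text \<open>The weight makes each second order coordinate \<open>u\<^sub>i\<^sub>l = u\<^sub>l\<^sub>i\<close> count once.\<close>

definition prolong2 ::
  "(real^'n \<Rightarrow> real \<Rightarrow> real^'n) \<Rightarrow> (real^'n \<Rightarrow> real \<Rightarrow> real) \<Rightarrow> 'n::finite dfun \<Rightarrow> 'n dfun" where
  "prolong2 \<xi> \<eta> P x j = prolong1 \<xi> \<eta> P x j
     + (\<Sum>i\<in>UNIV. \<Sum>l\<in>UNIV. (if i = l then 1 else 1/2) * eta2 \<xi> \<eta> i l x j * pd_u {#i, l#} P x j)"

section \<open>The Poisson equation and its symmetries\<close>

definition poisson :: "(real^'n \<Rightarrow> real^'n^'n) \<Rightarrow> (real \<Rightarrow> real) \<Rightarrow> 'n::finite dfun" where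
  "poisson g f x j = (\<Sum>i\<in>UNIV. \<Sum>l\<in>UNIV. ginv g i l x * j {#i, l#})
     - (\<Sum>i\<in>UNIV. christoffel_trace g i x * j {#i#}) + f (j {#})"

text \<open>As the metric may be indefinite, \<open>\<surd>g\<close> means \<open>\<surd>\<bar>det g\<bar>\<close>.\<close>

definition lagrangian :: "(real^'n \<Rightarrow> real^'n^'n) \<Rightarrow> (real \<Rightarrow> real) \<Rightarrow> 'n::finite dfun" where
  "lagrangian g F x j =
     sqrt \<bar>det (g x)\<bar> / 2 * (\<Sum>i\<in>UNIV. \<Sum>l\<in>UNIV. ginv g i l x * j {#i#} * j {#l#})
     - F (j {#}) * sqrt \<bar>det (g x)\<bar>"

text \<open>
  The dependent variable takes values in the open set \<open>J\<close>, the domain of \<open>f\<close> (usually \<open>UNIV\<close>);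
  vector fields live on \<open>M \<times> J\<close>.
\<close>

definition vector_field_prod ::
  "('m, 'n::finite) chart set \<Rightarrow> real set \<Rightarrow> ('m, 'n, real \<Rightarrow> real^'n) local_expr \<Rightarrow>
   ('m, 'n, real \<Rightarrow> real) local_expr \<Rightarrow> bool" where
  "vector_field_prod A J \<xi> \<eta> \<longleftrightarrow>
     (\<forall>c\<in>A. smooth_on (coord_dom c \<times> J) (\<lambda>(x, u). \<xi> c x u) \<and>
            smooth_on (coord_dom c \<times> J) (\<lambda>(x, u). \<eta> c x u)) \<and>
     (\<forall>c\<in>A. \<forall>d\<in>A. \<forall>x\<in>overlap c d. \<forall>u\<in>J.
        \<xi> d (transition c d x) u = jac c d x *v \<xi> c x u \<and> \<eta> d (transition c d x) u = \<eta> c x u)"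

definition lie_point_symmetry ::
  "('m, 'n::finite) chart set \<Rightarrow> ('m, 'n, real^'n^'n) local_expr \<Rightarrow> real set \<Rightarrow> (real \<Rightarrow> real) \<Rightarrow>
   ('m, 'n, real \<Rightarrow> real^'n) local_expr \<Rightarrow> ('m, 'n, real \<Rightarrow> real) local_expr \<Rightarrow> bool" where
  "lie_point_symmetry A g J f \<xi> \<eta> \<longleftrightarrow> (\<forall>c\<in>A. \<forall>(x, j)\<in>jet_dom (coord_dom c) J.
     poisson (g c) f x j = 0 \<longrightarrow> prolong2 (\<xi> c) (\<eta> c) (poisson (g c) f) x j = 0)"

definition lagrangian_variation ::
  "(real^'n \<Rightarrow> real^'n^'n) \<Rightarrow> (real \<Rightarrow> real) \<Rightarrow> (real^'n \<Rightarrow> real \<Rightarrow> real^'n) \<Rightarrow>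
   (real^'n \<Rightarrow> real \<Rightarrow> real) \<Rightarrow> 'n::finite dfun" where
  "lagrangian_variation g F \<xi> \<eta> x j = prolong1 \<xi> \<eta> (lagrangian g F) x j
     + lagrangian g F x j * (\<Sum>i\<in>UNIV. total_deriv i (xi_fun \<xi> i) x j)"

definition variational_symmetry ::
  "('m, 'n::finite) chart set \<Rightarrow> ('m, 'n, real^'n^'n) local_expr \<Rightarrow> real set \<Rightarrow> (real \<Rightarrow> real) \<Rightarrow>
   (real \<Rightarrow> real) \<Rightarrow> ('m, 'n, real \<Rightarrow> real^'n) local_expr \<Rightarrow> ('m, 'n, real \<Rightarrow> real) local_expr \<Rightarrow> bool" where
  "variational_symmetry A g J f F \<xi> \<eta> \<longleftrightarrow> lie_point_symmetry A g J f \<xi> \<eta> \<and>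
     (\<forall>c\<in>A. \<forall>(x, j)\<in>jet_dom (coord_dom c) J. lagrangian_variation (g c) F (\<xi> c) (\<eta> c) x j = 0)"

definition divergence_symmetry_with ::
  "('m, 'n::finite) chart set \<Rightarrow> ('m, 'n, real^'n^'n) local_expr \<Rightarrow> real set \<Rightarrow> (real \<Rightarrow> real) \<Rightarrow>
   (real \<Rightarrow> real) \<Rightarrow> ('m, 'n, real \<Rightarrow> real^'n) local_expr \<Rightarrow> ('m, 'n, real \<Rightarrow> real) local_expr \<Rightarrow>
   (('m, 'n) chart \<Rightarrow> 'n \<Rightarrow> 'n dfun) \<Rightarrow> bool" where
  "divergence_symmetry_with A g J f F \<xi> \<eta> \<phi> \<longleftrightarrow> lie_point_symmetry A g J f \<xi> \<eta> \<and>
     (\<forall>c\<in>A. (\<forall>i. differential_function (coord_dom c) J (\<phi> c i)) \<and>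
       (\<forall>(x, j)\<in>jet_dom (coord_dom c) J.
          lagrangian_variation (g c) F (\<xi> c) (\<eta> c) x j = (\<Sum>i\<in>UNIV. total_deriv i (\<phi> c i) x j)))"

definition divergence_symmetry ::
  "('m, 'n::finite) chart set \<Rightarrow> ('m, 'n, real^'n^'n) local_expr \<Rightarrow> real set \<Rightarrow> (real \<Rightarrow> real) \<Rightarrow>
   (real \<Rightarrow> real) \<Rightarrow> ('m, 'n, real \<Rightarrow> real^'n) local_expr \<Rightarrow> ('m, 'n, real \<Rightarrow> real) local_expr \<Rightarrow> bool" where
  "divergence_symmetry A g J f F \<xi> \<eta> \<longleftrightarrow> (\<exists>\<phi>. divergence_symmetry_with A g J f F \<xi> \<eta> \<phi>)"

definition noether_symmetry ::
  "('m, 'n::finite) chart set \<Rightarrow> ('m, 'n, real^'n^'n) local_expr \<Rightarrow> real set \<Rightarrow> (real \<Rightarrow> real) \<Rightarrow>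
   (real \<Rightarrow> real) \<Rightarrow> ('m, 'n, real \<Rightarrow> real^'n) local_expr \<Rightarrow> ('m, 'n, real \<Rightarrow> real) local_expr \<Rightarrow> bool" where
  "noether_symmetry A g J f F \<xi> \<eta> \<longleftrightarrow>
     variational_symmetry A g J f F \<xi> \<eta> \<or> divergence_symmetry A g J f F \<xi> \<eta>"

text \<open>
  Noether symmetries whose tuple \<open>\<phi>\<close> can be chosen without a purely \<open>x\<close>-dependent part, that is,
  vanishing at the zero jet.  This is strictly stronger than \<open>noether_symmetry\<close>: for the flat metric,
  \<open>\<partial>\<^sub>u\<close> changes \<open>L = \<bar>\<nabla>u\<bar>\<^sup>2/2 - k u\<close> by \<open>-k = D\<^sub>1(-k x\<^sup>1)\<close>.
\<close>

definition reduced_noether_symmetry ::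
  "('m, 'n::finite) chart set \<Rightarrow> ('m, 'n, real^'n^'n) local_expr \<Rightarrow> real set \<Rightarrow> (real \<Rightarrow> real) \<Rightarrow>
   (real \<Rightarrow> real) \<Rightarrow> ('m, 'n, real \<Rightarrow> real^'n) local_expr \<Rightarrow> ('m, 'n, real \<Rightarrow> real) local_expr \<Rightarrow> bool" where
  "reduced_noether_symmetry A g J f F \<xi> \<eta> \<longleftrightarrow> variational_symmetry A g J f F \<xi> \<eta> \<or>
     (\<exists>\<phi>. divergence_symmetry_with A g J f F \<xi> \<eta> \<phi> \<and>
        (\<forall>c\<in>A. \<forall>x\<in>coord_dom c. \<forall>i. \<phi> c i x (\<lambda>_. 0) = 0))"

definition lift_field :: "('m, 'n::finite, real^'n) local_expr \<Rightarrow> ('m, 'n, real \<Rightarrow> real^'n) local_expr" where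
  "lift_field \<xi> c x u = \<xi> c x"

text \<open>The infinitesimal isometries, as vector fields on \<open>M \<times> J\<close>.\<close>

definition isometry_generator ::
  "('m, 'n::finite) chart set \<Rightarrow> ('m, 'n, real^'n^'n) local_expr \<Rightarrow> real set \<Rightarrow>
   ('m, 'n, real \<Rightarrow> real^'n) local_expr \<Rightarrow> ('m, 'n, real \<Rightarrow> real) local_expr \<Rightarrow> bool" where
  "isometry_generator A g J \<xi> \<eta> \<longleftrightarrow> (\<exists>\<zeta>. conformal_field A g \<zeta> (\<lambda>_ _. 0) \<and>
     (\<forall>c\<in>A. \<forall>x\<in>coord_dom c. \<forall>u\<in>J. \<xi> c x u = lift_field \<zeta> c x u \<and> \<eta> c x u = 0))"

text \<open>
  The function \<open>f(u) = u\<^sup>p\<close> on an open set \<open>J\<close> on which it is smooth: positive \<open>u\<close> for real \<open>p\<close>, and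
  any \<open>u\<close> (nonzero if \<open>p < 0\<close>) for integral \<open>p\<close>.
\<close>

definition power_function_on :: "real set \<Rightarrow> real \<Rightarrow> (real \<Rightarrow> real) \<Rightarrow> bool" where
  "power_function_on J p f \<longleftrightarrow> open J \<and> J \<noteq> {} \<and>
     (J \<subseteq> {0<..} \<and> (\<forall>u\<in>J. f u = u powr p) \<or>
      (\<exists>k::int. p = of_int k \<and> (k \<ge> 0 \<or> 0 \<notin> J) \<and> (\<forall>u\<in>J. f u = u powi k)))"

text \<open>
  The primitive \<open>F(u) = u\<^sup>p\<^sup>+\<^sup>1/(p+1)\<close> of \<open>f(u) = u\<^sup>p\<close>, without additive constant unless \<open>p = -1\<close>.
\<close>

definition power_primitive_on :: "real set \<Rightarrow> real \<Rightarrow> (real \<Rightarrow> real) \<Rightarrow> (real \<Rightarrow> real) \<Rightarrow> bool" where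
  "power_primitive_on J p f F \<longleftrightarrow> primitive_on J f F \<and>
     (p \<noteq> -1 \<longrightarrow> (\<forall>u\<in>J. F u = u * f u / (p + 1)))"

definition critical_sobolev_exponent :: "real \<Rightarrow> real" where
  "critical_sobolev_exponent n = 2 * n / (n - 2)"

end

theory Submission
  imports Defs
begin

text \<open>
  In a chart, the variation of the Lagrangian under \<open>X\<close> is a polynomial in the first derivatives
  \<open>u\<^sub>i\<close>.  If it vanishes, the cubic part forces \<open>\<xi>\<close> to depend on \<open>x\<close> only, and the quadratic part forces
  \<open>\<xi>\<close> to be conformal, \<open>L\<^sub>\<xi> g = \<mu> g\<close>, with \<open>\<eta>\<^sub>u = (2 - n)/4 \<mu>\<close>.  For
  \<open>\<eta> = ((2 - n)/4 \<mu> + c) u + \<beta>\<close> the variation is \<open>c \<surd>g g\<^sup>i\<^sup>j u\<^sub>i u\<^sub>j\<close> plus a total divergence (of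
  \<open>\<surd>g g\<^sup>i\<^sup>j (\<mu>\<^sub>j u\<^sup>2 (2 - n)/8 + \<beta>\<^sub>j u)\<close>) plus an expression of order zero.  In
  the cases of the theorem the latter is a locally constant multiple of \<open>\<surd>g div \<xi>\<close>, itself a
  divergence; for \<open>f = k\<close> there is also the term \<open>- k \<beta> \<surd>g\<close>, the value at the zero jet.
  Conversely, the term with \<open>c\<close>
  is not a divergence, since the Euler operator \<open>\<Sum>\<^sub>K (-D)\<^sub>K \<partial>/\<partial>u\<^sub>K\<close> annihilates divergences of any order
  but contributes \<open>-2 c \<surd>g g\<^sup>i\<^sup>j u\<^sub>i\<^sub>j\<close> here.  The Lie point symmetry condition for conformal \<open>\<xi>\<close> is the
  derivative with respect to \<open>u\<close> of the condition of order zero.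
\<close>

section \<open>Smooth functions\<close>

text \<open>The factor (2 - n)/4 arises because the trace of
  \<open>L\<^sub>\<xi> g = \<mu> g\<close> gives div \<xi> = n \<mu>/2, and the quadratic terms
  cancel when div \<xi>/2 + \<eta>_u = \<mu>/2. The critical exponent is the p with 1/(1 - p) = (2 -
  n)/4. The main obstacle is that \<open>\<phi>\<close> may involve derivatives of any order, so
  that its divergence cannot be expanded explicitly. The Euler operator iterates total derivatives
  along multisets and hence needs them to commute. Jets are functions on all multisets,
  differentiated one coordinate at a time, so the symmetry of second derivatives is proved for two
  real variables and pulled back along coordinate surfaces. Covariant calculus is avoided by
  \<Gamma>^i = - d_j g^{ij} - g^{ij} W_j with W_j = d_j log sqrt g; differentiating the conformal
  equation and its trace then yields the identity that the second prolongation requires. That a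
  symmetry for all f is an isometry is read off from affine f alone.\<close>

lemma frechet_derivative_cong_open:
  assumes "open S" "x \<in> S" "\<And>y. y \<in> S \<Longrightarrow> f y = g y"
  shows "frechet_derivative f (at x) = frechet_derivative g (at x)"
proof -
  have "(f has_derivative f') (at x) \<longleftrightarrow> (g has_derivative f') (at x)" for f'
    using has_derivative_transform_within_open[OF _ assms(1,2)] assms(3) by metis
  then show ?thesis unfolding frechet_derivative_def by simp
qed

text \<open>The closure rules below know derivatives only through formulas valid on
  \<open>S\<close>; this transfers their regularity to \<open>frechet_derivative\<close> itself,
  which for open \<open>S\<close> depends only on values near the point.\<close>

lemma Ck_on_cong_imp:
  assumes "open S"
  shows "(\<And>x. x \<in> S \<Longrightarrow> f x = g x) \<Longrightarrow> Ck_on k S f \<Longrightarrow> Ck_on k S g"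
proof (induction k arbitrary: f g)
  case 0
  then show ?case by (metis Ck_on.simps(1) continuous_on_cong)
next
  case (Suc k)
  have "g differentiable (at x)" if "x \<in> S" for x
    using Suc.prems that assms differentiable_transform_within
    by (metis Ck_on.simps(2) differentiable_def has_derivative_transform_within_open)
  moreover have "Ck_on k S (\<lambda>x. frechet_derivative g (at x) v)" for v
    by (rule Suc.IH[of "\<lambda>x. frechet_derivative f (at x) v"])
      (use Suc.prems frechet_derivative_cong_open[OF assms _ Suc.prems(1)] in auto)
  ultimately show ?case by simp
qed

lemma smooth_on_cong:
  assumes "open S" "smooth_on S f" "\<And>x. x \<in> S \<Longrightarrow> f x = g x"
  shows "smooth_on S g"
  using assms Ck_on_cong_imp unfolding smooth_on_def by blast

text \<open>By Leibniz, the derivative of a product still contains an undifferentiated factor, for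
  which the induction step needs the lower regularity.\<close>

lemma Ck_on_Suc_imp: "Ck_on (Suc k) S f \<Longrightarrow> Ck_on k S f"
proof (induction k arbitrary: f)
  case 0
  then show ?case
    by (auto intro!: continuous_at_imp_continuous_on differentiable_imp_continuous_within)
next
  case (Suc k)
  then show ?case by (metis Ck_on.simps(2))
qed

lemma Ck_on_const: "Ck_on k S (\<lambda>_. c)"
  by (induction k arbitrary: c) (auto simp: frechet_derivative_const)

lemma Ck_on_add:
  assumes "open S"
  shows "Ck_on k S f \<Longrightarrow> Ck_on k S g \<Longrightarrow> Ck_on k S (\<lambda>x. f x + g x)"
proof (induction k arbitrary: f g)
  case 0
  then show ?case by (auto intro: continuous_intros)
next
  case (Suc k)
  have d: "((\<lambda>x. f x + g x) has_derivative
      (\<lambda>v. frechet_derivative f (at x) v + frechet_derivative g (at x) v)) (at x)" if "x \<in> S" for x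
    using Suc.prems that by (auto intro!: has_derivative_add simp: frechet_derivative_works)
  have "Ck_on k S (\<lambda>x. frechet_derivative (\<lambda>x. f x + g x) (at x) v)" for v
    by (rule Ck_on_cong_imp[OF assms _ Suc.IH[of "\<lambda>x. frechet_derivative f (at x) v" "\<lambda>x. frechet_derivative g (at x) v"]])
      (use Suc.prems frechet_derivative_at[OF d] in \<open>auto dest: fun_cong\<close>)
  then show ?case using Suc.prems by auto
qed

lemma Ck_on_bounded_linear:
  assumes "open S" "bounded_linear L"
  shows "Ck_on k S f \<Longrightarrow> Ck_on k S (\<lambda>x. L (f x))"
proof (induction k arbitrary: f)
  case 0
  then show ?case using assms by (auto intro: bounded_linear.continuous_on)
next
  case (Suc k)
  have d: "((\<lambda>x. L (f x)) has_derivative (\<lambda>v. L (frechet_derivative f (at x) v))) (at x)" if "x \<in> S" for x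
    using bounded_linear.has_derivative[OF assms(2)] Suc.prems that
    by (auto simp: frechet_derivative_works)
  have "Ck_on k S (\<lambda>x. frechet_derivative (\<lambda>x. L (f x)) (at x) v)" for v
    by (rule Ck_on_cong_imp[OF assms(1) _ Suc.IH[of "\<lambda>x. frechet_derivative f (at x) v"]])
      (use Suc.prems frechet_derivative_at[OF d] in \<open>auto dest: fun_cong\<close>)
  then show ?case using d by (auto simp: differentiable_def)
qed

lemma Ck_on_mult:
  fixes f g :: "'a::real_normed_vector \<Rightarrow> real"
  assumes "open S"
  shows "Ck_on k S f \<Longrightarrow> Ck_on k S g \<Longrightarrow> Ck_on k S (\<lambda>x. f x * g x)"
proof (induction k arbitrary: f g)
  case 0
  then show ?case by (auto intro: continuous_intros)
next
  case (Suc k)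
  have d: "((\<lambda>x. f x * g x) has_derivative
      (\<lambda>v. f x * frechet_derivative g (at x) v + frechet_derivative f (at x) v * g x)) (at x)" if "x \<in> S" for x
    using Suc.prems that by (auto intro!: has_derivative_mult simp: frechet_derivative_works)
  have "Ck_on k S (\<lambda>x. frechet_derivative (\<lambda>x. f x * g x) (at x) v)" for v
  proof (rule Ck_on_cong_imp[OF assms])
    show "Ck_on k S (\<lambda>x. f x * frechet_derivative g (at x) v + frechet_derivative f (at x) v * g x)"
      using Suc.prems Suc.IH[of f "\<lambda>x. frechet_derivative g (at x) v"]
        Suc.IH[of "\<lambda>x. frechet_derivative f (at x) v" g] Ck_on_Suc_imp[of k S f] Ck_on_Suc_imp[of k S g]
      by (auto intro!: Ck_on_add[OF assms])
  qed (use frechet_derivative_at[OF d] in \<open>auto dest: fun_cong\<close>)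
  then show ?case using d by (auto simp: differentiable_def)
qed

text \<open>The derivative of 1/f is again built from 1/f and f', so the induction keeps the
  function and only raises k.\<close>

lemma Ck_on_inverse:
  fixes f :: "'a::real_normed_vector \<Rightarrow> real"
  assumes "open S" and nz: "\<And>x. x \<in> S \<Longrightarrow> f x \<noteq> 0"
  shows "Ck_on k S f \<Longrightarrow> Ck_on k S (\<lambda>x. inverse (f x))"
proof (induction k)
  case 0
  then show ?case using nz by (auto intro: continuous_intros)
next
  case (Suc k)
  have d: "((\<lambda>x. inverse (f x)) has_derivative
      (\<lambda>v. - (inverse (f x) * frechet_derivative f (at x) v * inverse (f x)))) (at x)" if "x \<in> S" for x
    using Suc.prems that nz by (intro Deriv.has_derivative_inverse) (auto simp: frechet_derivative_works)
  have "Ck_on k S (\<lambda>x. frechet_derivative (\<lambda>x. inverse (f x)) (at x) v)" for v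
  proof (rule Ck_on_cong_imp[OF assms(1)])
    show "Ck_on k S (\<lambda>x. - (inverse (f x) * frechet_derivative f (at x) v * inverse (f x)))"
      using Suc.prems Suc.IH Ck_on_Suc_imp[of k S f]
      by (intro Ck_on_bounded_linear[OF assms(1) bounded_linear_minus] Ck_on_mult assms(1))
        (auto simp: bounded_linear_ident)
  qed (use frechet_derivative_at[OF d] in \<open>auto dest: fun_cong\<close>)
  then show ?case using d by (auto simp: differentiable_def)
qed

text \<open>With the derivative written as sqrt|f| f'/(2 f), both signs of f obey one formula in
  which the function itself recurs, so the induction runs as for the inverse. The volume density of
  an indefinite metric has this form.\<close>

lemma Ck_on_sqrt_abs:
  fixes f :: "'a::real_normed_vector \<Rightarrow> real"
  assumes "open S" and nz: "\<And>x. x \<in> S \<Longrightarrow> f x \<noteq> 0"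
  shows "Ck_on k S f \<Longrightarrow> Ck_on k S (\<lambda>x. sqrt \<bar>f x\<bar>)"
proof (induction k)
  case 0
  then show ?case using nz by (auto intro: continuous_intros)
next
  case (Suc k)
  have d: "((\<lambda>x. sqrt \<bar>f x\<bar>) has_derivative
      (\<lambda>v. 1/2 * (sqrt \<bar>f x\<bar> * (inverse (f x) * frechet_derivative f (at x) v)))) (at x)" if "x \<in> S" for x
  proof -
    have D: "((\<lambda>u. sqrt \<bar>u\<bar>) has_real_derivative 1/2 * (sqrt \<bar>u\<bar> * inverse u)) (at u)" if "u \<noteq> 0" for u :: real
    proof (cases "u > 0")
      case True
      have "(sqrt has_real_derivative inverse (sqrt u) / 2) (at u)"
        by (rule DERIV_real_sqrt[OF True])
      then have "((\<lambda>u. sqrt \<bar>u\<bar>) has_real_derivative inverse (sqrt u) / 2) (at u)"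
        by (rule has_field_derivative_transform_within_open[of _ _ _ "{0<..}"]) (use True in auto)
      moreover have "inverse (sqrt u) / 2 = 1/2 * (sqrt \<bar>u\<bar> * inverse u)"
        using True real_sqrt_mult_self[of u] by (simp add: field_simps)
      ultimately show ?thesis by simp
    next
      case False
      with that have u: "u < 0" by simp
      have "((\<lambda>u. sqrt (- u)) has_real_derivative inverse (sqrt (-u)) / 2 * (-1)) (at u)"
        by (rule DERIV_chain2[of sqrt]) (use u in \<open>auto intro!: derivative_eq_intros DERIV_real_sqrt\<close>)
      then have "((\<lambda>u. sqrt \<bar>u\<bar>) has_real_derivative inverse (sqrt (-u)) / 2 * (-1)) (at u)"
        by (rule has_field_derivative_transform_within_open[of _ _ _ "{..<0}"]) (use u in auto)
      moreover have "inverse (sqrt (-u)) / 2 * (-1) = 1/2 * (sqrt \<bar>u\<bar> * inverse u)"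
        using u real_sqrt_mult_self[of "-u"] by (simp add: field_simps)
      ultimately show ?thesis by metis
    qed
    have "(f has_derivative frechet_derivative f (at x)) (at x)"
      using Suc.prems that by (auto simp: frechet_derivative_works)
    from DERIV_compose_FDERIV[OF D[OF nz[OF that]] this] show ?thesis
      by (simp add: mult_ac)
  qed
  have "Ck_on k S (\<lambda>x. frechet_derivative (\<lambda>x. sqrt \<bar>f x\<bar>) (at x) v)" for v
  proof (rule Ck_on_cong_imp[OF assms(1)])
    show "Ck_on k S (\<lambda>x. 1/2 * (sqrt \<bar>f x\<bar> * (inverse (f x) * frechet_derivative f (at x) v)))"
      using Suc.prems Suc.IH Ck_on_Suc_imp[of k S f]
      by (intro Ck_on_mult Ck_on_const Ck_on_inverse assms) auto
  qed (simp add: fun_cong[OF frechet_derivative_at[OF d], symmetric])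
  then show ?case using d by (auto simp: differentiable_def)
qed

lemma smooth_on_const: "smooth_on S (\<lambda>_. c)"
  by (simp add: smooth_on_def Ck_on_const)

lemma smooth_on_add: "open S \<Longrightarrow> smooth_on S f \<Longrightarrow> smooth_on S g \<Longrightarrow> smooth_on S (\<lambda>x. f x + g x)"
  by (simp add: smooth_on_def Ck_on_add)

lemma smooth_on_mult:
  fixes f g :: "'a::real_normed_vector \<Rightarrow> real"
  shows "open S \<Longrightarrow> smooth_on S f \<Longrightarrow> smooth_on S g \<Longrightarrow> smooth_on S (\<lambda>x. f x * g x)"
  by (simp add: smooth_on_def Ck_on_mult)

lemma smooth_on_bounded_linear:
  "open S \<Longrightarrow> bounded_linear L \<Longrightarrow> smooth_on S f \<Longrightarrow> smooth_on S (\<lambda>x. L (f x))"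
  by (simp add: smooth_on_def Ck_on_bounded_linear)

lemma smooth_on_uminus: "open S \<Longrightarrow> smooth_on S f \<Longrightarrow> smooth_on S (\<lambda>x. - f x)"
  by (rule smooth_on_bounded_linear[of S uminus]) (auto intro: bounded_linear_minus bounded_linear_ident)

lemma smooth_on_diff: "open S \<Longrightarrow> smooth_on S f \<Longrightarrow> smooth_on S g \<Longrightarrow> smooth_on S (\<lambda>x. f x - g x)"
  using smooth_on_add[of S f "\<lambda>x. - g x"] smooth_on_uminus[of S g] by simp

lemma smooth_on_sum:
  assumes "open S" "\<And>i. i \<in> I \<Longrightarrow> smooth_on S (f i)"
  shows "smooth_on S (\<lambda>x. \<Sum>i\<in>I. f i x)"
proof (cases "finite I")
  case True
  then show ?thesis using assms
    by (induction I) (auto intro: smooth_on_const smooth_on_add)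
qed (simp add: smooth_on_const)

lemma smooth_on_prod:
  fixes f :: "'i \<Rightarrow> 'a::real_normed_vector \<Rightarrow> real"
  assumes "open S" "\<And>i. i \<in> I \<Longrightarrow> smooth_on S (f i)"
  shows "smooth_on S (\<lambda>x. \<Prod>i\<in>I. f i x)"
proof (cases "finite I")
  case True
  then show ?thesis using assms
    by (induction I) (auto intro: smooth_on_const smooth_on_mult)
qed (simp add: smooth_on_const)

lemma smooth_on_inverse:
  fixes f :: "'a::real_normed_vector \<Rightarrow> real"
  shows "open S \<Longrightarrow> smooth_on S f \<Longrightarrow> (\<And>x. x \<in> S \<Longrightarrow> f x \<noteq> 0) \<Longrightarrow> smooth_on S (\<lambda>x. inverse (f x))"
  by (simp add: smooth_on_def Ck_on_inverse)

lemma smooth_on_sqrt_abs: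
  fixes f :: "'a::real_normed_vector \<Rightarrow> real"
  shows "open S \<Longrightarrow> smooth_on S f \<Longrightarrow> (\<And>x. x \<in> S \<Longrightarrow> f x \<noteq> 0) \<Longrightarrow> smooth_on S (\<lambda>x. sqrt \<bar>f x\<bar>)"
  by (simp add: smooth_on_def Ck_on_sqrt_abs)

lemma smooth_on_differentiable: "smooth_on S f \<Longrightarrow> x \<in> S \<Longrightarrow> f differentiable (at x)"
  unfolding smooth_on_def by (metis Ck_on.simps(2))

lemma smooth_on_frechet: "smooth_on S f \<Longrightarrow> smooth_on S (\<lambda>x. frechet_derivative f (at x) v)"
  unfolding smooth_on_def by (metis Ck_on.simps(2))

lemma smooth_on_continuous: "smooth_on S f \<Longrightarrow> continuous_on S f"
  unfolding smooth_on_def by (metis Ck_on.simps(1))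

text \<open>The derivative of the slice along v is the slice of the derivative along (v, 0), so
  regularity passes down order by order.\<close>

lemma Ck_on_slice:
  assumes "open S" "open J" "u \<in> J"
  shows "Ck_on k (S \<times> J) f \<Longrightarrow> Ck_on k S (\<lambda>x. f (x, u))"
proof (induction k arbitrary: f)
  case 0
  then show ?case using assms by (auto intro!: continuous_on_compose2[of "S \<times> J" f] continuous_intros)
next
  case (Suc k)
  have d: "((\<lambda>x. f (x, u)) has_derivative (\<lambda>v. frechet_derivative f (at (x, u)) (v, 0))) (at x)" if "x \<in> S" for x
  proof -
    have "((\<lambda>x. (x, u)) has_derivative (\<lambda>v. (v, 0))) (at x)"
      by (auto intro!: derivative_eq_intros)
    moreover have "(f has_derivative frechet_derivative f (at (x, u))) (at (x, u))"
      using Suc.prems that assms by (auto simp: frechet_derivative_works)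
    ultimately show ?thesis by (rule has_derivative_compose)
  qed
  have "Ck_on k S (\<lambda>x. frechet_derivative (\<lambda>x. f (x, u)) (at x) v)" for v
    by (rule Ck_on_cong_imp[OF assms(1) _ Suc.IH[of "\<lambda>z. frechet_derivative f (at z) (v, 0)"]])
      (use Suc.prems frechet_derivative_at[OF d] in \<open>auto dest: fun_cong\<close>)
  then show ?case using d by (auto simp: differentiable_def)
qed

lemma smooth_on_slice:
  "open S \<Longrightarrow> open J \<Longrightarrow> u \<in> J \<Longrightarrow> smooth_on (S \<times> J) f \<Longrightarrow> smooth_on S (\<lambda>x. f (x, u))"
  by (simp add: smooth_on_def Ck_on_slice)

section \<open>Partial derivatives\<close>

lemma has_pd:
  assumes "h differentiable (at x)"
  shows "((\<lambda>t. h (x + t *\<^sub>R axis i 1)) has_real_derivative frechet_derivative h (at x) (axis i 1)) (at 0)"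
proof -
  have h: "(h has_derivative frechet_derivative h (at x)) (at (x + 0 *\<^sub>R axis i 1))"
    using assms by (simp add: frechet_derivative_works)
  have "((\<lambda>t. x + t *\<^sub>R axis i 1) has_derivative (\<lambda>t. t *\<^sub>R axis i 1)) (at (0::real))"
    by (auto intro!: derivative_eq_intros)
  from has_derivative_compose[OF this h]
  have "((\<lambda>t. h (x + t *\<^sub>R axis i 1)) has_derivative (\<lambda>t. frechet_derivative h (at x) (t *\<^sub>R axis i 1))) (at 0)" .
  moreover have "frechet_derivative h (at x) (t *\<^sub>R axis i 1) = frechet_derivative h (at x) (axis i 1) * t" for t
    using linear_frechet_derivative[OF assms] by (simp add: linear_cmul)
  ultimately show ?thesis by (simp add: has_field_derivative_def)
qed

lemma pd_frechet: "h differentiable (at x) \<Longrightarrow> pd i h x = frechet_derivative h (at x) (axis i 1)"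
  unfolding pd_def by (rule DERIV_imp_deriv) (rule has_pd)

lemma pd_has_deriv:
  "h differentiable (at x) \<Longrightarrow> ((\<lambda>t. h (x + t *\<^sub>R axis i 1)) has_real_derivative pd i h x) (at 0)"
  using has_pd pd_frechet by metis

lemma pdI: "((\<lambda>t. h (x + t *\<^sub>R axis i 1)) has_real_derivative d) (at 0) \<Longrightarrow> pd i h x = d"
  unfolding pd_def by (rule DERIV_imp_deriv)

lemma line_nhds:
  fixes x :: "real^'n::finite"
  assumes "open V" "x \<in> V"
  obtains S where "open S" "0 \<in> S" "\<And>t. t \<in> S \<Longrightarrow> x + t *\<^sub>R axis i (1::real) \<in> V"
proof
  show "open ((\<lambda>t. x + t *\<^sub>R axis i (1::real)) -` V)"
    by (rule open_vimage[OF assms(1)]) (intro continuous_intros)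
qed (use assms in auto)

lemma deriv_cong_open:
  fixes f g :: "real \<Rightarrow> real"
  assumes "open S" "x \<in> S" "\<And>y. y \<in> S \<Longrightarrow> f y = g y"
  shows "deriv f x = deriv g x"
  using deriv_cong_ev[of f g x x] eventually_nhds assms by auto

lemma pd_cong:
  assumes "open V" "x \<in> V" "\<And>y. y \<in> V \<Longrightarrow> f y = g y"
  shows "pd i f x = pd i g x"
proof -
  obtain S where "open S" "0 \<in> S" "\<And>t. t \<in> S \<Longrightarrow> x + t *\<^sub>R axis i (1::real) \<in> V"
    using line_nhds[OF assms(1,2)] by metis
  then show ?thesis unfolding pd_def
    by (intro deriv_cong_open[of S]) (auto intro: assms(3))
qed

lemma smooth_on_pd:
  assumes "open V" "smooth_on V h"
  shows "smooth_on V (pd i h)"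
  by (rule smooth_on_cong[OF assms(1) smooth_on_frechet[OF assms(2), of "axis i 1"]])
    (simp add: pd_frechet smooth_on_differentiable[OF assms(2)])

lemma pd_const [simp]: "pd i (\<lambda>_. c) x = 0"
  by (rule pdI) auto

lemma pd_add:
  assumes "f differentiable (at x)" "g differentiable (at x)"
  shows "pd i (\<lambda>y. f y + g y) x = pd i f x + pd i g x"
  by (rule pdI) (intro DERIV_add pd_has_deriv assms)

lemma pd_diff:
  assumes "f differentiable (at x)" "g differentiable (at x)"
  shows "pd i (\<lambda>y. f y - g y) x = pd i f x - pd i g x"
  by (rule pdI) (intro DERIV_diff pd_has_deriv assms)

lemma pd_mult:
  assumes "f differentiable (at x)" "g differentiable (at x)"
  shows "pd i (\<lambda>y. f y * g y) x = pd i f x * g x + f x * pd i g x"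
  using DERIV_mult[OF pd_has_deriv[OF assms(1), of i] pd_has_deriv[OF assms(2), of i]]
  by (intro pdI) (simp add: mult.commute)

lemma pd_cmult: "f differentiable (at x) \<Longrightarrow> pd i (\<lambda>y. c * f y) x = c * pd i f x"
  by (simp add: pd_mult)

lemma pd_uminus: "f differentiable (at x) \<Longrightarrow> pd i (\<lambda>y. - f y) x = - pd i f x"
  using pd_cmult[of f x i "-1"] by simp

lemma pd_sum:
  assumes "\<And>k. k \<in> I \<Longrightarrow> f k differentiable (at x)"
  shows "pd i (\<lambda>y. \<Sum>k\<in>I. f k y) x = (\<Sum>k\<in>I. pd i (f k) x)"
  by (rule pdI) (intro DERIV_sum pd_has_deriv assms)

section \<open>Symmetry of second derivatives\<close>

text \<open>The second difference G h h - G h 0 - G 0 h + G 0 0 equals h^2 times a value of either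
  mixed derivative, by the mean value theorem applied twice in each order; continuity at the origin
  then forces equality.\<close>

lemma clairaut:
  fixes G Gs Gt Gst Gts :: "real \<Rightarrow> real \<Rightarrow> real"
  assumes \<delta>: "\<delta> > 0"
    and Gs: "\<And>s t. \<bar>s\<bar> < \<delta> \<Longrightarrow> \<bar>t\<bar> < \<delta> \<Longrightarrow> ((\<lambda>s. G s t) has_real_derivative Gs s t) (at s)"
    and Gt: "\<And>s t. \<bar>s\<bar> < \<delta> \<Longrightarrow> \<bar>t\<bar> < \<delta> \<Longrightarrow> ((\<lambda>t. G s t) has_real_derivative Gt s t) (at t)"
    and Gst: "\<And>s t. \<bar>s\<bar> < \<delta> \<Longrightarrow> \<bar>t\<bar> < \<delta> \<Longrightarrow> ((\<lambda>t. Gs s t) has_real_derivative Gst s t) (at t)"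
    and Gts: "\<And>s t. \<bar>s\<bar> < \<delta> \<Longrightarrow> \<bar>t\<bar> < \<delta> \<Longrightarrow> ((\<lambda>s. Gt s t) has_real_derivative Gts s t) (at s)"
    and cst: "isCont (\<lambda>(s, t). Gst s t) (0, 0)" and cts: "isCont (\<lambda>(s, t). Gts s t) (0, 0)"
  shows "Gst 0 0 = Gts 0 0"
proof (rule ccontr)
  assume ne: "Gst 0 0 \<noteq> Gts 0 0"
  define e where "e = \<bar>Gst 0 0 - Gts 0 0\<bar> / 2"
  have e: "e > 0" using ne by (simp add: e_def)
  obtain d1 where d1: "d1 > 0" "\<And>s t. dist (s, t) (0, 0) < d1 \<Longrightarrow> \<bar>Gst s t - Gst 0 0\<bar> < e"
    using cst e unfolding continuous_at_eps_delta dist_real_def by fastforce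
  obtain d2 where d2: "d2 > 0" "\<And>s t. dist (s, t) (0, 0) < d2 \<Longrightarrow> \<bar>Gts s t - Gts 0 0\<bar> < e"
    using cts e unfolding continuous_at_eps_delta dist_real_def by fastforce
  \<comment> \<open>Half the minimum, so that the open square of side h lies within distance 2 h of
    the origin, inside both continuity radii.\<close>
  define h where "h = min \<delta> (min d1 d2) / 2"
  have h: "h > 0" "h < \<delta>" "2 * h \<le> d1" "2 * h \<le> d2" using \<delta> d1(1) d2(1) by (auto simp: h_def)
  have dist: "dist (s, t) (0::real, 0::real) < 2 * h" if "0 < s" "s < h" "0 < t" "t < h" for s t
  proof -
    have "dist (s, t) (0::real, 0::real) \<le> \<bar>s\<bar> + \<bar>t\<bar>"
      using norm_Pair_le[of s t] by (simp add: dist_norm zero_prod_def[symmetric])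
    then show ?thesis using that by simp
  qed
  have "\<exists>s. 0 < s \<and> s < h \<and> (G h h - G h 0) - (G 0 h - G 0 0) = (h - 0) * (Gs s h - Gs s 0)"
    using h by (intro MVT2[of 0 h "\<lambda>s. G s h - G s 0"]) (auto intro!: DERIV_diff Gs)
  then obtain s where s: "0 < s" "s < h" "(G h h - G h 0) - (G 0 h - G 0 0) = h * (Gs s h - Gs s 0)"
    by auto
  have "\<exists>t. 0 < t \<and> t < h \<and> Gs s h - Gs s 0 = (h - 0) * Gst s t"
    using h s by (intro MVT2) (auto intro!: Gst)
  then obtain t where t: "0 < t" "t < h" "Gs s h - Gs s 0 = h * Gst s t" by auto
  have "\<exists>t. 0 < t \<and> t < h \<and> (G h h - G 0 h) - (G h 0 - G 0 0) = (h - 0) * (Gt h t - Gt 0 t)"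
    using h by (intro MVT2[of 0 h "\<lambda>t. G h t - G 0 t"]) (auto intro!: DERIV_diff Gt)
  then obtain t' where t': "0 < t'" "t' < h" "(G h h - G 0 h) - (G h 0 - G 0 0) = h * (Gt h t' - Gt 0 t')"
    by auto
  have "\<exists>s. 0 < s \<and> s < h \<and> Gt h t' - Gt 0 t' = (h - 0) * Gts s t'"
    using h t' by (intro MVT2) (auto intro!: Gts)
  then obtain s' where s': "0 < s'" "s' < h" "Gt h t' - Gt 0 t' = h * Gts s' t'" by auto
  have "h * (h * Gst s t) = h * (h * Gts s' t')"
    using s t t' s' by (simp add: algebra_simps)
  then have "Gst s t = Gts s' t'" using h by simp
  moreover have "\<bar>Gst s t - Gst 0 0\<bar> < e" "\<bar>Gts s' t' - Gts 0 0\<bar> < e"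
    using dist[of s t] dist[of s' t'] s t s' t' h by (auto intro!: d1 d2)
  ultimately show False by (simp add: e_def abs_if split: if_splits)
qed

section \<open>Differential functions\<close>

text \<open>Smoothness without a bound on the order, which is tracked separately by
  \<open>order_le\<close> so that it can be counted.\<close>

definition smooth_jet :: "(real^'n) set \<Rightarrow> real set \<Rightarrow> 'n::finite dfun \<Rightarrow> bool" where
  "smooth_jet V J P \<longleftrightarrow> (\<forall>k. jet_Ck k V J P)"

lemma finite_multisets_size_le: "finite {I :: 'n::finite multiset. size I \<le> r}"
proof -
  have "{I :: 'n multiset. size I \<le> r} \<subseteq> (\<Union>k\<in>{..r}. multisets_of_size UNIV k)"
    by (auto simp: multisets_of_size_def)
  then show ?thesis by (rule finite_subset) auto
qed

lemma open_jet_dom: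
  assumes "open V" "open J"
  shows "open (jet_dom V J :: ((real^'n) \<times> 'n::finite jet) set)"
proof -
  have "jet_dom V J = V \<times> ((\<lambda>j :: 'n jet. j {#}) -` J)"
    by (auto simp: jet_dom_def)
  moreover have "open ((\<lambda>j :: 'n jet. j {#}) -` J)"
    by (rule open_vimage[OF assms(2)]) (rule continuous_on_product_coordinates)
  ultimately show ?thesis using assms(1) by (simp add: open_Times)
qed

lemma pd_x_cong:
  assumes "open V" "(x, j) \<in> jet_dom V J" "\<And>x j. (x, j) \<in> jet_dom V J \<Longrightarrow> P x j = Q x j"
  shows "pd_x i P x j = pd_x i Q x j"
  unfolding pd_x_def using assms by (intro pd_cong[of V]) (auto simp: jet_dom_def)

lemma jet_slice_nhds:
  assumes "open J" "(x, j) \<in> jet_dom V J"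
  obtains S where "open S" "j I \<in> S" "\<And>t. t \<in> S \<Longrightarrow> (x, j(I := t)) \<in> jet_dom V J"
proof
  show "open (if I = {#} then J else UNIV)" using assms(1) by auto
qed (use assms(2) in \<open>auto simp: jet_dom_def split: if_splits\<close>)

lemma pd_u_cong:
  assumes "open J" "(x, j) \<in> jet_dom V J" "\<And>x j. (x, j) \<in> jet_dom V J \<Longrightarrow> P x j = Q x j"
  shows "pd_u I P x j = pd_u I Q x j"
proof -
  obtain S where "open S" "j I \<in> S" "\<And>t. t \<in> S \<Longrightarrow> (x, j(I := t)) \<in> jet_dom V J"
    using jet_slice_nhds[OF assms(1,2)] by metis
  then show ?thesis unfolding pd_u_def by (intro deriv_cong_open[of S]) (auto intro: assms(3))
qed

lemma total_deriv_cong: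
  assumes "open V" "open J" "(x, j) \<in> jet_dom V J" "\<And>x j. (x, j) \<in> jet_dom V J \<Longrightarrow> P x j = Q x j"
  shows "total_deriv i P x j = total_deriv i Q x j"
  unfolding total_deriv_def
  by (simp add: pd_x_cong[OF assms(1,3,4)] pd_u_cong[OF assms(2,3,4)])

lemma jet_Ck_cong_imp:
  assumes "open V" "open J"
  shows "(\<And>x j. (x, j) \<in> jet_dom V J \<Longrightarrow> P x j = Q x j) \<Longrightarrow> jet_Ck k V J P \<Longrightarrow> jet_Ck k V J Q"
proof (induction k arbitrary: P Q)
  case 0
  have "continuous_on (jet_dom V J) (\<lambda>(x, j). P x j) \<longleftrightarrow> continuous_on (jet_dom V J) (\<lambda>(x, j). Q x j)"
    by (rule continuous_on_cong) (use 0 in auto)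
  then show ?case using 0 by simp
next
  case (Suc k)
  have c: "continuous_on (jet_dom V J) (\<lambda>(x, j). P x j) \<longleftrightarrow> continuous_on (jet_dom V J) (\<lambda>(x, j). Q x j)"
    by (rule continuous_on_cong) (use Suc in auto)
  have dx: "(\<lambda>t. Q (x + t *\<^sub>R axis i 1) j) differentiable (at 0)" if xj: "(x, j) \<in> jet_dom V J" for x j i
  proof -
    from xj have "x \<in> V" by (simp add: jet_dom_def)
    obtain S where S: "open S" "0 \<in> S" "\<And>t. t \<in> S \<Longrightarrow> x + t *\<^sub>R axis i (1::real) \<in> V"
      using line_nhds[OF assms(1) \<open>x \<in> V\<close>] by metis
    obtain D where D: "((\<lambda>t. P (x + t *\<^sub>R axis i 1) j) has_derivative D) (at 0)"
      using Suc.prems(2) xj by (fastforce simp: differentiable_def)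
    have "((\<lambda>t. Q (x + t *\<^sub>R axis i 1) j) has_derivative D) (at 0)"
      by (rule has_derivative_transform_within_open[OF D S(1,2)])
        (use S(3) xj in \<open>auto intro!: Suc.prems(1) simp: jet_dom_def\<close>)
    then show ?thesis by (auto simp: differentiable_def)
  qed
  have du: "(\<lambda>t. Q x (j(I := t))) differentiable (at (j I))" if xj: "(x, j) \<in> jet_dom V J" for x j I
  proof -
    obtain S where S: "open S" "j I \<in> S" "\<And>t. t \<in> S \<Longrightarrow> (x, j(I := t)) \<in> jet_dom V J"
      using jet_slice_nhds[OF assms(2) xj] by metis
    obtain D where D: "((\<lambda>t. P x (j(I := t))) has_derivative D) (at (j I))"
      using Suc.prems(2) xj by (fastforce simp: differentiable_def)
    have "((\<lambda>t. Q x (j(I := t))) has_derivative D) (at (j I))"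
      by (rule has_derivative_transform_within_open[OF D S(1,2)]) (use S(3) in \<open>auto intro!: Suc.prems(1)\<close>)
    then show ?thesis by (auto simp: differentiable_def)
  qed
  have "jet_Ck k V J (pd_x i Q)" for i
    by (rule Suc.IH[of "pd_x i P"]) (use Suc.prems in \<open>auto intro: pd_x_cong[OF assms(1)]\<close>)
  moreover have "jet_Ck k V J (pd_u I Q)" for I
    by (rule Suc.IH[of "pd_u I P"]) (use Suc.prems in \<open>auto intro: pd_u_cong[OF assms(2)]\<close>)
  ultimately show ?case using c Suc.prems(2) dx du by auto
qed

lemma smooth_jet_cong:
  "open V \<Longrightarrow> open J \<Longrightarrow> smooth_jet V J P \<Longrightarrow> (\<And>x j. (x, j) \<in> jet_dom V J \<Longrightarrow> P x j = Q x j) \<Longrightarrow> smooth_jet V J Q"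
  using jet_Ck_cong_imp unfolding smooth_jet_def by blast

lemma jet_Ck_cont: "jet_Ck k V J P \<Longrightarrow> continuous_on (jet_dom V J) (\<lambda>(x, j). P x j)"
  by (cases k) auto

lemma jet_Ck_Suc_imp: "jet_Ck (Suc k) V J P \<Longrightarrow> jet_Ck k V J P"
proof (induction k arbitrary: P)
  case (Suc k)
  note * = iffD1[OF jet_Ck.simps(2)[of "Suc k"] Suc.prems]
  have "jet_Ck k V J (pd_x i P)" "jet_Ck k V J (pd_u I P)" for i I
    using * Suc.IH by blast+
  with * show ?case unfolding jet_Ck.simps(2)[of k] by blast
qed auto

lemma jet_Ck_dx:
  assumes "jet_Ck (Suc k) V J P" "(x, j) \<in> jet_dom V J"
  shows "((\<lambda>t. P (x + t *\<^sub>R axis i 1) j) has_real_derivative pd_x i P x j) (at 0)"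
proof -
  have "(\<lambda>t. P (x + t *\<^sub>R axis i 1) j) differentiable (at 0)" using assms by auto
  then show ?thesis unfolding pd_x_def pd_def
    by (metis DERIV_deriv_iff_real_differentiable)
qed

lemma jet_Ck_du:
  assumes "jet_Ck (Suc k) V J P" "(x, j) \<in> jet_dom V J"
  shows "((\<lambda>t. P x (j(I := t))) has_real_derivative pd_u I P x j) (at (j I))"
proof -
  have "(\<lambda>t. P x (j(I := t))) differentiable (at (j I))" using assms by auto
  then show ?thesis unfolding pd_u_def
    by (metis DERIV_deriv_iff_real_differentiable)
qed

text \<open>Lets the derivatives be supplied as explicit formulas, which have to agree with
  \<open>pd_x\<close> and \<open>pd_u\<close> only on the jet domain.\<close>

lemma jet_Ck_SucI:
  assumes VJ: "open V" "open J" and c: "continuous_on (jet_dom V J) (\<lambda>(x, j). P x j)"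
    and X: "\<And>i x j. (x, j) \<in> jet_dom V J \<Longrightarrow> ((\<lambda>t. P (x + t *\<^sub>R axis i 1) j) has_real_derivative PX i x j) (at 0)"
    and U: "\<And>I x j. (x, j) \<in> jet_dom V J \<Longrightarrow> ((\<lambda>t. P x (j(I := t))) has_real_derivative PU I x j) (at (j I))"
    and kX: "\<And>i. jet_Ck k V J (PX i)" and kU: "\<And>I. jet_Ck k V J (PU I)"
  shows "jet_Ck (Suc k) V J P"
proof -
  have "jet_Ck k V J (pd_x i P)" for i
    by (rule jet_Ck_cong_imp[OF VJ _ kX[of i]]) (use pdI[OF X] in \<open>auto simp: pd_x_def\<close>)
  moreover have "jet_Ck k V J (pd_u I P)" for I
    by (rule jet_Ck_cong_imp[OF VJ _ kU[of I]]) (use DERIV_imp_deriv[OF U] in \<open>auto simp: pd_u_def\<close>)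
  ultimately show ?thesis using c X U
    unfolding jet_Ck.simps real_differentiable_def by blast
qed

lemma jet_Ck_const: "open V \<Longrightarrow> open J \<Longrightarrow> jet_Ck k V J (\<lambda>_ _. c)"
proof (induction k arbitrary: c)
  case (Suc k)
  show ?case
    by (rule jet_Ck_SucI[where PX = "\<lambda>_ _ _. 0" and PU = "\<lambda>_ _ _. 0"]) (use Suc in auto)
qed (auto simp: case_prod_unfold)

lemma jet_Ck_add:
  assumes "open V" "open J"
  shows "jet_Ck k V J P \<Longrightarrow> jet_Ck k V J Q \<Longrightarrow> jet_Ck k V J (\<lambda>x j. P x j + Q x j)"
proof (induction k arbitrary: P Q)
  case 0
  then show ?case by (auto simp: case_prod_unfold intro: continuous_intros)
next
  case (Suc k)
  note c = jet_Ck_cont[OF Suc.prems(1)] jet_Ck_cont[OF Suc.prems(2)]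
  show ?case
  proof (rule jet_Ck_SucI[where PX = "\<lambda>i x j. pd_x i P x j + pd_x i Q x j" and PU = "\<lambda>I x j. pd_u I P x j + pd_u I Q x j"])
    show "continuous_on (jet_dom V J) (\<lambda>(x, j). P x j + Q x j)"
      using c by (auto simp: case_prod_unfold intro: continuous_intros)
  next
    fix i x j assume xj: "(x, j) \<in> jet_dom V J"
    show "((\<lambda>t. P (x + t *\<^sub>R axis i 1) j + Q (x + t *\<^sub>R axis i 1) j) has_real_derivative
        pd_x i P x j + pd_x i Q x j) (at 0)"
      by (rule DERIV_add[OF jet_Ck_dx[OF Suc.prems(1) xj] jet_Ck_dx[OF Suc.prems(2) xj]])
  next
    fix I x j assume xj: "(x, j) \<in> jet_dom V J"
    show "((\<lambda>t. P x (j(I := t)) + Q x (j(I := t))) has_real_derivative pd_u I P x j + pd_u I Q x j) (at (j I))"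
      by (rule DERIV_add[OF jet_Ck_du[OF Suc.prems(1) xj] jet_Ck_du[OF Suc.prems(2) xj]])
  next
    show "jet_Ck k V J (\<lambda>x j. pd_x i P x j + pd_x i Q x j)" for i
      using Suc.prems by (intro Suc.IH) auto
    show "jet_Ck k V J (\<lambda>x j. pd_u I P x j + pd_u I Q x j)" for I
      using Suc.prems by (intro Suc.IH) auto
  qed (use assms in auto)
qed

lemma jet_Ck_mult:
  assumes "open V" "open J"
  shows "jet_Ck k V J P \<Longrightarrow> jet_Ck k V J Q \<Longrightarrow> jet_Ck k V J (\<lambda>x j. P x j * Q x j)"
proof (induction k arbitrary: P Q)
  case 0
  then show ?case by (auto simp: case_prod_unfold intro: continuous_intros)
next
  case (Suc k)
  note c = jet_Ck_cont[OF Suc.prems(1)] jet_Ck_cont[OF Suc.prems(2)]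
  note k = jet_Ck_Suc_imp[OF Suc.prems(1)] jet_Ck_Suc_imp[OF Suc.prems(2)]
  show ?case
  proof (rule jet_Ck_SucI[where PX = "\<lambda>i x j. pd_x i P x j * Q x j + pd_x i Q x j * P x j"
        and PU = "\<lambda>I x j. pd_u I P x j * Q x j + pd_u I Q x j * P x j"])
    show "continuous_on (jet_dom V J) (\<lambda>(x, j). P x j * Q x j)"
      using c by (auto simp: case_prod_unfold intro: continuous_intros)
  next
    fix i x j assume "(x, j) \<in> jet_dom V J"
    from DERIV_mult[OF jet_Ck_dx[OF Suc.prems(1) this] jet_Ck_dx[OF Suc.prems(2) this]]
    show "((\<lambda>t. P (x + t *\<^sub>R axis i 1) j * Q (x + t *\<^sub>R axis i 1) j) has_real_derivative
        pd_x i P x j * Q x j + pd_x i Q x j * P x j) (at 0)" by simp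
  next
    fix I x j assume xj: "(x, j) \<in> jet_dom V J"
    show "((\<lambda>t. P x (j(I := t)) * Q x (j(I := t))) has_real_derivative
        pd_u I P x j * Q x j + pd_u I Q x j * P x j) (at (j I))"
      using DERIV_mult[OF jet_Ck_du[OF Suc.prems(1) xj, of I] jet_Ck_du[OF Suc.prems(2) xj, of I]]
      by (simp only: fun_upd_triv)
  next
    show "jet_Ck k V J (\<lambda>x j. pd_x i P x j * Q x j + pd_x i Q x j * P x j)" for i
      using Suc.prems k by (intro jet_Ck_add[OF assms] Suc.IH) auto
  next
    show "jet_Ck k V J (\<lambda>x j. pd_u I P x j * Q x j + pd_u I Q x j * P x j)" for I
      using Suc.prems k by (intro jet_Ck_add[OF assms] Suc.IH) auto
  qed (use assms in auto)
qed

lemma smooth_jet_cont: "smooth_jet V J P \<Longrightarrow> continuous_on (jet_dom V J) (\<lambda>(x, j). P x j)"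
  unfolding smooth_jet_def using jet_Ck_cont by blast

lemma smooth_jet_dx:
  "smooth_jet V J P \<Longrightarrow> (x, j) \<in> jet_dom V J \<Longrightarrow>
    ((\<lambda>t. P (x + t *\<^sub>R axis i 1) j) has_real_derivative pd_x i P x j) (at 0)"
  unfolding smooth_jet_def using jet_Ck_dx by blast

lemma smooth_jet_du:
  "smooth_jet V J P \<Longrightarrow> (x, j) \<in> jet_dom V J \<Longrightarrow>
    ((\<lambda>t. P x (j(I := t))) has_real_derivative pd_u I P x j) (at (j I))"
  unfolding smooth_jet_def using jet_Ck_du by blast

lemma smooth_jet_pd_x: "smooth_jet V J P \<Longrightarrow> smooth_jet V J (pd_x i P)"
  unfolding smooth_jet_def by (metis jet_Ck.simps(2))

lemma smooth_jet_pd_u: "smooth_jet V J P \<Longrightarrow> smooth_jet V J (pd_u I P)"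
  unfolding smooth_jet_def by (metis jet_Ck.simps(2))

lemma smooth_jet_const: "open V \<Longrightarrow> open J \<Longrightarrow> smooth_jet V J (\<lambda>_ _. c)"
  by (simp add: smooth_jet_def jet_Ck_const)

lemma smooth_jet_add:
  "open V \<Longrightarrow> open J \<Longrightarrow> smooth_jet V J P \<Longrightarrow> smooth_jet V J Q \<Longrightarrow> smooth_jet V J (\<lambda>x j. P x j + Q x j)"
  by (simp add: smooth_jet_def jet_Ck_add)

lemma smooth_jet_mult:
  "open V \<Longrightarrow> open J \<Longrightarrow> smooth_jet V J P \<Longrightarrow> smooth_jet V J Q \<Longrightarrow> smooth_jet V J (\<lambda>x j. P x j * Q x j)"
  by (simp add: smooth_jet_def jet_Ck_mult)

lemma smooth_jet_uminus:
  assumes "open V" "open J" "smooth_jet V J P"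
  shows "smooth_jet V J (\<lambda>x j. - P x j)"
  using smooth_jet_mult[OF assms(1,2) smooth_jet_const[OF assms(1,2), of "-1"] assms(3)] by simp

lemma smooth_jet_sum:
  assumes "open V" "open J" "\<And>a. a \<in> I \<Longrightarrow> smooth_jet V J (P a)"
  shows "smooth_jet V J (\<lambda>x j. \<Sum>a\<in>I. P a x j)"
proof (cases "finite I")
  case True
  then show ?thesis using assms
    by (induction I) (auto intro: smooth_jet_const smooth_jet_add)
qed (simp add: smooth_jet_const assms)

lemma continuous_on_jet_coordinate: "continuous_on S (\<lambda>z :: 'x::topological_space \<times> ('n multiset \<Rightarrow> real). snd z K)"
  by (rule continuous_on_product_then_coordinatewise[where f = snd and i = K]) (rule continuous_on_snd[OF continuous_on_id])

lemma smooth_jet_coordinate: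
  assumes "open V" "open J"
  shows "smooth_jet V J (\<lambda>x j. j K)"
  unfolding smooth_jet_def
proof
  fix k
  have c: "continuous_on (jet_dom V J) (\<lambda>(x, j). j K)"
    unfolding case_prod_unfold by (rule continuous_on_jet_coordinate)
  show "jet_Ck k V J (\<lambda>x j. j K)"
  proof (cases k)
    case (Suc k')
    show ?thesis unfolding Suc
      by (rule jet_Ck_SucI[where PX = "\<lambda>_ _ _. 0" and PU = "\<lambda>I _ _. if I = K then 1 else 0"])
        (use assms c in \<open>auto intro: jet_Ck_const\<close>)
  qed (use c in simp)
qed

lemma smooth_on_imp_smooth_jet:
  fixes V :: "(real^'n::finite) set"
  assumes "open V" "open J" "smooth_on V h"
  shows "smooth_jet V J (\<lambda>x j. h x)"
proof -
  have c: "continuous_on (jet_dom V J) (\<lambda>(x, j). h x)" if "smooth_on V h" for h :: "real^'n \<Rightarrow> real"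
    using continuous_on_compose2[OF smooth_on_continuous[OF that] continuous_on_fst[OF continuous_on_id], of "jet_dom V J"]
    by (auto simp: case_prod_unfold jet_dom_def)
  have "smooth_on V h \<Longrightarrow> jet_Ck k V J (\<lambda>x j. h x)" for k
  proof (induction k arbitrary: h)
    case 0
    then show ?case
      using c by simp
  next
    case (Suc k)
    show ?case
    proof (rule jet_Ck_SucI[OF assms(1,2), where PX = "\<lambda>i x _. pd i h x" and PU = "\<lambda>_ _ _. 0"])
      show "continuous_on (jet_dom V J) (\<lambda>(x, j). h x)"
        using Suc.prems c by simp
    qed (use Suc assms in \<open>auto intro!: pd_has_deriv smooth_on_differentiable[of V] smooth_on_pd jet_Ck_const simp: jet_dom_def\<close>)
  qed
  then show ?thesis using assms(3) by (simp add: smooth_jet_def)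
qed

text \<open>The sequence \<open>B\<close> lists the successive derivatives of a function of u, so
  the induction on the order may shift m. Locally constant functions are the case of a sequence that
  is zero from m = 1 on.\<close>

lemma smooth_jet_fun_u:
  assumes "open V" "open J" and B: "\<And>m u. u \<in> J \<Longrightarrow> (B m has_real_derivative B (Suc m) u) (at u)"
  shows "smooth_jet V J (\<lambda>x j. B m (j {#}))"
proof -
  have "jet_Ck k V J (\<lambda>x j. B m (j {#}))" for k
  proof (induction k arbitrary: m)
    have c: "continuous_on (jet_dom V J) (\<lambda>(x, j). B m (j {#}))" for m
    proof -
      have "continuous_on J (B m)"
        using B by (meson DERIV_continuous_on has_field_derivative_at_within)
      from continuous_on_compose2[OF this continuous_on_jet_coordinate[of "jet_dom V J" "{#}"]]
      show ?thesis by (auto simp: case_prod_unfold jet_dom_def)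
    qed
    {
      case 0
      show ?case using c by simp
    next
      case (Suc k)
      show ?case
      proof (rule jet_Ck_SucI[OF assms(1,2) c, where PX = "\<lambda>_ _ _. 0"
            and PU = "\<lambda>I x j. (if I = {#} then 1 else 0) * B (Suc m) (j {#})"])
        show "((\<lambda>t. B m ((j(I := t)) {#})) has_real_derivative (if I = {#} then 1 else 0) * B (Suc m) (j {#})) (at (j I))"
          if "(x, j) \<in> jet_dom V J" for I x j
          using that B by (auto simp: jet_dom_def)
      qed (use Suc assms in \<open>auto intro: jet_Ck_const jet_Ck_mult\<close>)
    }
  qed
  then show ?thesis by (simp add: smooth_jet_def)
qed

text \<open>The jet space is an infinite product, so mixed derivatives are compared along a
  two-parameter surface \<open>\<gamma>\<close> through the point: continuity of
  \<open>\<gamma>\<close> keeps a small square inside \<open>D\<close>, and the planar statement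
  applies there.\<close>

lemma clairaut_path:
  fixes \<gamma> :: "real \<times> real \<Rightarrow> 'z::topological_space" and P Ps Pt Pst Pts :: "'z \<Rightarrow> real"
  assumes \<gamma>: "continuous_on UNIV \<gamma>" and D: "open D" "\<gamma> (0, 0) \<in> D"
    and d: "\<And>s t. \<gamma> (s, t) \<in> D \<Longrightarrow> ((\<lambda>s. P (\<gamma> (s, t))) has_real_derivative Ps (\<gamma> (s, t))) (at s)"
      "\<And>s t. \<gamma> (s, t) \<in> D \<Longrightarrow> ((\<lambda>t. P (\<gamma> (s, t))) has_real_derivative Pt (\<gamma> (s, t))) (at t)"
      "\<And>s t. \<gamma> (s, t) \<in> D \<Longrightarrow> ((\<lambda>t. Ps (\<gamma> (s, t))) has_real_derivative Pst (\<gamma> (s, t))) (at t)"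
      "\<And>s t. \<gamma> (s, t) \<in> D \<Longrightarrow> ((\<lambda>s. Pt (\<gamma> (s, t))) has_real_derivative Pts (\<gamma> (s, t))) (at s)"
    and c: "continuous_on D Pst" "continuous_on D Pts"
  shows "Pst (\<gamma> (0, 0)) = Pts (\<gamma> (0, 0))"
proof -
  have "open (\<gamma> -` D)" using D(1) \<gamma> by (rule open_vimage)
  then obtain e where e: "e > 0" "ball (0, 0) e \<subseteq> \<gamma> -` D"
    using D(2) open_contains_ball by (metis vimageI2)
  have in_D: "\<gamma> (s, t) \<in> D" if "\<bar>s\<bar> < e / 2" "\<bar>t\<bar> < e / 2" for s t
  proof -
    have "dist (0, 0) (s, t) \<le> \<bar>s\<bar> + \<bar>t\<bar>"
      using norm_Pair_le[of "- s" "- t"] by (simp add: dist_norm zero_prod_def[symmetric])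
    then have "(s, t) \<in> ball (0, 0) e" using that by simp
    then show ?thesis using e(2) by blast
  qed
  have iso: "isCont (\<lambda>(s, t). Q (\<gamma> (s, t))) (0, 0)" if "continuous_on D Q" for Q :: "'z \<Rightarrow> real"
  proof -
    have "continuous_on (\<gamma> -` D) (\<lambda>z. Q (\<gamma> z))"
      by (rule continuous_on_compose2[OF that continuous_on_subset[OF \<gamma>]]) auto
    moreover have "(0, 0) \<in> \<gamma> -` D" using D(2) by simp
    ultimately have "isCont (\<lambda>z. Q (\<gamma> z)) (0, 0)"
      using \<open>open (\<gamma> -` D)\<close> continuous_on_eq_continuous_at by blast
    then show ?thesis by (simp add: case_prod_unfold)
  qed
  show ?thesis
    by (rule clairaut[of "e / 2" "\<lambda>s t. P (\<gamma> (s, t))" "\<lambda>s t. Ps (\<gamma> (s, t))" "\<lambda>s t. Pt (\<gamma> (s, t))"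
          "\<lambda>s t. Pst (\<gamma> (s, t))" "\<lambda>s t. Pts (\<gamma> (s, t))"])
      (use e(1) in_D d iso[OF c(1)] iso[OF c(2)] in auto)
qed

lemma smooth_jet_dx_at:
  assumes "smooth_jet V J P" "(x + s *\<^sub>R axis i 1, j) \<in> jet_dom V J"
  shows "((\<lambda>s. P (x + s *\<^sub>R axis i 1) j) has_real_derivative pd_x i P (x + s *\<^sub>R axis i 1) j) (at s)"
proof -
  have "((\<lambda>t. P (x + (t + s) *\<^sub>R axis i 1) j) has_real_derivative pd_x i P (x + s *\<^sub>R axis i 1) j) (at 0)"
    using smooth_jet_dx[OF assms, of i] by (simp add: scaleR_add_left add_ac)
  then show ?thesis
    using DERIV_shift[of "\<lambda>t. P (x + t *\<^sub>R axis i 1) j" _ 0 s] by simp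
qed

lemma smooth_jet_du_at:
  assumes "smooth_jet V J P" "(x, j(I := c + t)) \<in> jet_dom V J"
  shows "((\<lambda>t. P x (j(I := c + t))) has_real_derivative pd_u I P x (j(I := c + t))) (at t)"
proof -
  have "((\<lambda>t. P x (j(I := t))) has_real_derivative pd_u I P x (j(I := c + t))) (at (t + c))"
    using smooth_jet_du[OF assms, of I] by (simp add: add.commute)
  then show ?thesis
    using DERIV_shift[of "\<lambda>t. P x (j(I := t))" _ t c] by (simp add: add.commute)
qed

lemma continuous_on_fun_upd:
  fixes j :: "'a \<Rightarrow> 'b::topological_space"
  assumes "\<And>i. continuous_on S (\<lambda>z. f z i)" "continuous_on S g"
  shows "continuous_on S (\<lambda>z. (f z)(I := g z))"
proof (rule continuous_on_coordinatewise_then_product)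
  show "continuous_on S (\<lambda>z. ((f z)(I := g z)) i)" for i
    using assms by (cases "i = I") auto
qed

lemma pd_x_pd_u:
  assumes VJ: "open V" "open J" and P: "smooth_jet V J P" and xj: "(x, j) \<in> jet_dom V J"
  shows "pd_x i (pd_u K P) x j = pd_u K (pd_x i P) x j"
proof -
  let ?\<gamma> = "\<lambda>(s, t). (x + s *\<^sub>R axis i 1, j(K := j K + t))"
  have "(\<lambda>(x, j). pd_u K (pd_x i P) x j) (?\<gamma> (0, 0)) = (\<lambda>(x, j). pd_x i (pd_u K P) x j) (?\<gamma> (0, 0))"
  proof (rule clairaut_path[where D = "jet_dom V J" and \<gamma> = ?\<gamma> and P = "\<lambda>(x, j). P x j"
        and Ps = "\<lambda>(x, j). pd_x i P x j" and Pt = "\<lambda>(x, j). pd_u K P x j"])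
    show "continuous_on UNIV ?\<gamma>"
      unfolding case_prod_unfold by (intro continuous_intros continuous_on_fun_upd)
  qed (use P xj open_jet_dom[OF VJ] in \<open>auto intro!: smooth_jet_dx_at smooth_jet_du_at smooth_jet_pd_x smooth_jet_pd_u smooth_jet_cont\<close>)
  then show ?thesis by simp
qed

lemma pd_u_pd_u:
  assumes VJ: "open V" "open J" and P: "smooth_jet V J P" and xj: "(x, j) \<in> jet_dom V J"
  shows "pd_u I (pd_u K P) x j = pd_u K (pd_u I P) x j"
proof (cases "I = K")
  case False
  let ?\<gamma> = "\<lambda>(s, t). (x, j(I := j I + s, K := j K + t))"
  \<comment> \<open>For distinct multisets the updates commute, so either parameter can be treated
    as the outermost one.\<close>
  have tw: "j(I := a, K := b) = j(K := b, I := a)" for a b using False by (rule fun_upd_twist)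
  have "(\<lambda>(x, j). pd_u K (pd_u I P) x j) (?\<gamma> (0, 0)) = (\<lambda>(x, j). pd_u I (pd_u K P) x j) (?\<gamma> (0, 0))"
  proof (rule clairaut_path[where D = "jet_dom V J" and \<gamma> = ?\<gamma> and P = "\<lambda>(x, j). P x j"
        and Ps = "\<lambda>(x, j). pd_u I P x j" and Pt = "\<lambda>(x, j). pd_u K P x j"])
    show "continuous_on UNIV ?\<gamma>"
      unfolding case_prod_unfold
      by (intro continuous_intros continuous_on_fun_upd continuous_on_product_then_coordinatewise[OF continuous_on_fun_upd])
  next
    fix s t assume a: "?\<gamma> (s, t) \<in> jet_dom V J"
    have du: "((\<lambda>s. Q x (j(I := j I + s, K := j K + t))) has_real_derivative
        pd_u I Q x (j(I := j I + s, K := j K + t))) (at s)" if "smooth_jet V J Q" for Q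
      unfolding tw by (rule smooth_jet_du_at[OF that]) (use a in \<open>simp add: tw\<close>)
    show "((\<lambda>s. (\<lambda>(x, j). P x j) (?\<gamma> (s, t))) has_real_derivative (\<lambda>(x, j). pd_u I P x j) (?\<gamma> (s, t))) (at s)"
      using du[OF P] by simp
    show "((\<lambda>s. (\<lambda>(x, j). pd_u K P x j) (?\<gamma> (s, t))) has_real_derivative (\<lambda>(x, j). pd_u I (pd_u K P) x j) (?\<gamma> (s, t))) (at s)"
      using du[OF smooth_jet_pd_u[OF P]] by simp
  qed (use P xj open_jet_dom[OF VJ] in \<open>auto intro!: smooth_jet_du_at smooth_jet_pd_x smooth_jet_pd_u smooth_jet_cont\<close>)
  then show ?thesis by simp
qed simp

lemma pd_x_pd_x:
  assumes VJ: "open V" "open J" and P: "smooth_jet V J P" and xj: "(x, j) \<in> jet_dom V J"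
  shows "pd_x i (pd_x k P) x j = pd_x k (pd_x i P) x j"
proof -
  let ?\<gamma> = "\<lambda>(s, t). (x + s *\<^sub>R axis i 1 + t *\<^sub>R axis k 1, j)"
  have "(\<lambda>(x, j). pd_x k (pd_x i P) x j) (?\<gamma> (0, 0)) = (\<lambda>(x, j). pd_x i (pd_x k P) x j) (?\<gamma> (0, 0))"
  proof (rule clairaut_path[where D = "jet_dom V J" and \<gamma> = ?\<gamma> and P = "\<lambda>(x, j). P x j"
        and Ps = "\<lambda>(x, j). pd_x i P x j" and Pt = "\<lambda>(x, j). pd_x k P x j"])
    show "continuous_on UNIV ?\<gamma>"
      unfolding case_prod_unfold by (intro continuous_intros)
  next
    fix s t assume a: "?\<gamma> (s, t) \<in> jet_dom V J"
    have ac: "x + s *\<^sub>R axis i 1 + t *\<^sub>R axis k (1::real) = x + t *\<^sub>R axis k 1 + s *\<^sub>R axis i 1" for s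
      by (simp add: add_ac)
    have dx: "((\<lambda>s. Q (x + s *\<^sub>R axis i 1 + t *\<^sub>R axis k 1) j) has_real_derivative
        pd_x i Q (x + s *\<^sub>R axis i 1 + t *\<^sub>R axis k 1) j) (at s)" if "smooth_jet V J Q" for Q
      unfolding ac by (rule smooth_jet_dx_at[OF that]) (use a in \<open>simp add: ac\<close>)
    show "((\<lambda>s. (\<lambda>(x, j). P x j) (?\<gamma> (s, t))) has_real_derivative (\<lambda>(x, j). pd_x i P x j) (?\<gamma> (s, t))) (at s)"
      using dx[OF P] by simp
    show "((\<lambda>s. (\<lambda>(x, j). pd_x k P x j) (?\<gamma> (s, t))) has_real_derivative (\<lambda>(x, j). pd_x i (pd_x k P) x j) (?\<gamma> (s, t))) (at s)"
      using dx[OF smooth_jet_pd_x[OF P]] by simp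
  qed (use P xj open_jet_dom[OF VJ] in \<open>auto intro!: smooth_jet_dx_at smooth_jet_pd_x smooth_jet_pd_u smooth_jet_cont\<close>)
  then show ?thesis by simp
qed

text \<open>A function of x is a jet function that is constant in the jet, so this is a case of the
  commutation in jet space.\<close>

lemma pd_pd_commute:
  assumes "open V" "smooth_on V h" "x \<in> V"
  shows "pd i (pd k h) x = pd k (pd i h) x"
proof -
  have "pd_x i (pd_x k (\<lambda>x j. h x)) x (\<lambda>_. 0) = pd_x k (pd_x i (\<lambda>x j. h x)) x (\<lambda>_. 0)"
    by (rule pd_x_pd_x[OF assms(1) open_UNIV smooth_on_imp_smooth_jet[OF assms(1) open_UNIV assms(2)]])
      (use assms(3) in \<open>simp add: jet_dom_def\<close>)
  moreover have "pd_x k (\<lambda>x j. h x) = (\<lambda>x j. pd k h x)" for k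
    by (simp add: pd_x_def fun_eq_iff)
  ultimately show ?thesis by (simp add: pd_x_def)
qed

section \<open>The Euler operator annihilates divergences\<close>

text \<open>Unlike in \<open>differential_function\<close>, u is not restricted to a set
  \<open>J\<close>: the Euler operator is applied only with u ranging over all reals.\<close>

definition order_le :: "nat \<Rightarrow> (real^'n) set \<Rightarrow> 'n::finite dfun \<Rightarrow> bool" where
  "order_le r V P \<longleftrightarrow> (\<forall>x\<in>V. \<forall>j j'. (\<forall>I. size I \<le> r \<longrightarrow> j I = j' I) \<longrightarrow> P x j = P x j')"

lemma order_leD: "order_le r V P \<Longrightarrow> x \<in> V \<Longrightarrow> (\<And>I. size I \<le> r \<Longrightarrow> j I = j' I) \<Longrightarrow> P x j = P x j'"
  unfolding order_le_def by blast

lemma order_le_mono: "order_le r V P \<Longrightarrow> r \<le> s \<Longrightarrow> order_le s V P"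
  unfolding order_le_def by (meson order_trans)

lemma pd_u_zero:
  assumes "order_le r V P" "x \<in> V" "r < size I"
  shows "pd_u I P x j = 0"
proof -
  have "(\<lambda>t. P x (j(I := t))) = (\<lambda>_. P x j)"
    using assms(3) by (intro ext order_leD[OF assms(1,2)]) auto
  then show ?thesis by (simp add: pd_u_def)
qed

lemma pd_u_order:
  assumes "order_le r V P"
  shows "order_le r V (pd_u I P)"
  unfolding order_le_def
proof (intro ballI allI impI)
  fix x and j j' :: "'a jet" assume x: "x \<in> V" and j: "\<forall>I. size I \<le> r \<longrightarrow> j I = j' I"
  show "pd_u I P x j = pd_u I P x j'"
  proof (cases "size I \<le> r")
    case True
    have "(\<lambda>t. P x (j(I := t))) = (\<lambda>t. P x (j'(I := t)))"
      by (intro ext order_leD[OF assms x]) (use j in auto)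
    then show ?thesis using True j by (simp add: pd_u_def)
  next
    case False
    then show ?thesis using pd_u_zero[OF assms x, of I] by simp
  qed
qed

lemma pd_x_order:
  assumes "open V" "order_le r V P"
  shows "order_le r V (pd_x i P)"
  unfolding order_le_def pd_x_def
proof (intro ballI allI impI)
  fix x and j j' :: "'a jet" assume "x \<in> V" "\<forall>I. size I \<le> r \<longrightarrow> j I = j' I"
  then show "pd i (\<lambda>y. P y j) x = pd i (\<lambda>y. P y j') x"
    by (intro pd_cong[OF assms(1)] order_leD[OF assms(2)]) auto
qed

text \<open>Any upper bound r on the order is allowed, which gives several functions a common finite
  index set.\<close>

lemma total_deriv_sum:
  assumes "order_le r V P" "x \<in> V"
  shows "total_deriv i P x j = pd_x i P x j + (\<Sum>I | size I \<le> r. j (add_mset i I) * pd_u I P x j)"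
  unfolding total_deriv_def
  using pd_u_zero[OF assms] by (subst Sum_any.expand_superset[OF finite_multisets_size_le[of r]]) (auto simp: not_le[symmetric])

lemma total_deriv_order:
  assumes "open V" "order_le r V P"
  shows "order_le (Suc r) V (total_deriv i P)"
  unfolding order_le_def
proof (intro ballI allI impI)
  fix x and j j' :: "'a jet" assume x: "x \<in> V" and j: "\<forall>I. size I \<le> Suc r \<longrightarrow> j I = j' I"
  have "pd_x i P x j = pd_x i P x j'"
    by (rule order_leD[OF pd_x_order[OF assms] x]) (use j in auto)
  moreover have "pd_u I P x j = pd_u I P x j'" for I
    by (rule order_leD[OF pd_u_order[OF assms(2)] x]) (use j in auto)
  ultimately show "total_deriv i P x j = total_deriv i P x j'"
    using j by (auto simp: total_deriv_sum[OF assms(2) x] intro!: sum.cong)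
qed

lemma mem_jet_dom_UNIV [simp]: "(x, j) \<in> jet_dom V UNIV \<longleftrightarrow> x \<in> V"
  by (simp add: jet_dom_def)

lemma smooth_jet_total_deriv:
  assumes "open V" "order_le r V P" "smooth_jet V UNIV P"
  shows "smooth_jet V UNIV (total_deriv i P)"
proof (rule smooth_jet_cong[OF assms(1) open_UNIV])
  show "smooth_jet V UNIV (\<lambda>x j. pd_x i P x j + (\<Sum>I | size I \<le> r. j (add_mset i I) * pd_u I P x j))"
    using assms by (intro smooth_jet_add smooth_jet_sum smooth_jet_mult smooth_jet_coordinate smooth_jet_pd_x smooth_jet_pd_u) auto
qed (simp add: total_deriv_sum[OF assms(2)])

text \<open>The multisets containing l are exactly the \<open>add_mset l L\<close>, each obtained
  once. This reindexing serves both the commutation of total derivatives and the cancellation in the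
  Euler operator.\<close>

lemma sum_multisets_containing:
  fixes h :: "'n::finite multiset \<Rightarrow> 'n multiset \<Rightarrow> real"
  shows "(\<Sum>I | size I \<le> Suc r. if l \<in># I then h I (I - {#l#}) else 0) = (\<Sum>L | size L \<le> r. h (add_mset l L) L)"
proof -
  have "(\<Sum>I | size I \<le> Suc r. if l \<in># I then h I (I - {#l#}) else 0)
      = (\<Sum>I\<in>{I. size I \<le> Suc r} \<inter> {I. l \<in># I}. h I (I - {#l#}))"
    by (rule sum.inter_restrict[OF finite_multisets_size_le, symmetric, where B = "{I. l \<in># I}", simplified])
  also have "\<dots> = (\<Sum>L | size L \<le> r. h (add_mset l L) L)"
    by (rule sum.reindex_bij_witness[where i = "add_mset l" and j = "\<lambda>I. I - {#l#}"])
      (auto simp: size_Diff_singleton)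
  finally show ?thesis .
qed

text \<open>The commutator of d/du_K with D_i is d/du_{K - i}: it comes from differentiating the
  coefficient u_{I + i} in D_i, which is u_K itself exactly when K = I + i.\<close>

lemma pd_u_total_deriv:
  assumes V: "open V" and o: "order_le r V P" and P: "smooth_jet V UNIV P" and x: "x \<in> V"
  shows "pd_u K (total_deriv i P) x j = total_deriv i (pd_u K P) x j + (if i \<in># K then pd_u (K - {#i#}) P x j else 0)"
proof -
  let ?S = "{I :: 'a multiset. size I \<le> r}"
  have "((\<lambda>t. pd_x i P x (j(K := t)) + (\<Sum>I\<in>?S. (j(K := t)) (add_mset i I) * pd_u I P x (j(K := t)))) has_real_derivative
      pd_u K (pd_x i P) x j + (\<Sum>I\<in>?S. (if add_mset i I = K then 1 else 0) * pd_u I P x j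
        + pd_u K (pd_u I P) x j * j (add_mset i I))) (at (j K))"
  proof (intro DERIV_add DERIV_sum)
    show "((\<lambda>t. pd_x i P x (j(K := t))) has_real_derivative pd_u K (pd_x i P) x j) (at (j K))"
      by (rule smooth_jet_du[OF smooth_jet_pd_x[OF P]]) (use x in simp)
    fix I
    have "((\<lambda>t. (j(K := t)) (add_mset i I)) has_real_derivative (if add_mset i I = K then 1 else 0)) (at (j K))"
      by auto
    from DERIV_mult[OF this smooth_jet_du[OF smooth_jet_pd_u[OF P], where x = x and j = j and I = K]]
    show "((\<lambda>t. (j(K := t)) (add_mset i I) * pd_u I P x (j(K := t))) has_real_derivative
        (if add_mset i I = K then 1 else 0) * pd_u I P x j + pd_u K (pd_u I P) x j * j (add_mset i I)) (at (j K))"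
      using x by (simp only: fun_upd_triv mem_jet_dom_UNIV)
  qed
  then have "pd_u K (total_deriv i P) x j = pd_u K (pd_x i P) x j + (\<Sum>I\<in>?S. (if add_mset i I = K then 1 else 0) * pd_u I P x j
        + pd_u K (pd_u I P) x j * j (add_mset i I))"
    unfolding pd_u_def[of K "total_deriv i P"] total_deriv_sum[OF o x] by (rule DERIV_imp_deriv)
  also have "\<dots> = pd_u K (pd_x i P) x j + (\<Sum>I\<in>?S. j (add_mset i I) * pd_u K (pd_u I P) x j)
      + (\<Sum>I\<in>?S. (if add_mset i I = K then 1 else 0) * pd_u I P x j)"
    by (simp add: sum.distrib mult.commute)
  also have "pd_u K (pd_x i P) x j = pd_x i (pd_u K P) x j"
    by (rule pd_x_pd_u[symmetric, OF V open_UNIV P]) (use x in simp)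
  also have "(\<Sum>I\<in>?S. j (add_mset i I) * pd_u K (pd_u I P) x j) = (\<Sum>I\<in>?S. j (add_mset i I) * pd_u I (pd_u K P) x j)"
    by (intro sum.cong refl arg_cong2[where f = "(*)"] pd_u_pd_u[OF V open_UNIV P]) (use x in simp)
  also have "pd_x i (pd_u K P) x j + \<dots> = total_deriv i (pd_u K P) x j"
    by (rule total_deriv_sum[symmetric, OF pd_u_order[OF o] x])
  also have "(\<Sum>I\<in>?S. (if add_mset i I = K then 1 else 0) * pd_u I P x j) = (if i \<in># K then pd_u (K - {#i#}) P x j else 0)"
  proof (cases "i \<in># K")
    case True
    then have eq: "add_mset i I = K \<longleftrightarrow> I = K - {#i#}" for I by auto
    have "(\<Sum>I\<in>?S. (if add_mset i I = K then 1 else 0) * pd_u I P x j) = (\<Sum>I\<in>?S. if I = K - {#i#} then pd_u I P x j else 0)"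
      unfolding eq by (rule sum.cong) auto
    also have "\<dots> = (if K - {#i#} \<in> ?S then pd_u (K - {#i#}) P x j else 0)"
      by (rule sum.delta[OF finite_multisets_size_le])
    \<comment> \<open>If \<open>K - {#i#}\<close> is too large to be an index of the sum, the
      derivative vanishes anyway.\<close>
    also have "\<dots> = pd_u (K - {#i#}) P x j"
      using pd_u_zero[OF o x, of "K - {#i#}"] by auto
    finally show ?thesis using True by simp
  next
    case False
    then have "add_mset i I \<noteq> K" for I by auto
    then show ?thesis using False by simp
  qed
  finally show ?thesis .
qed

lemma total_deriv_commute:
  assumes V: "open V" and o: "order_le r V P" and P: "smooth_jet V UNIV P" and x: "x \<in> V"
  shows "total_deriv i (total_deriv l P) x j = total_deriv l (total_deriv i P) x j"
proof -
  \<comment> \<open>The inner total derivative has order \<open>Suc r\<close>, so the sums run up to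
    that size.\<close>
  let ?S = "{I :: 'a multiset. size I \<le> Suc r}"
  have o': "order_le (Suc r) V P" using o by (rule order_le_mono) simp
  \<comment> \<open>Arranged so that exchanging i and l swaps the second and third terms and
    preserves the others, by the symmetry of second derivatives and of
    \<open>add_mset\<close>.\<close>
  have *: "total_deriv i (total_deriv l P) x j =
      pd_x i (pd_x l P) x j + (\<Sum>I\<in>?S. j (add_mset l I) * pd_x i (pd_u I P) x j)
      + (\<Sum>I\<in>?S. j (add_mset i I) * pd_x l (pd_u I P) x j)
      + (\<Sum>I\<in>?S. \<Sum>K\<in>?S. j (add_mset i I) * (j (add_mset l K) * pd_u K (pd_u I P) x j))
      + (\<Sum>L | size L \<le> r. j (add_mset i (add_mset l L)) * pd_u L P x j)" for i l
  proof -
    have "pd_x i (total_deriv l P) x j = pd_x i (\<lambda>x j. pd_x l P x j + (\<Sum>I\<in>?S. j (add_mset l I) * pd_u I P x j)) x j"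
      by (rule pd_x_cong[OF V, of _ _ UNIV]) (use x in \<open>auto simp: total_deriv_sum[OF o']\<close>)
    also have "\<dots> = pd_x i (pd_x l P) x j + (\<Sum>I\<in>?S. j (add_mset l I) * pd_x i (pd_u I P) x j)"
      unfolding pd_x_def[of i "\<lambda>x j. pd_x l P x j + _ x j"]
      by (intro pdI DERIV_add DERIV_sum DERIV_cmult smooth_jet_dx[of V UNIV] smooth_jet_pd_x smooth_jet_pd_u P) (use x in simp_all)
    finally have 1: "pd_x i (total_deriv l P) x j = \<dots>" .
    have "(\<Sum>I\<in>?S. j (add_mset i I) * pd_u I (total_deriv l P) x j) =
      (\<Sum>I\<in>?S. j (add_mset i I) * pd_x l (pd_u I P) x j)
      + (\<Sum>I\<in>?S. \<Sum>K\<in>?S. j (add_mset i I) * (j (add_mset l K) * pd_u K (pd_u I P) x j))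
      + (\<Sum>I\<in>?S. if l \<in># I then j (add_mset i I) * pd_u (I - {#l#}) P x j else 0)"
      unfolding sum.distrib[symmetric]
      by (intro sum.cong refl)
        (simp add: pd_u_total_deriv[OF V o' P x] total_deriv_sum[OF pd_u_order[OF o'] x] algebra_simps sum_distrib_left)
    also have "(\<Sum>I\<in>?S. if l \<in># I then j (add_mset i I) * pd_u (I - {#l#}) P x j else 0)
        = (\<Sum>L | size L \<le> r. j (add_mset i (add_mset l L)) * pd_u L P x j)"
      by (rule sum_multisets_containing)
    finally show ?thesis
      using total_deriv_sum[OF total_deriv_order[OF V o] x, of i l j] 1 by simp
  qed
  have "(\<Sum>I\<in>?S. \<Sum>K\<in>?S. j (add_mset i I) * (j (add_mset l K) * pd_u K (pd_u I P) x j))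
      = (\<Sum>K\<in>?S. \<Sum>I\<in>?S. j (add_mset i I) * (j (add_mset l K) * pd_u K (pd_u I P) x j))"
    by (rule sum.swap)
  also have "\<dots> = (\<Sum>I\<in>?S. \<Sum>K\<in>?S. j (add_mset l I) * (j (add_mset i K) * pd_u K (pd_u I P) x j))"
    using pd_u_pd_u[OF V open_UNIV P, of x j] x by (intro sum.cong refl) (simp add: mult_ac)
  finally have "(\<Sum>I\<in>?S. \<Sum>K\<in>?S. j (add_mset i I) * (j (add_mset l K) * pd_u K (pd_u I P) x j)) = \<dots>" .
  moreover have "pd_x i (pd_x l P) x j = pd_x l (pd_x i P) x j"
    by (rule pd_x_pd_x[OF V open_UNIV P]) (use x in simp)
  ultimately show ?thesis unfolding *[of i l] *[of l i] by (simp add: add_mset_commute)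
qed

section \<open>Iterated total derivatives and the Euler operator\<close>

text \<open>
  Differential functions are extended by zero outside \<open>V\<close>, and total derivatives of other functions
  are set to zero, so that the total derivatives commute outright and can be iterated along a multiset.
\<close>

definition dfuns :: "(real^'n) set \<Rightarrow> 'n::finite dfun set" where
  "dfuns V = {P. (\<exists>r. order_le r V P) \<and> smooth_jet V UNIV P \<and> (\<forall>x j. x \<notin> V \<longrightarrow> P x j = 0)}"

definition restr :: "(real^'n) set \<Rightarrow> 'n::finite dfun \<Rightarrow> 'n dfun" where
  "restr V P x j = (if x \<in> V then P x j else 0)"

definition TD :: "(real^'n) set \<Rightarrow> 'n \<Rightarrow> 'n::finite dfun \<Rightarrow> 'n dfun" where
  "TD V i P = (if P \<in> dfuns V then restr V (total_deriv i P) else (\<lambda>_ _. 0))"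

definition TM :: "(real^'n) set \<Rightarrow> 'n multiset \<Rightarrow> 'n::finite dfun \<Rightarrow> 'n dfun" where
  "TM V K P = fold_mset (TD V) P K"

text \<open>With jet coordinates indexed by multisets, each u_K occurs once and no multinomial
  weights appear. The cutoff \<open>R\<close> loses nothing once it is at least the order of
  \<open>P\<close>.\<close>

definition euler :: "(real^'n) set \<Rightarrow> nat \<Rightarrow> 'n::finite dfun \<Rightarrow> 'n dfun" where
  "euler V R P x j = (\<Sum>K | size K \<le> R. (-1) ^ size K * TM V K (restr V (pd_u K P)) x j)"

lemma dfuns_restr:
  assumes "open V" "order_le r V P" "smooth_jet V UNIV P"
  shows "restr V P \<in> dfuns V"
proof -
  have "smooth_jet V UNIV (restr V P)"
    by (rule smooth_jet_cong[OF assms(1) open_UNIV assms(3)]) (simp add: restr_def)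
  moreover have "order_le r V (restr V P)" using assms(2) by (simp add: order_le_def restr_def)
  ultimately show ?thesis by (auto simp: dfuns_def restr_def)
qed

lemma total_deriv_restr:
  assumes "open V" "x \<in> V"
  shows "total_deriv i (restr V P) x j = total_deriv i P x j" "pd_u K (restr V P) x j = pd_u K P x j"
  using assms by (auto intro!: total_deriv_cong[of V UNIV] pd_u_cong[of UNIV _ _ V] simp: restr_def)

lemma TD_in:
  assumes "open V" "P \<in> dfuns V"
  shows "TD V i P \<in> dfuns V"
proof -
  obtain r where "order_le r V P" "smooth_jet V UNIV P" using assms(2) by (auto simp: dfuns_def)
  then have "restr V (total_deriv i P) \<in> dfuns V"
    using assms(1) by (intro dfuns_restr[where r = "Suc r"] total_deriv_order smooth_jet_total_deriv)
  then show ?thesis using assms(2) by (simp add: TD_def)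
qed

lemma PU_in:
  assumes "open V" "P \<in> dfuns V"
  shows "restr V (pd_u K P) \<in> dfuns V"
proof -
  obtain r where "order_le r V P" "smooth_jet V UNIV P" using assms(2) by (auto simp: dfuns_def)
  then show ?thesis using assms(1) by (intro dfuns_restr pd_u_order smooth_jet_pd_u)
qed

lemma zero_in: "open V \<Longrightarrow> (\<lambda>_ _. 0) \<in> dfuns V"
  by (auto simp: dfuns_def order_le_def intro: smooth_jet_const)

lemma add_in: "open V \<Longrightarrow> P \<in> dfuns V \<Longrightarrow> Q \<in> dfuns V \<Longrightarrow> (\<lambda>x j. P x j + Q x j) \<in> dfuns V"
proof -
  assume a: "open V" "P \<in> dfuns V" "Q \<in> dfuns V"
  then obtain r s where "order_le r V P" "order_le s V Q" by (auto simp: dfuns_def)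
  then have "order_le (max r s) V P" "order_le (max r s) V Q" by (auto elim: order_le_mono)
  then have "order_le (max r s) V (\<lambda>x j. P x j + Q x j)" unfolding order_le_def by metis
  then show ?thesis using a by (auto simp: dfuns_def intro: smooth_jet_add)
qed

lemma sum_in: "open V \<Longrightarrow> (\<And>a. a \<in> A \<Longrightarrow> P a \<in> dfuns V) \<Longrightarrow> (\<lambda>x j. \<Sum>a\<in>A. P a x j) \<in> dfuns V"
  by (induction A rule: infinite_finite_induct) (auto intro: zero_in add_in)

lemma pd_u_add:
  assumes "P \<in> dfuns V" "Q \<in> dfuns V"
  shows "restr V (pd_u K (\<lambda>x j. P x j + Q x j)) = (\<lambda>x j. restr V (pd_u K P) x j + restr V (pd_u K Q) x j)"
proof (intro ext)
  fix x j
  have "pd_u K (\<lambda>x j. P x j + Q x j) x j = pd_u K P x j + pd_u K Q x j" if x: "x \<in> V"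
    unfolding pd_u_def[of K "\<lambda>x j. P x j + Q x j"]
    by (intro DERIV_imp_deriv DERIV_add smooth_jet_du[of V UNIV]) (use assms x in \<open>auto simp: dfuns_def\<close>)
  then show "restr V (pd_u K (\<lambda>x j. P x j + Q x j)) x j = restr V (pd_u K P) x j + restr V (pd_u K Q) x j"
    by (simp add: restr_def)
qed

lemma pd_x_add:
  assumes "P \<in> dfuns V" "Q \<in> dfuns V" "x \<in> V"
  shows "pd_x i (\<lambda>x j. P x j + Q x j) x j = pd_x i P x j + pd_x i Q x j"
  unfolding pd_x_def[of i "\<lambda>x j. P x j + Q x j"]
  by (intro pdI DERIV_add smooth_jet_dx[of V UNIV]) (use assms in \<open>auto simp: dfuns_def\<close>)

lemma TD_add:
  assumes V: "open V" and "P \<in> dfuns V" "Q \<in> dfuns V"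
  shows "TD V i (\<lambda>x j. P x j + Q x j) = (\<lambda>x j. TD V i P x j + TD V i Q x j)"
proof (intro ext)
  fix x j
  show "TD V i (\<lambda>x j. P x j + Q x j) x j = TD V i P x j + TD V i Q x j"
  proof (cases "x \<in> V")
    case x: True
    obtain r s where "order_le r V P" "order_le s V Q" using assms by (auto simp: dfuns_def)
    then have o: "order_le (max r s) V P" "order_le (max r s) V Q" by (auto elim: order_le_mono)
    then have "order_le (max r s) V (\<lambda>x j. P x j + Q x j)" unfolding order_le_def by metis
    note td = total_deriv_sum[OF o(1) x] total_deriv_sum[OF o(2) x] total_deriv_sum[OF this x]
    have "pd_u K (\<lambda>x j. P x j + Q x j) x j = pd_u K P x j + pd_u K Q x j" for K
      using fun_cong[OF fun_cong[OF pd_u_add[OF assms(2,3), of K], of x], of j] x by (simp add: restr_def)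
    then have "total_deriv i (\<lambda>x j. P x j + Q x j) x j = total_deriv i P x j + total_deriv i Q x j"
      unfolding td pd_x_add[OF assms(2,3) x] by (simp add: algebra_simps sum.distrib)
    then show ?thesis using add_in[OF assms] assms by (simp add: TD_def restr_def)
  qed (use assms add_in[OF assms] in \<open>simp add: TD_def restr_def\<close>)
qed

lemma TD_zero: "open V \<Longrightarrow> TD V i (\<lambda>_ _. 0) = (\<lambda>_ _. 0)"
  using TD_add[OF _ zero_in zero_in, of V i] by (simp add: fun_eq_iff)

lemma TD_commute: "open V \<Longrightarrow> TD V i (TD V l P) = TD V l (TD V i P)"
proof (cases "P \<in> dfuns V")
  case True
  assume V: "open V"
  from True obtain r where o: "order_le r V P" "smooth_jet V UNIV P" by (auto simp: dfuns_def)
  have "TD V i (TD V l P) = restr V (total_deriv i (total_deriv l P))" for i l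
    using TD_in[OF V True, of l] True total_deriv_restr(1)[OF V]
    by (auto simp: TD_def restr_def[of _ "total_deriv i _"] fun_eq_iff)
  then show ?thesis using total_deriv_commute[OF V o] by (simp add: restr_def fun_eq_iff)
next
  case False
  assume "open V"
  with False show ?thesis by (simp add: TD_zero TD_def[of V _ P])
qed

lemma TM_simps:
  assumes "open V"
  shows "TM V {#} P = P" "TM V (add_mset i K) P = TD V i (TM V K P)" "TM V K (TD V i P) = TD V i (TM V K P)"
proof -
  interpret comp_fun_commute "TD V"
    by standard (use TD_commute[OF assms] in \<open>auto simp: fun_eq_iff comp_def\<close>)
  show "TM V {#} P = P" "TM V (add_mset i K) P = TD V i (TM V K P)" "TM V K (TD V i P) = TD V i (TM V K P)"
    unfolding TM_def by (simp_all add: fold_mset_fun_left_comm)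
qed

lemma TM_in: "open V \<Longrightarrow> P \<in> dfuns V \<Longrightarrow> TM V K P \<in> dfuns V"
  by (induction K) (auto simp: TM_simps intro: TD_in)

lemma TM_add:
  assumes "open V" "P \<in> dfuns V" "Q \<in> dfuns V"
  shows "TM V K (\<lambda>x j. P x j + Q x j) = (\<lambda>x j. TM V K P x j + TM V K Q x j)"
  by (induction K) (use assms in \<open>auto simp: TM_simps TD_add TM_in\<close>)

lemma TM_zero: "open V \<Longrightarrow> TM V K (\<lambda>_ _. 0) = (\<lambda>_ _. 0)"
  by (induction K) (auto simp: TM_simps TD_zero)

lemma euler_add:
  assumes "open V" "P \<in> dfuns V" "Q \<in> dfuns V"
  shows "euler V R (\<lambda>x j. P x j + Q x j) x j = euler V R P x j + euler V R Q x j"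
  unfolding euler_def pd_u_add[OF assms(2,3)]
  using assms by (simp add: TM_add PU_in algebra_simps sum.distrib)

lemma euler_zero: "open V \<Longrightarrow> euler V R (\<lambda>_ _. 0) x j = 0"
  using euler_add[OF _ zero_in zero_in, of V R x j] by simp

lemma euler_sum:
  assumes "open V" "\<And>a. a \<in> A \<Longrightarrow> P a \<in> dfuns V"
  shows "euler V R (\<lambda>x j. \<Sum>a\<in>A. P a x j) x j = (\<Sum>a\<in>A. euler V R (P a) x j)"
  using assms
proof (induction A rule: infinite_finite_induct)
  case (insert a A)
  then show ?case
    using euler_add[OF assms(1), of "P a" "\<lambda>x j. \<Sum>a\<in>A. P a x j" R x j] by (simp add: sum_in)
qed (auto simp: euler_zero)

text \<open>Write P_K for the derivative of P in u_K. By the commutator, each K contributes (-1)^|K|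
  D_{K + i} P_K and, if i is in K, also (-1)^|K| D_K P_{K - i}. Reindexing the second family by K =
  L + i flips the sign, and the two families cancel. The cutoff \<open>Suc r\<close> bounds the
  order of the total derivative.\<close>

lemma euler_TD:
  assumes V: "open V" and P: "P \<in> dfuns V" and o: "order_le r V P"
  shows "euler V (Suc r) (TD V i P) x j = 0"
proof -
  let ?PU = "\<lambda>K. restr V (pd_u K P)"
  have P': "smooth_jet V UNIV P" using P by (simp add: dfuns_def)
  have PU: "restr V (pd_u K (TD V i P)) = (\<lambda>x j. TD V i (?PU K) x j + (if i \<in># K then ?PU (K - {#i#}) else (\<lambda>_ _. 0)) x j)" for K
  proof (intro ext)
    fix x j
    show "restr V (pd_u K (TD V i P)) x j = TD V i (?PU K) x j + (if i \<in># K then ?PU (K - {#i#}) else (\<lambda>_ _. 0)) x j"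
    proof (cases "x \<in> V")
      case x: True
      show ?thesis
        using x P PU_in[OF V P, of K] total_deriv_restr[OF V x] pd_u_total_deriv[OF V o P' x, of K i j]
        by (simp add: TD_def restr_def[of _ "total_deriv i _"] restr_def[of _ "pd_u _ _"])
    qed (use PU_in[OF V P, of K] in \<open>simp add: restr_def TD_def\<close>)
  qed
  have cond: "(if i \<in># K then ?PU (K - {#i#}) else (\<lambda>_ _. 0)) \<in> dfuns V" for K
    using PU_in[OF V P] zero_in[OF V] by simp
  have "euler V (Suc r) (TD V i P) x j =
      (\<Sum>K | size K \<le> Suc r. (-1) ^ size K * TM V (add_mset i K) (?PU K) x j)
      + (\<Sum>K | size K \<le> Suc r. if i \<in># K then (-1) ^ size K * TM V K (?PU (K - {#i#})) x j else 0)"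
    unfolding euler_def PU TM_add[OF V TD_in[OF V PU_in[OF V P]] cond] sum.distrib[symmetric]
    by (intro sum.cong refl) (auto simp: TM_simps V TM_zero algebra_simps)
  also have "(\<Sum>K | size K \<le> Suc r. if i \<in># K then (-1) ^ size K * TM V K (?PU (K - {#i#})) x j else 0)
      = (\<Sum>L | size L \<le> r. (-1) ^ size (add_mset i L) * TM V (add_mset i L) (?PU L) x j)"
    by (rule sum_multisets_containing)
  \<comment> \<open>Multisets of size \<open>Suc r\<close> exceed the order of \<open>P\<close> and
    drop out, which makes the two index sets equal.\<close>
  also have "(\<Sum>K | size K \<le> Suc r. (-1) ^ size K * TM V (add_mset i K) (?PU K) x j)
      = (\<Sum>K | size K \<le> r. (-1) ^ size K * TM V (add_mset i K) (?PU K) x j)"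
  proof -
    have "?PU K = (\<lambda>_ _. 0)" if "\<not> size K \<le> r" for K
      using pd_u_zero[OF o, of _ K] that by (auto simp: restr_def fun_eq_iff)
    then show ?thesis
      by (intro sum.mono_neutral_right[OF finite_multisets_size_le]) (auto simp: TM_zero[OF V])
  qed
  finally show ?thesis by (simp add: sum.distrib[symmetric])
qed

lemma multisets_size_le_1: "{I :: 'n multiset. size I \<le> Suc 0} = insert {#} (range (\<lambda>i. {#i#}))"
  using size_1_singleton_mset by (force simp: le_Suc_eq)

lemma sum_multisets_size_le_1:
  fixes h :: "'n::finite multiset \<Rightarrow> real"
  shows "(\<Sum>I | size I \<le> Suc 0. h I) = h {#} + (\<Sum>i\<in>UNIV. h {#i#})"
proof -
  have "{#} \<notin> range (\<lambda>i :: 'n. {#i#})" by auto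
  then have "(\<Sum>I | size I \<le> Suc 0. h I) = h {#} + (\<Sum>I\<in>range (\<lambda>i. {#i#}). h I)"
    unfolding multisets_size_le_1 by (subst sum.insert) auto
  also have "(\<Sum>I\<in>range (\<lambda>i. {#i#}). h I) = (\<Sum>i\<in>UNIV. h {#i#})"
    by (subst sum.reindex) (auto simp: inj_on_def)
  finally show ?thesis .
qed

lemma order_1_total_deriv:
  assumes "order_le 1 V P" "x \<in> V"
  shows "total_deriv i P x j = pd_x i P x j + j {#i#} * pd_u {#} P x j + (\<Sum>k\<in>UNIV. j {#i, k#} * pd_u {#k#} P x j)"
  using total_deriv_sum[OF assms, of i j] by (simp add: sum_multisets_size_le_1)

text \<open>However high the order of \<open>\<phi>\<close>, that of \<open>L\<close> is one, so
  only the terms of the Euler operator with multisets of size at most one remain: the classical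
  Euler-Lagrange expression.\<close>

lemma euler_lagrange_divergence:
  fixes \<phi> :: "'n::finite \<Rightarrow> 'n dfun"
  assumes V: "open V" and \<phi>: "\<And>i. differential_function V UNIV (\<phi> i)"
    and L: "\<And>x j. x \<in> V \<Longrightarrow> L x j = (\<Sum>i\<in>UNIV. total_deriv i (\<phi> i) x j)"
    and oL: "order_le 1 V L" and x: "x \<in> V"
  shows "pd_u {#} L x j = (\<Sum>i\<in>UNIV. total_deriv i (pd_u {#i#} L) x j)"
proof -
  have "\<forall>i. \<exists>r. order_le r V (\<phi> i)"
    using \<phi> by (auto simp: differential_function_def order_le_def)
  then obtain r where r: "\<And>i. order_le (r i) V (\<phi> i)" by metis
  \<comment> \<open>The sum of the orders serves as a common bound.\<close>
  define R where "R = (\<Sum>i\<in>UNIV. r i)"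
  have "r i \<le> R" for i unfolding R_def by (intro member_le_sum) auto
  then have oR: "order_le R V (\<phi> i)" for i using r order_le_mono by blast
  have sm: "smooth_jet V UNIV (\<phi> i)" for i using \<phi> by (simp add: differential_function_def smooth_jet_def)
  define \<psi> where "\<psi> i = restr V (\<phi> i)" for i
  have \<psi>: "\<psi> i \<in> dfuns V" for i unfolding \<psi>_def by (rule dfuns_restr[OF V oR sm])
  have o\<psi>: "order_le R V (\<psi> i)" for i using oR by (simp add: order_le_def \<psi>_def restr_def)
  have L\<psi>: "restr V L = (\<lambda>x j. \<Sum>i\<in>UNIV. TD V i (\<psi> i) x j)"
    using \<psi> L total_deriv_restr(1)[OF V, of _ _ "\<phi> _"] unfolding \<psi>_def
    by (auto simp: TD_def restr_def[of V L] restr_def[of _ "total_deriv _ _"] fun_eq_iff)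
  have Lin: "restr V L \<in> dfuns V"
    unfolding L\<psi> by (intro sum_in V TD_in \<psi>)
  have 0: "euler V (Suc R) (restr V L) x j = 0"
    unfolding L\<psi> by (subst euler_sum[OF V TD_in[OF V \<psi>]]) (simp add: euler_TD[OF V \<psi> o\<psi>])
  let ?E = "\<lambda>K. (-1) ^ size K * TM V K (restr V (pd_u K L)) x j"
  have PU: "restr V (pd_u K (restr V L)) = restr V (pd_u K L)" for K
    using total_deriv_restr(2)[OF V] by (auto simp: restr_def[of V "pd_u _ _"] fun_eq_iff)
  have "restr V (pd_u K L) = (\<lambda>_ _. 0)" if "\<not> size K \<le> Suc 0" for K
    using pd_u_zero[OF oL, of _ K] that by (auto simp: restr_def fun_eq_iff)
  then have "(\<Sum>K | size K \<le> Suc R. ?E K) = (\<Sum>K | size K \<le> Suc 0. ?E K)"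
    by (intro sum.mono_neutral_right[OF finite_multisets_size_le]) (auto simp: TM_zero[OF V])
  also have "\<dots> = ?E {#} + (\<Sum>i\<in>UNIV. ?E {#i#})"
    by (rule sum_multisets_size_le_1)
  finally have "?E {#} + (\<Sum>i\<in>UNIV. ?E {#i#}) = 0"
    using 0 by (simp add: euler_def PU)
  moreover have "?E {#} = pd_u {#} L x j" using x by (simp add: TM_simps[OF V] restr_def)
  moreover have "?E {#i#} = - total_deriv i (pd_u {#i#} L) x j" for i
  proof -
    have "restr V (pd_u {#i#} L) \<in> dfuns V" using PU_in[OF V Lin, of "{#i#}"] PU by simp
    then show ?thesis using x total_deriv_restr(1)[OF V x]
      by (simp add: TM_simps[OF V] TD_def restr_def[of _ "total_deriv _ _"])
  qed
  ultimately show ?thesis by (simp add: sum_negf)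
qed

section \<open>The metric in a chart\<close>

lemma smooth_on_vec_nth: "open V \<Longrightarrow> smooth_on V f \<Longrightarrow> smooth_on V (\<lambda>x. f x $ i)"
  by (rule smooth_on_bounded_linear[OF _ bounded_linear_vec_nth])

lemma smooth_on_det:
  fixes M :: "'a::real_normed_vector \<Rightarrow> real^'k^'k"
  assumes "open V" "\<And>i j. smooth_on V (\<lambda>x. M x $ i $ j)"
  shows "smooth_on V (\<lambda>x. det (M x))"
  unfolding det_def by (intro smooth_on_sum smooth_on_mult smooth_on_const smooth_on_prod assms)

lemma pd_prod:
  fixes f :: "'i \<Rightarrow> real^'n::finite \<Rightarrow> real"
  assumes "open V" "x \<in> V" "finite I" "\<And>i. smooth_on V (f i)"
  shows "pd k (\<lambda>y. \<Prod>i\<in>I. f i y) x = (\<Sum>i\<in>I. pd k (f i) x * (\<Prod>m\<in>I - {i}. f m x))"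
  using assms(3)
proof (induction I)
  case (insert a I)
  have "pd k (\<lambda>y. \<Prod>i\<in>insert a I. f i y) x = pd k (\<lambda>y. f a y * (\<Prod>i\<in>I. f i y)) x"
    using insert by simp
  also have "\<dots> = pd k (f a) x * (\<Prod>i\<in>I. f i x) + f a x * pd k (\<lambda>y. \<Prod>i\<in>I. f i y) x"
    by (rule pd_mult) (use assms in \<open>auto intro!: smooth_on_differentiable[of V] smooth_on_prod\<close>)
  also have "f a x * pd k (\<lambda>y. \<Prod>i\<in>I. f i y) x = (\<Sum>i\<in>I. pd k (f i) x * (\<Prod>m\<in>insert a I - {i}. f m x))"
    unfolding insert.IH sum_distrib_left
  proof (rule sum.cong[OF refl])
    fix i assume "i \<in> I"
    then have "insert a I - {i} = insert a (I - {i})" using insert by auto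
    then show "f a x * (pd k (f i) x * (\<Prod>m\<in>I - {i}. f m x)) = pd k (f i) x * (\<Prod>m\<in>insert a I - {i}. f m x)"
      using insert by simp
  qed
  also have "(\<Prod>i\<in>I. f i x) = (\<Prod>m\<in>insert a I - {a}. f m x)"
    using insert by simp
  finally show ?case using insert by simp
qed simp

locale chart_metric =
  fixes V :: "(real^'n::finite) set" and g :: "real^'n \<Rightarrow> real^'n^'n"
  assumes open_V: "open V" and smooth_g: "smooth_on V g"
    and transpose_g: "\<And>x. x \<in> V \<Longrightarrow> transpose (g x) = g x"
    and invertible_g: "\<And>x. x \<in> V \<Longrightarrow> invertible (g x)"
begin

text \<open>The logarithmic derivative of the volume density, which is also the contracted
  Christoffel symbol.\<close>

definition W :: "'n \<Rightarrow> real^'n \<Rightarrow> real" where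
  "W k x = 1/2 * (\<Sum>a\<in>UNIV. \<Sum>b\<in>UNIV. ginv g a b x * pd k (\<lambda>y. g y $ a $ b) x)"

definition vol :: "real^'n \<Rightarrow> real" where
  "vol x = sqrt \<bar>det (g x)\<bar>"

lemma smooth_g_comp: "smooth_on V (\<lambda>x. g x $ i $ j)"
  by (intro smooth_on_vec_nth open_V smooth_g)

lemma g_sym: "x \<in> V \<Longrightarrow> g x $ i $ j = g x $ j $ i"
  using transpose_g[of x] by (metis transpose_def vec_lambda_beta)

lemma matrix_inv_g:
  assumes "x \<in> V"
  shows "g x ** matrix_inv (g x) = mat 1" "matrix_inv (g x) ** g x = mat 1"
  using someI_ex[OF invertible_g[OF assms, unfolded invertible_def]] by (auto simp: matrix_inv_def)

lemma g_ginv: "x \<in> V \<Longrightarrow> (\<Sum>b\<in>UNIV. g x $ a $ b * ginv g b c x) = (if a = c then 1 else 0)"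
  using matrix_inv_g(1)[of x] by (simp add: matrix_matrix_mult_def mat_def vec_eq_iff ginv_def)

lemma ginv_g: "x \<in> V \<Longrightarrow> (\<Sum>b\<in>UNIV. ginv g a b x * g x $ b $ c) = (if a = c then 1 else 0)"
  using matrix_inv_g(2)[of x] by (simp add: matrix_matrix_mult_def mat_def vec_eq_iff ginv_def)

lemma ginv_sym:
  assumes "x \<in> V"
  shows "ginv g i j x = ginv g j i x"
proof -
  let ?G = "matrix_inv (g x)"
  have "transpose ?G ** g x = mat 1"
    using matrix_inv_g(1)[OF assms] transpose_g[OF assms] matrix_transpose_mul[of "g x" ?G] by (simp add: transpose_mat)
  then have "transpose ?G = ?G"
    using matrix_inv_g(1)[OF assms] by (metis matrix_mul_assoc matrix_mul_lid matrix_mul_rid)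
  then show ?thesis unfolding ginv_def by (metis transpose_def vec_lambda_beta)
qed

lemma det_g: "x \<in> V \<Longrightarrow> det (g x) \<noteq> 0"
  using invertible_g invertible_det_nz by blast

lemma vol_pos: "x \<in> V \<Longrightarrow> vol x > 0"
  using det_g by (simp add: vol_def)

lemma smooth_det_g: "smooth_on V (\<lambda>x. det (g x))"
proof -
  have "smooth_on V (\<lambda>x. g x $ i $ j)" for i j by (rule smooth_g_comp)
  then show ?thesis by (rule smooth_on_det[OF open_V])
qed

lemma smooth_vol: "smooth_on V vol"
  unfolding vol_def[abs_def] by (intro smooth_on_sqrt_abs open_V smooth_det_g det_g)

text \<open>Cramer's rule shows the inverse metric as a rational function of the metric, from which
  its smoothness follows.\<close>

lemma ginv_cramer:
  assumes "x \<in> V"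
  shows "ginv g k j x = det (\<chi> i m. if m = k then axis j 1 $ i else g x $ i $ m) * inverse (det (g x))"
proof -
  have "g x *v (\<chi> i. ginv g i j x) = axis j 1"
    by (simp add: vec_eq_iff matrix_vector_mult_def g_ginv assms axis_def)
  then have "(\<chi> i. ginv g i j x) = (\<chi> k. det (\<chi> i m. if m = k then axis j 1 $ i else g x $ i $ m) / det (g x))"
    using cramer[OF det_g[OF assms]] by blast
  then show ?thesis by (simp add: vec_eq_iff divide_inverse)
qed

lemma smooth_ginv: "smooth_on V (ginv g i j)"
proof (rule smooth_on_cong[OF open_V])
  show "smooth_on V (\<lambda>x. det (\<chi> k m. if m = i then axis j 1 $ k else g x $ k $ m) * inverse (det (g x)))"
  proof (intro smooth_det_g smooth_on_mult smooth_on_inverse smooth_on_det open_V det_g)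
    show "smooth_on V (\<lambda>x. (\<chi> k m. if m = i then axis j 1 $ k else g x $ k $ m) $ a $ b)" for a b
      by (cases "b = i") (simp_all add: smooth_on_const smooth_g_comp)
  qed
qed (simp add: ginv_cramer)

lemma smooth_pd: "smooth_on V h \<Longrightarrow> smooth_on V (pd i h)"
  by (rule smooth_on_pd[OF open_V])

lemma smooth_W: "smooth_on V (W k)"
  unfolding W_def[abs_def]
  by (intro smooth_on_mult smooth_on_const smooth_on_sum smooth_ginv smooth_pd smooth_g_comp open_V)

lemma diff: "x \<in> V \<Longrightarrow> smooth_on V h \<Longrightarrow> h differentiable (at x)"
  by (rule smooth_on_differentiable)

text \<open>Jacobi's formula. Differentiating one row at a time, the differentiated row is a
  combination of the rows of \<open>g x\<close>, and only its component along the row that it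
  replaces contributes to the determinant.\<close>

lemma pd_det_g:
  assumes x: "x \<in> V"
  shows "pd k (\<lambda>y. det (g y)) x = 2 * W k x * det (g x)"
proof -
  let ?d = "\<lambda>i j. pd k (\<lambda>y. g y $ i $ j) x"
  let ?P = "{p. p permutes (UNIV :: 'n set)}"
  have "pd k (\<lambda>y. det (g y)) x = (\<Sum>p\<in>?P. pd k (\<lambda>y. of_int (sign p) * (\<Prod>i\<in>UNIV. g y $ i $ p i)) x)"
    unfolding det_def
    by (rule pd_sum) (intro diff[OF x] smooth_on_mult smooth_on_const smooth_on_prod open_V smooth_g_comp)
  also have "\<dots> = (\<Sum>p\<in>?P. of_int (sign p) * (\<Sum>i\<in>UNIV. ?d i (p i) * (\<Prod>m\<in>UNIV - {i}. g x $ m $ p m)))"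
    by (intro sum.cong refl, subst pd_cmult)
      (auto intro!: diff[OF x] smooth_on_prod open_V smooth_g_comp simp: pd_prod[OF open_V x _ smooth_g_comp])
  also have "\<dots> = (\<Sum>p\<in>?P. \<Sum>i\<in>UNIV. of_int (sign p) * (?d i (p i) * (\<Prod>m\<in>UNIV - {i}. g x $ m $ p m)))"
    by (simp add: sum_distrib_left)
  also have "\<dots> = (\<Sum>i\<in>UNIV. \<Sum>p\<in>?P. of_int (sign p) * (?d i (p i) * (\<Prod>m\<in>UNIV - {i}. g x $ m $ p m)))"
    by (rule sum.swap)
  also have "\<dots> = (\<Sum>i\<in>UNIV. det (\<chi> m. if m = i then (\<chi> c. ?d i c) else g x $ m))"
  proof (intro sum.cong refl)
    fix i
    have "(\<Prod>m\<in>UNIV. (\<chi> m. if m = i then (\<chi> c. ?d i c) else g x $ m) $ m $ p m)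
        = ?d i (p i) * (\<Prod>m\<in>UNIV - {i}. g x $ m $ p m)" for p
      by (subst prod.remove[of UNIV i]) (auto intro!: prod.cong)
    then show "(\<Sum>p\<in>?P. of_int (sign p) * (?d i (p i) * (\<Prod>m\<in>UNIV - {i}. g x $ m $ p m)))
        = det (\<chi> m. if m = i then (\<chi> c. ?d i c) else g x $ m)"
      unfolding det_def by simp
  qed
  also have "\<dots> = (\<Sum>i\<in>UNIV. (\<Sum>c\<in>UNIV. ?d i c * ginv g c i x) * det (g x))"
  proof (intro sum.cong refl)
    fix i
    \<comment> \<open>Coefficients of the differentiated row in terms of the rows of
      \<open>g x\<close>, obtained by multiplying with the inverse metric.\<close>
    let ?x = "\<chi> l. \<Sum>c\<in>UNIV. ?d i c * ginv g c l x"
    have "(\<Sum>l\<in>UNIV. ?x $ l * g x $ l $ b) = ?d i b" for b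
    proof -
      have "(\<Sum>l\<in>UNIV. ?x $ l * g x $ l $ b) = (\<Sum>l\<in>UNIV. \<Sum>c\<in>UNIV. ?d i c * (ginv g c l x * g x $ l $ b))"
        by (simp add: sum_distrib_right mult.assoc)
      also have "\<dots> = (\<Sum>c\<in>UNIV. ?d i c * (\<Sum>l\<in>UNIV. ginv g c l x * g x $ l $ b))"
        by (subst sum.swap) (simp add: sum_distrib_left)
      also have "\<dots> = ?d i b" by (simp add: ginv_g x if_distrib cong: if_cong)
      finally show ?thesis .
    qed
    then have "(\<chi> m. if m = i then (\<chi> c. ?d i c) else g x $ m)
        = (\<chi> m. if m = i then sum (\<lambda>l. ?x $ l *s row l (g x)) UNIV else row m (g x))"
      by (simp add: vec_eq_iff row_def)
    then show "det (\<chi> m. if m = i then (\<chi> c. ?d i c) else g x $ m) = (\<Sum>c\<in>UNIV. ?d i c * ginv g c i x) * det (g x)"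
      using cramer_lemma_transpose[of i ?x "g x"] by simp
  qed
  also have "\<dots> = 2 * W k x * det (g x)"
    by (simp add: W_def sum_distrib_left sum_distrib_right ginv_sym[OF x] mult_ac)
  finally show ?thesis .
qed

lemma pd_vol:
  assumes x: "x \<in> V"
  shows "pd k vol x = vol x * W k x"
proof -
  \<comment> \<open>Near x the sign of the determinant is constant, so the square of the density is
    differentiated without touching the absolute value or the root.\<close>
  have sq: "vol y * vol y = sgn (det (g x)) * det (g y)" if "y \<in> V \<inter> (\<lambda>y. sgn (det (g x)) * det (g y)) -` {0<..}" for y
  proof -
    have "sgn (det (g x)) * det (g y) > 0" using that by auto
    then have "\<bar>det (g y)\<bar> = sgn (det (g x)) * det (g y)"
      by (auto simp: sgn_if zero_less_mult_iff split: if_splits)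
    then show ?thesis by (simp add: vol_def)
  qed
  have "continuous_on V (\<lambda>y. sgn (det (g x)) * det (g y))"
    by (intro continuous_intros smooth_on_continuous smooth_det_g)
  then have op: "open (V \<inter> (\<lambda>y. sgn (det (g x)) * det (g y)) -` {0<..})"
    by (rule continuous_open_preimage[OF _ open_V open_greaterThan])
  have xin: "x \<in> V \<inter> (\<lambda>y. sgn (det (g x)) * det (g y)) -` {0<..}"
    using x det_g[OF x] by (simp add: sgn_if)
  have "2 * vol x * pd k vol x = pd k (\<lambda>y. vol y * vol y) x"
    by (subst pd_mult) (auto intro!: diff[OF x] smooth_vol)
  also have "\<dots> = pd k (\<lambda>y. sgn (det (g x)) * det (g y)) x"
    by (rule pd_cong[OF op xin]) (rule sq)
  also have "\<dots> = sgn (det (g x)) * (2 * W k x * det (g x))"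
    by (subst pd_cmult) (auto intro!: diff[OF x] smooth_det_g simp: pd_det_g[OF x])
  also have "\<dots> = 2 * W k x * (vol x * vol x)"
    by (simp add: sq[OF xin])
  finally show ?thesis using vol_pos[OF x] by (simp add: field_simps)
qed

text \<open>Differentiate the product of the inverse metric with the metric, which is constant, and
  solve for the derivative of the inverse.\<close>

lemma pd_ginv:
  assumes x: "x \<in> V"
  shows "pd k (ginv g i j) x = - (\<Sum>a\<in>UNIV. \<Sum>b\<in>UNIV. ginv g i a x * pd k (\<lambda>y. g y $ a $ b) x * ginv g b j x)"
proof -
  let ?d = "\<lambda>i j. pd k (\<lambda>y. g y $ i $ j) x" and ?D = "\<lambda>i j. pd k (ginv g i j) x"
  have *: "(\<Sum>a\<in>UNIV. ?D i a * g x $ a $ b + ginv g i a x * ?d a b) = 0" for b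
  proof -
    have "(\<Sum>a\<in>UNIV. ?D i a * g x $ a $ b + ginv g i a x * ?d a b) = pd k (\<lambda>y. \<Sum>a\<in>UNIV. ginv g i a y * g y $ a $ b) x"
      using diff[OF x smooth_ginv] diff[OF x smooth_g_comp] by (simp add: pd_sum pd_mult)
    also have "\<dots> = pd k (\<lambda>_. if i = b then 1 else 0) x"
      by (rule pd_cong[OF open_V x]) (simp add: ginv_g)
    finally show ?thesis by simp
  qed
  have "?D i j = (\<Sum>a\<in>UNIV. ?D i a * (\<Sum>b\<in>UNIV. g x $ a $ b * ginv g b j x))"
    by (simp add: g_ginv x if_distrib cong: if_cong)
  also have "\<dots> = (\<Sum>b\<in>UNIV. (\<Sum>a\<in>UNIV. ?D i a * g x $ a $ b) * ginv g b j x)"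
    by (simp add: sum_distrib_left sum_distrib_right mult.assoc) (rule sum.swap)
  also have "\<dots> = (\<Sum>b\<in>UNIV. - (\<Sum>a\<in>UNIV. ginv g i a x * ?d a b) * ginv g b j x)"
  proof -
    have "(\<Sum>a\<in>UNIV. ?D i a * g x $ a $ b) = - (\<Sum>a\<in>UNIV. ginv g i a x * ?d a b)" for b
      using *[of b] by (simp add: sum.distrib eq_neg_iff_add_eq_0)
    then show ?thesis by simp
  qed
  also have "\<dots> = - (\<Sum>a\<in>UNIV. \<Sum>b\<in>UNIV. ginv g i a x * ?d a b * ginv g b j x)"
    by (simp add: sum_distrib_right sum_negf) (rule sum.swap)
  finally show ?thesis .
qed

text \<open>\<open>W\<close> is the gradient of log \<open>vol\<close>, so the symmetry of the
  second derivatives of \<open>vol\<close> carries over.\<close>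

lemma pd_W_commute:
  assumes x: "x \<in> V"
  shows "pd i (W k) x = pd k (W i) x"
proof -
  have *: "pd i (pd k vol) x = vol x * W i x * W k x + vol x * pd i (W k) x" for i k
  proof -
    have "pd i (pd k vol) x = pd i (\<lambda>y. vol y * W k y) x"
      by (rule pd_cong[OF open_V x]) (rule pd_vol)
    then show ?thesis
      by (simp add: pd_mult[OF diff[OF x smooth_vol] diff[OF x smooth_W]] pd_vol[OF x])
  qed
  have "vol x * W i x * W k x + vol x * pd i (W k) x = vol x * W k x * W i x + vol x * pd k (W i) x"
    unfolding *[symmetric] by (rule pd_pd_commute[OF open_V smooth_vol x])
  then have "vol x * (pd i (W k) x - pd k (W i) x) = 0" by (simp add: algebra_simps)
  then show ?thesis using vol_pos[OF x] by simp
qed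

text \<open>Equivalently - (1/sqrt g) d_j (sqrt g g^{ij}). This form exposes the divergence
  structure of the Laplacian and replaces the Christoffel symbols in the conformal
  identities.\<close>

lemma christoffel_trace_eq:
  assumes x: "x \<in> V"
  shows "christoffel_trace g i x = - (\<Sum>j\<in>UNIV. pd j (ginv g i j) x) - (\<Sum>j\<in>UNIV. ginv g i j x * W j x)"
proof -
  let ?G = "\<lambda>i j. ginv g i j x" and ?d = "\<lambda>k i j. pd k (\<lambda>y. g y $ i $ j) x"
  have "christoffel_trace g i x = 1/2 * ((\<Sum>p\<in>UNIV. \<Sum>q\<in>UNIV. \<Sum>l\<in>UNIV. ?G p q * ?G i l * ?d p l q)
      + (\<Sum>p\<in>UNIV. \<Sum>q\<in>UNIV. \<Sum>l\<in>UNIV. ?G p q * ?G i l * ?d q l p)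
      - (\<Sum>p\<in>UNIV. \<Sum>q\<in>UNIV. \<Sum>l\<in>UNIV. ?G p q * ?G i l * ?d l p q))"
    unfolding christoffel_trace_def christoffel_def sum_distrib_left sum.distrib[symmetric] sum_subtractf[symmetric]
    by (intro sum.cong refl) (simp add: algebra_simps)
  also have "(\<Sum>p\<in>UNIV. \<Sum>q\<in>UNIV. \<Sum>l\<in>UNIV. ?G p q * ?G i l * ?d q l p)
      = (\<Sum>p\<in>UNIV. \<Sum>q\<in>UNIV. \<Sum>l\<in>UNIV. ?G p q * ?G i l * ?d p l q)"
    by (subst sum.swap) (intro sum.cong refl, simp add: ginv_sym[OF x])
  also have "(\<Sum>p\<in>UNIV. \<Sum>q\<in>UNIV. \<Sum>l\<in>UNIV. ?G p q * ?G i l * ?d p l q) = - (\<Sum>j\<in>UNIV. pd j (ginv g i j) x)"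
    unfolding pd_ginv[OF x] sum_negf minus_minus
    by (rule sum.cong[OF refl], subst sum.swap) (intro sum.cong refl, simp add: ginv_sym[OF x] mult_ac)
  also have "(\<Sum>p\<in>UNIV. \<Sum>q\<in>UNIV. \<Sum>l\<in>UNIV. ?G p q * ?G i l * ?d l p q) = 2 * (\<Sum>j\<in>UNIV. ginv g i j x * W j x)"
  proof -
    have "(\<Sum>p\<in>UNIV. \<Sum>q\<in>UNIV. \<Sum>l\<in>UNIV. ?G p q * ?G i l * ?d l p q) = (\<Sum>l\<in>UNIV. \<Sum>p\<in>UNIV. \<Sum>q\<in>UNIV. ?G p q * ?G i l * ?d l p q)"
      by (subst (2) sum.swap, subst sum.swap) simp
    then show ?thesis by (simp add: W_def sum_distrib_left mult_ac)
  qed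
  finally show ?thesis by simp
qed

lemma smooth_christoffel_trace: "smooth_on V (christoffel_trace g i)"
  by (rule smooth_on_cong[OF open_V, of "\<lambda>x. - (\<Sum>j\<in>UNIV. pd j (ginv g i j) x) - (\<Sum>j\<in>UNIV. ginv g i j x * W j x)"])
    (auto intro!: smooth_on_diff smooth_on_uminus smooth_on_sum smooth_on_mult open_V smooth_pd smooth_ginv smooth_W
      simp: christoffel_trace_eq)

section \<open>Conformal vector fields\<close>

text \<open>The Lie derivative of the metric with both indices raised, that is, minus the Lie
  derivative of the inverse metric. The quadratic part of the Lagrangian and the leading part of the
  equation contain \<open>ginv\<close>, so their variations come in this form.\<close>

definition raised_lie :: "(real^'n \<Rightarrow> real^'n) \<Rightarrow> 'n \<Rightarrow> 'n \<Rightarrow> real^'n \<Rightarrow> real" where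
  "raised_lie \<xi> i j x = - (\<Sum>k\<in>UNIV. \<xi> x $ k * pd k (ginv g i j) x)
     + (\<Sum>k\<in>UNIV. ginv g i k x * pd k (\<lambda>y. \<xi> y $ j) x) + (\<Sum>k\<in>UNIV. ginv g j k x * pd k (\<lambda>y. \<xi> y $ i) x)"

text \<open>The Riemannian divergence (1/sqrt g) d_k (sqrt g \<xi>^k), expanded.\<close>

definition divergence :: "(real^'n \<Rightarrow> real^'n) \<Rightarrow> real^'n \<Rightarrow> real" where
  "divergence \<xi> x = (\<Sum>k\<in>UNIV. \<xi> x $ k * W k x) + (\<Sum>k\<in>UNIV. pd k (\<lambda>y. \<xi> y $ k) x)"

lemma raise_lie_metric:
  assumes x: "x \<in> V"
  shows "(\<Sum>a\<in>UNIV. \<Sum>b\<in>UNIV. ginv g i a x * ginv g j b x * lie_metric g \<xi> a b x) = raised_lie \<xi> i j x"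
proof -
  let ?G = "\<lambda>i j. ginv g i j x" and ?d = "\<lambda>k i j. pd k (\<lambda>y. g y $ i $ j) x" and ?x = "\<lambda>k. \<xi> x $ k"
  let ?p = "\<lambda>a k. pd a (\<lambda>y. \<xi> y $ k) x"
  have "(\<Sum>a\<in>UNIV. \<Sum>b\<in>UNIV. ?G i a * ?G j b * lie_metric g \<xi> a b x)
     = (\<Sum>a\<in>UNIV. \<Sum>b\<in>UNIV. \<Sum>k\<in>UNIV. ?G i a * ?G j b * (?x k * ?d k a b))
     + (\<Sum>a\<in>UNIV. \<Sum>b\<in>UNIV. \<Sum>k\<in>UNIV. ?G i a * ?G j b * (g x $ k $ b * ?p a k))
     + (\<Sum>a\<in>UNIV. \<Sum>b\<in>UNIV. \<Sum>k\<in>UNIV. ?G i a * ?G j b * (g x $ a $ k * ?p b k))"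
    unfolding lie_metric_def sum_distrib_left sum.distrib[symmetric]
    by (intro sum.cong refl) (simp add: algebra_simps)
  also have "(\<Sum>a\<in>UNIV. \<Sum>b\<in>UNIV. \<Sum>k\<in>UNIV. ?G i a * ?G j b * (?x k * ?d k a b)) = - (\<Sum>k\<in>UNIV. ?x k * pd k (ginv g i j) x)"
  proof -
    have "(\<Sum>a\<in>UNIV. \<Sum>b\<in>UNIV. \<Sum>k\<in>UNIV. ?G i a * ?G j b * (?x k * ?d k a b))
        = (\<Sum>k\<in>UNIV. \<Sum>a\<in>UNIV. \<Sum>b\<in>UNIV. ?G i a * ?G j b * (?x k * ?d k a b))"
      by (subst (2) sum.swap, subst sum.swap) simp
    then show ?thesis
      by (simp add: pd_ginv[OF x] sum_negf sum_distrib_left ginv_sym[OF x, of j] mult_ac)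
  qed
  also have "(\<Sum>a\<in>UNIV. \<Sum>b\<in>UNIV. \<Sum>k\<in>UNIV. ?G i a * ?G j b * (g x $ k $ b * ?p a k)) = (\<Sum>a\<in>UNIV. ?G i a * ?p a j)"
  proof (intro sum.cong refl)
    fix a
    have "(\<Sum>b\<in>UNIV. \<Sum>k\<in>UNIV. ?G i a * ?G j b * (g x $ k $ b * ?p a k))
       = (\<Sum>k\<in>UNIV. \<Sum>b\<in>UNIV. ?G i a * ?G j b * (g x $ k $ b * ?p a k))" by (rule sum.swap)
    also have "\<dots> = (\<Sum>k\<in>UNIV. ?G i a * ?p a k * (\<Sum>b\<in>UNIV. ?G j b * g x $ b $ k))"
      by (simp add: sum_distrib_left mult_ac g_sym[OF x])
    also have "\<dots> = ?G i a * ?p a j" by (simp add: ginv_g x if_distrib cong: if_cong)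
    finally show "(\<Sum>b\<in>UNIV. \<Sum>k\<in>UNIV. ?G i a * ?G j b * (g x $ k $ b * ?p a k)) = ?G i a * ?p a j" .
  qed
  also have "(\<Sum>a\<in>UNIV. \<Sum>b\<in>UNIV. \<Sum>k\<in>UNIV. ?G i a * ?G j b * (g x $ a $ k * ?p b k))
      = (\<Sum>b\<in>UNIV. \<Sum>a\<in>UNIV. \<Sum>k\<in>UNIV. ?G i a * ?G j b * (g x $ a $ k * ?p b k))"
    by (rule sum.swap)
  also have "\<dots> = (\<Sum>b\<in>UNIV. ?G j b * ?p b i)"
  proof (rule sum.cong[OF refl])
    fix b
    have "(\<Sum>a\<in>UNIV. \<Sum>k\<in>UNIV. ?G i a * ?G j b * (g x $ a $ k * ?p b k))
       = (\<Sum>k\<in>UNIV. \<Sum>a\<in>UNIV. ?G i a * ?G j b * (g x $ a $ k * ?p b k))" by (rule sum.swap)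
    also have "\<dots> = (\<Sum>k\<in>UNIV. ?G j b * ?p b k * (\<Sum>a\<in>UNIV. ?G i a * g x $ a $ k))"
      by (simp add: sum_distrib_left mult_ac)
    also have "\<dots> = ?G j b * ?p b i" by (simp add: ginv_g x if_distrib cong: if_cong)
    finally show "(\<Sum>a\<in>UNIV. \<Sum>k\<in>UNIV. ?G i a * ?G j b * (g x $ a $ k * ?p b k)) = ?G j b * ?p b i" .
  qed
  finally show ?thesis by (simp add: raised_lie_def)
qed

lemma raise_multiple_of_metric:
  assumes x: "x \<in> V"
  shows "(\<Sum>a\<in>UNIV. \<Sum>b\<in>UNIV. ginv g i a x * ginv g j b x * (m * g x $ a $ b)) = m * ginv g i j x"
proof -
  have "(\<Sum>a\<in>UNIV. \<Sum>b\<in>UNIV. ginv g i a x * ginv g j b x * (m * g x $ a $ b))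
      = (\<Sum>a\<in>UNIV. m * ginv g i a x * (\<Sum>b\<in>UNIV. ginv g j b x * g x $ b $ a))"
    by (simp add: sum_distrib_left mult_ac g_sym[OF x])
  also have "\<dots> = m * ginv g i j x" by (simp add: ginv_g x if_distrib cong: if_cong)
  finally show ?thesis .
qed

lemma lower_raised:
  assumes x: "x \<in> V"
  shows "(\<Sum>i\<in>UNIV. \<Sum>j\<in>UNIV. g x $ c $ i * g x $ e $ j * (\<Sum>a\<in>UNIV. \<Sum>b\<in>UNIV. ginv g i a x * ginv g j b x * h a b)) = h c e"
proof -
  have "(\<Sum>i\<in>UNIV. \<Sum>j\<in>UNIV. g x $ c $ i * g x $ e $ j * (\<Sum>a\<in>UNIV. \<Sum>b\<in>UNIV. ginv g i a x * ginv g j b x * h a b))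
     = (\<Sum>i\<in>UNIV. \<Sum>j\<in>UNIV. \<Sum>a\<in>UNIV. \<Sum>b\<in>UNIV. (g x $ c $ i * ginv g i a x) * (g x $ e $ j * ginv g j b x) * h a b)"
    by (simp add: sum_distrib_left mult_ac)
  also have "\<dots> = (\<Sum>i\<in>UNIV. \<Sum>a\<in>UNIV. \<Sum>j\<in>UNIV. \<Sum>b\<in>UNIV. (g x $ c $ i * ginv g i a x) * (g x $ e $ j * ginv g j b x) * h a b)"
    by (rule sum.cong[OF refl], rule sum.swap)
  also have "\<dots> = (\<Sum>a\<in>UNIV. \<Sum>i\<in>UNIV. \<Sum>b\<in>UNIV. \<Sum>j\<in>UNIV. (g x $ c $ i * ginv g i a x) * (g x $ e $ j * ginv g j b x) * h a b)"
    by (subst sum.swap, rule sum.cong[OF refl], rule sum.cong[OF refl], rule sum.swap)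
  also have "\<dots> = (\<Sum>a\<in>UNIV. \<Sum>b\<in>UNIV. (\<Sum>i\<in>UNIV. g x $ c $ i * ginv g i a x) * (\<Sum>j\<in>UNIV. g x $ e $ j * ginv g j b x) * h a b)"
    unfolding sum_product unfolding sum_distrib_right by (rule sum.cong[OF refl], rule sum.swap)
  also have "\<dots> = (\<Sum>a\<in>UNIV. (if c = a then 1 else 0) * (\<Sum>b\<in>UNIV. (if e = b then 1 else 0) * h a b))"
    by (simp add: g_ginv x sum_distrib_left mult.assoc)
  also have "\<dots> = h c e" by (simp add: if_distrib[of "\<lambda>u. u * _"] cong: if_cong)
  finally show ?thesis .
qed

text \<open>Raising and lowering indices are inverse to each other, and raising both indices turns
  the metric into its inverse.\<close>

lemma conformal_iff_raised:
  assumes x: "x \<in> V"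
  shows "(\<forall>i j. lie_metric g \<xi> i j x = m * g x $ i $ j) \<longleftrightarrow> (\<forall>i j. raised_lie \<xi> i j x = m * ginv g i j x)"
proof
  assume "\<forall>i j. lie_metric g \<xi> i j x = m * g x $ i $ j"
  then show "\<forall>i j. raised_lie \<xi> i j x = m * ginv g i j x"
    by (simp add: raise_lie_metric[OF x, symmetric] raise_multiple_of_metric[OF x])
next
  assume r: "\<forall>i j. raised_lie \<xi> i j x = m * ginv g i j x"
  show "\<forall>i j. lie_metric g \<xi> i j x = m * g x $ i $ j"
  proof (intro allI)
    fix c e
    have "lie_metric g \<xi> c e x = (\<Sum>i\<in>UNIV. \<Sum>j\<in>UNIV. g x $ c $ i * g x $ e $ j * (m * ginv g i j x))"
      using lower_raised[OF x, of c e "\<lambda>a b. lie_metric g \<xi> a b x"] by (simp add: raise_lie_metric[OF x] r)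
    also have "\<dots> = m * g x $ c $ e"
      using lower_raised[OF x, of c e "\<lambda>a b. m * g x $ a $ b"] by (simp add: raise_multiple_of_metric[OF x])
    finally show "lie_metric g \<xi> c e x = m * g x $ c $ e" .
  qed
qed

lemma trace_ginv_g: "x \<in> V \<Longrightarrow> (\<Sum>a\<in>UNIV. \<Sum>b\<in>UNIV. ginv g a b x * g x $ a $ b) = real CARD('n)"
  using ginv_g[of x] by (simp add: g_sym)

lemma trace_lie_metric:
  assumes x: "x \<in> V"
  shows "(\<Sum>a\<in>UNIV. \<Sum>b\<in>UNIV. ginv g a b x * lie_metric g \<xi> a b x) = 2 * divergence \<xi> x"
proof -
  let ?G = "\<lambda>i j. ginv g i j x" and ?d = "\<lambda>k i j. pd k (\<lambda>y. g y $ i $ j) x" and ?x = "\<lambda>k. \<xi> x $ k"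
  let ?p = "\<lambda>a k. pd a (\<lambda>y. \<xi> y $ k) x"
  have "(\<Sum>a\<in>UNIV. \<Sum>b\<in>UNIV. ?G a b * lie_metric g \<xi> a b x)
     = (\<Sum>a\<in>UNIV. \<Sum>b\<in>UNIV. \<Sum>k\<in>UNIV. ?G a b * (?x k * ?d k a b))
     + (\<Sum>a\<in>UNIV. \<Sum>b\<in>UNIV. \<Sum>k\<in>UNIV. ?G a b * (g x $ k $ b * ?p a k))
     + (\<Sum>a\<in>UNIV. \<Sum>b\<in>UNIV. \<Sum>k\<in>UNIV. ?G a b * (g x $ a $ k * ?p b k))"
    unfolding lie_metric_def sum_distrib_left sum.distrib[symmetric]
    by (intro sum.cong refl) (simp add: algebra_simps)
  also have "(\<Sum>a\<in>UNIV. \<Sum>b\<in>UNIV. \<Sum>k\<in>UNIV. ?G a b * (?x k * ?d k a b)) = 2 * (\<Sum>k\<in>UNIV. ?x k * W k x)"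
  proof -
    have "(\<Sum>a\<in>UNIV. \<Sum>b\<in>UNIV. \<Sum>k\<in>UNIV. ?G a b * (?x k * ?d k a b))
        = (\<Sum>k\<in>UNIV. \<Sum>a\<in>UNIV. \<Sum>b\<in>UNIV. ?G a b * (?x k * ?d k a b))"
      by (subst (2) sum.swap, subst sum.swap) simp
    then show ?thesis by (simp add: W_def sum_distrib_left mult_ac)
  qed
  also have "(\<Sum>a\<in>UNIV. \<Sum>b\<in>UNIV. \<Sum>k\<in>UNIV. ?G a b * (g x $ k $ b * ?p a k)) = (\<Sum>a\<in>UNIV. ?p a a)"
  proof (intro sum.cong refl)
    fix a
    have "(\<Sum>b\<in>UNIV. \<Sum>k\<in>UNIV. ?G a b * (g x $ k $ b * ?p a k))
       = (\<Sum>k\<in>UNIV. \<Sum>b\<in>UNIV. ?G a b * (g x $ k $ b * ?p a k))" by (rule sum.swap)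
    also have "\<dots> = (\<Sum>k\<in>UNIV. ?p a k * (\<Sum>b\<in>UNIV. ?G a b * g x $ b $ k))"
      by (simp add: sum_distrib_left mult_ac g_sym[OF x])
    also have "\<dots> = ?p a a" by (simp add: ginv_g x if_distrib cong: if_cong)
    finally show "(\<Sum>b\<in>UNIV. \<Sum>k\<in>UNIV. ?G a b * (g x $ k $ b * ?p a k)) = ?p a a" .
  qed
  also have "(\<Sum>a\<in>UNIV. \<Sum>b\<in>UNIV. \<Sum>k\<in>UNIV. ?G a b * (g x $ a $ k * ?p b k))
      = (\<Sum>b\<in>UNIV. \<Sum>a\<in>UNIV. \<Sum>k\<in>UNIV. ?G a b * (g x $ a $ k * ?p b k))"
    by (rule sum.swap)
  also have "\<dots> = (\<Sum>b\<in>UNIV. ?p b b)"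
  proof (rule sum.cong[OF refl])
    fix b
    have "(\<Sum>a\<in>UNIV. \<Sum>k\<in>UNIV. ?G a b * (g x $ a $ k * ?p b k))
       = (\<Sum>k\<in>UNIV. \<Sum>a\<in>UNIV. ?G a b * (g x $ a $ k * ?p b k))" by (rule sum.swap)
    also have "\<dots> = (\<Sum>k\<in>UNIV. ?p b k * (\<Sum>a\<in>UNIV. ?G b a * g x $ a $ k))"
      by (simp add: sum_distrib_left mult_ac ginv_sym[OF x, of b])
    also have "\<dots> = ?p b b" by (simp add: ginv_g x if_distrib cong: if_cong)
    finally show "(\<Sum>a\<in>UNIV. \<Sum>k\<in>UNIV. ?G a b * (g x $ a $ k * ?p b k)) = ?p b b" .
  qed
  finally show ?thesis by (simp add: divergence_def)
qed

text \<open>Taking the trace turns the metric into n and its Lie derivative into twice the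
  divergence. The dimension enters the later coefficients through this relation.\<close>

lemma conformal_divergence:
  assumes x: "x \<in> V" and "\<forall>i j. lie_metric g \<xi> i j x = m * g x $ i $ j"
  shows "divergence \<xi> x = real CARD('n) * m / 2"
proof -
  have "2 * divergence \<xi> x = (\<Sum>a\<in>UNIV. \<Sum>b\<in>UNIV. m * (ginv g a b x * g x $ a $ b))"
    unfolding trace_lie_metric[OF x, symmetric] using assms(2) by (simp add: mult_ac)
  also have "\<dots> = m * real CARD('n)"
    by (simp add: sum_distrib_left[symmetric] trace_ginv_g[OF x])
  finally show ?thesis by (simp add: field_simps)
qed

end

section \<open>Derivatives of the conformal equation; the Laplacian in divergence form\<close>

context chart_metric
begin

lemma pd_ginv_sym: "x \<in> V \<Longrightarrow> pd k (ginv g i j) x = pd k (ginv g j i) x"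
  by (rule pd_cong[OF open_V]) (simp_all add: ginv_sym)

text \<open>The left side is, up to sign, what \<xi> contributes to the coefficient of u_i in the
  prolonged equation. Differentiating the raised conformal equation and contracting gives the
  gradient of \<mu> with coefficient 1, differentiating the divergence relation gives it with - n/2;
  \<open>pd_W_commute\<close> makes the latter applicable to the derivative of \<open>W\<close>
  along \<xi>.\<close>

lemma conformal_christoffel_trace:
  assumes \<xi>: "smooth_on V \<xi>" and \<mu>: "smooth_on V \<mu>"
    and conf: "\<And>x. x \<in> V \<Longrightarrow> \<forall>i j. lie_metric g \<xi> i j x = \<mu> x * g x $ i $ j" and x: "x \<in> V"
  shows "(\<Sum>j\<in>UNIV. \<Sum>l\<in>UNIV. ginv g j l x * pd j (pd l (\<lambda>y. \<xi> y $ i)) x)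
      + (\<Sum>k\<in>UNIV. \<xi> x $ k * pd k (christoffel_trace g i) x)
      - (\<Sum>k\<in>UNIV. christoffel_trace g k x * pd k (\<lambda>y. \<xi> y $ i) x)
    = - \<mu> x * christoffel_trace g i x + (1 - real CARD('n) / 2) * (\<Sum>j\<in>UNIV. ginv g i j x * pd j \<mu> x)"
proof -
  let ?n = "real CARD('n)"
  let ?G = "\<lambda>i j. ginv g i j x" and ?D = "\<lambda>k i j. pd k (ginv g i j) x" and ?X = "\<lambda>k. \<xi> x $ k"
  let ?P = "\<lambda>l i. pd l (\<lambda>y. \<xi> y $ i) x" and ?PP = "\<lambda>j l i. pd j (pd l (\<lambda>y. \<xi> y $ i)) x"
  let ?W = "\<lambda>k. W k x" and ?M = "\<lambda>j. pd j \<mu> x"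
  have sx: "smooth_on V (\<lambda>y. \<xi> y $ k)" for k by (rule smooth_on_vec_nth[OF open_V \<xi>])
  note sm = open_V sx \<mu> smooth_pd smooth_ginv smooth_W
  note d = diff[OF x sx] diff[OF x \<mu>] diff[OF x smooth_ginv] diff[OF x smooth_W]
    diff[OF x smooth_pd[OF sx]] diff[OF x smooth_pd[OF smooth_ginv]]
  have PPs: "?PP j l i = ?PP l j i" for j l i by (rule pd_pd_commute[OF open_V sx x])
  have I: "(\<Sum>k\<in>UNIV. \<xi> y $ k * pd k (ginv g i j) y) = (\<Sum>k\<in>UNIV. ginv g i k y * pd k (\<lambda>y. \<xi> y $ j) y)
      + (\<Sum>k\<in>UNIV. ginv g j k y * pd k (\<lambda>y. \<xi> y $ i) y) - \<mu> y * ginv g i j y" if "y \<in> V" for y i j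
  proof -
    have "raised_lie \<xi> i j y = \<mu> y * ginv g i j y"
      using conformal_iff_raised[OF that] conf[OF that] by blast
    then show ?thesis by (simp add: raised_lie_def)
  qed
  have III: "(\<Sum>k\<in>UNIV. \<xi> y $ k * W k y) + (\<Sum>k\<in>UNIV. pd k (\<lambda>y. \<xi> y $ k) y) = ?n / 2 * \<mu> y" if "y \<in> V" for y
    using conformal_divergence[OF that conf[OF that]] by (simp add: divergence_def)
  \<comment> \<open>The raised equation for the pair i, j, differentiated in x^j itself, ready for
    contraction over j.\<close>
  have A: "(\<Sum>k\<in>UNIV. ?P j k * ?D k i j) + (\<Sum>k\<in>UNIV. ?X k * pd j (pd k (ginv g i j)) x)
      = (\<Sum>k\<in>UNIV. ?D j i k * ?P k j) + (\<Sum>k\<in>UNIV. ?G i k * ?PP j k j)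
      + (\<Sum>k\<in>UNIV. ?D j j k * ?P k i) + (\<Sum>k\<in>UNIV. ?G j k * ?PP j k i) - ?M j * ?G i j - \<mu> x * ?D j i j" for j
  proof -
    have "pd j (\<lambda>y. \<Sum>k\<in>UNIV. \<xi> y $ k * pd k (ginv g i j) y) x
       = pd j (\<lambda>y. (\<Sum>k\<in>UNIV. ginv g i k y * pd k (\<lambda>y. \<xi> y $ j) y)
        + (\<Sum>k\<in>UNIV. ginv g j k y * pd k (\<lambda>y. \<xi> y $ i) y) - \<mu> y * ginv g i j y) x"
      by (rule pd_cong[OF open_V x]) (rule I)
    moreover have "pd j (\<lambda>y. \<Sum>k\<in>UNIV. \<xi> y $ k * pd k (ginv g i j) y) x
       = (\<Sum>k\<in>UNIV. ?P j k * ?D k i j) + (\<Sum>k\<in>UNIV. ?X k * pd j (pd k (ginv g i j)) x)"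
      using d by (simp add: pd_sum pd_mult sum.distrib)
    moreover have "pd j (\<lambda>y. (\<Sum>k\<in>UNIV. ginv g i k y * pd k (\<lambda>y. \<xi> y $ j) y)
        + (\<Sum>k\<in>UNIV. ginv g j k y * pd k (\<lambda>y. \<xi> y $ i) y) - \<mu> y * ginv g i j y) x
      = (\<Sum>k\<in>UNIV. ?D j i k * ?P k j) + (\<Sum>k\<in>UNIV. ?G i k * ?PP j k j)
      + ((\<Sum>k\<in>UNIV. ?D j j k * ?P k i) + (\<Sum>k\<in>UNIV. ?G j k * ?PP j k i)) - (?M j * ?G i j + \<mu> x * ?D j i j)"
      using d by (simp add: pd_diff pd_add pd_sum pd_mult sum.distrib)
    ultimately show ?thesis by simp
  qed
  \<comment> \<open>The divergence relation differentiated in x^j, solved for the derivatives of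
    \<open>W\<close>.\<close>
  have B: "(\<Sum>k\<in>UNIV. ?X k * pd j (W k) x) = ?n / 2 * ?M j - (\<Sum>k\<in>UNIV. ?P j k * ?W k) - (\<Sum>k\<in>UNIV. ?PP j k k)" for j
  proof -
    have "pd j (\<lambda>y. (\<Sum>k\<in>UNIV. \<xi> y $ k * W k y) + (\<Sum>k\<in>UNIV. pd k (\<lambda>y. \<xi> y $ k) y)) x = pd j (\<lambda>y. ?n / 2 * \<mu> y) x"
      by (rule pd_cong[OF open_V x]) (rule III)
    moreover have "pd j (\<lambda>y. ?n / 2 * \<mu> y) x = ?n / 2 * ?M j"
      by (rule pd_cmult) (rule d)
    moreover have "pd j (\<lambda>y. (\<Sum>k\<in>UNIV. \<xi> y $ k * W k y) + (\<Sum>k\<in>UNIV. pd k (\<lambda>y. \<xi> y $ k) y)) x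
      = (\<Sum>k\<in>UNIV. ?P j k * ?W k) + (\<Sum>k\<in>UNIV. ?X k * pd j (W k) x) + (\<Sum>k\<in>UNIV. ?PP j k k)"
      using d by (simp add: pd_add pd_sum pd_mult sum.distrib)
    ultimately show ?thesis by simp
  qed
  have X\<Gamma>: "pd k (christoffel_trace g i) x = - (\<Sum>j\<in>UNIV. pd k (pd j (ginv g i j)) x)
      - (\<Sum>j\<in>UNIV. ?D k i j * ?W j) - (\<Sum>j\<in>UNIV. ?G i j * pd k (W j) x)" for k
  proof -
    have "pd k (christoffel_trace g i) x
      = pd k (\<lambda>x. - (\<Sum>j\<in>UNIV. pd j (ginv g i j) x) - (\<Sum>j\<in>UNIV. ginv g i j x * W j x)) x"
      by (rule pd_cong[OF open_V x]) (rule christoffel_trace_eq)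
    then show ?thesis using d by (simp add: pd_diff pd_uminus pd_sum pd_mult sum.distrib)
  qed
  \<comment> \<open>Names for the complete contractions. \<open>S3\<close> and \<open>U1\<close>
    come from both differentiated relations and cancel, which removes all second derivatives of
    \<xi> except those in \<open>S1\<close>.\<close>
  define S1 where "S1 = (\<Sum>j\<in>UNIV. \<Sum>k\<in>UNIV. ?G j k * ?PP j k i)"
  define S2 where "S2 = (\<Sum>j\<in>UNIV. \<Sum>k\<in>UNIV. ?X k * pd j (pd k (ginv g i j)) x)"
  define S3 where "S3 = (\<Sum>j\<in>UNIV. \<Sum>k\<in>UNIV. ?G i k * ?PP j k j)"
  define S4 where "S4 = (\<Sum>j\<in>UNIV. \<Sum>k\<in>UNIV. ?D j j k * ?P k i)"
  define Sm where "Sm = (\<Sum>j\<in>UNIV. ?M j * ?G i j)"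
  define Sd where "Sd = (\<Sum>j\<in>UNIV. ?D j i j)"
  define U1 where "U1 = (\<Sum>j\<in>UNIV. \<Sum>k\<in>UNIV. ?G i k * ?P k j * ?W j)"
  define U2 where "U2 = (\<Sum>j\<in>UNIV. \<Sum>k\<in>UNIV. ?G j k * ?P k i * ?W j)"
  define U3 where "U3 = (\<Sum>j\<in>UNIV. ?G i j * ?W j)"
  have A': "S2 = S3 + S4 + S1 - Sm - \<mu> x * Sd"
  proof -
    have "(\<Sum>j\<in>UNIV. \<Sum>k\<in>UNIV. ?P j k * ?D k i j) = (\<Sum>j\<in>UNIV. \<Sum>k\<in>UNIV. ?D j i k * ?P k j)"
      by (subst sum.swap) (simp add: mult.commute)
    moreover have "(\<Sum>j\<in>UNIV. \<Sum>k\<in>UNIV. ?P j k * ?D k i j) + S2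
        = (\<Sum>j\<in>UNIV. \<Sum>k\<in>UNIV. ?D j i k * ?P k j) + S3 + S4 + S1 - Sm - \<mu> x * Sd"
      unfolding S1_def S2_def S3_def S4_def Sm_def Sd_def sum.distrib[symmetric] sum_distrib_left[of "\<mu> x"] sum_subtractf[symmetric]
      by (rule sum.cong[OF refl]) (simp add: A sum.distrib)
    ultimately show ?thesis by simp
  qed
  have T1: "(\<Sum>k\<in>UNIV. \<Sum>j\<in>UNIV. ?X k * (?D k i j * ?W j)) = U1 + U2 - \<mu> x * U3"
  proof -
    have "(\<Sum>k\<in>UNIV. \<Sum>j\<in>UNIV. ?X k * (?D k i j * ?W j)) = (\<Sum>j\<in>UNIV. (\<Sum>k\<in>UNIV. ?X k * ?D k i j) * ?W j)"
      by (subst sum.swap) (simp add: sum_distrib_right mult.assoc)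
    then show ?thesis
      unfolding I[OF x] U1_def U2_def U3_def sum.distrib[symmetric] sum_distrib_left[of "\<mu> x"] sum_subtractf[symmetric]
      by (simp add: algebra_simps sum_distrib_right sum_distrib_left sum.distrib sum_subtractf)
  qed
  have T2: "(\<Sum>k\<in>UNIV. \<Sum>j\<in>UNIV. ?X k * (?G i j * pd k (W j) x)) = ?n / 2 * Sm - U1 - S3"
  proof -
    have "(\<Sum>k\<in>UNIV. \<Sum>j\<in>UNIV. ?X k * (?G i j * pd k (W j) x)) = (\<Sum>j\<in>UNIV. ?G i j * (\<Sum>k\<in>UNIV. ?X k * pd j (W k) x))"
      by (subst sum.swap) (simp add: sum_distrib_left mult_ac pd_W_commute[OF x])
    also have "\<dots> = ?n / 2 * Sm - (\<Sum>j\<in>UNIV. \<Sum>k\<in>UNIV. ?G i j * ?P j k * ?W k) - (\<Sum>j\<in>UNIV. \<Sum>k\<in>UNIV. ?G i j * ?PP j k k)"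
      unfolding B Sm_def by (simp add: algebra_simps sum_distrib_left sum.distrib sum_subtractf)
    also have "(\<Sum>j\<in>UNIV. \<Sum>k\<in>UNIV. ?G i j * ?P j k * ?W k) = U1"
      unfolding U1_def by (rule sum.swap)
    also have "(\<Sum>j\<in>UNIV. \<Sum>k\<in>UNIV. ?G i j * ?PP j k k) = S3"
      unfolding S3_def by (subst sum.swap) (intro sum.cong refl, simp only: PPs)
    finally show ?thesis .
  qed
  have "(\<Sum>k\<in>UNIV. ?X k * pd k (christoffel_trace g i) x) = - (\<Sum>k\<in>UNIV. \<Sum>j\<in>UNIV. ?X k * pd k (pd j (ginv g i j)) x)
      - (\<Sum>k\<in>UNIV. \<Sum>j\<in>UNIV. ?X k * (?D k i j * ?W j)) - (\<Sum>k\<in>UNIV. \<Sum>j\<in>UNIV. ?X k * (?G i j * pd k (W j) x))"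
    unfolding X\<Gamma> by (simp add: right_diff_distrib sum_distrib_left sum_subtractf sum_negf)
  also have "(\<Sum>k\<in>UNIV. \<Sum>j\<in>UNIV. ?X k * pd k (pd j (ginv g i j)) x) = S2"
    unfolding S2_def by (subst sum.swap) (simp add: pd_pd_commute[OF open_V smooth_ginv x])
  finally have X: "(\<Sum>k\<in>UNIV. ?X k * pd k (christoffel_trace g i) x) = - S2 - (U1 + U2 - \<mu> x * U3) - (?n / 2 * Sm - U1 - S3)"
    unfolding T1 T2 .
  have \<Gamma>: "(\<Sum>k\<in>UNIV. christoffel_trace g k x * ?P k i) = - S4 - U2"
  proof -
    have "(\<Sum>k\<in>UNIV. christoffel_trace g k x * ?P k i)
      = (\<Sum>k\<in>UNIV. - (\<Sum>j\<in>UNIV. ?D j k j * ?P k i) - (\<Sum>j\<in>UNIV. ?G k j * ?P k i * ?W j))"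
      unfolding christoffel_trace_eq[OF x]
      by (rule sum.cong[OF refl]) (simp add: algebra_simps sum_distrib_left)
    also have "\<dots> = - (\<Sum>k\<in>UNIV. \<Sum>j\<in>UNIV. ?D j k j * ?P k i) - (\<Sum>k\<in>UNIV. \<Sum>j\<in>UNIV. ?G k j * ?P k i * ?W j)"
      by (simp add: sum_subtractf sum_negf)
    also have "(\<Sum>k\<in>UNIV. \<Sum>j\<in>UNIV. ?D j k j * ?P k i) = S4"
      unfolding S4_def by (subst sum.swap) (simp add: pd_ginv_sym[OF x, of _ _ ])
    also have "(\<Sum>k\<in>UNIV. \<Sum>j\<in>UNIV. ?G k j * ?P k i * ?W j) = U2"
      unfolding U2_def by (subst sum.swap) (simp add: ginv_sym[OF x])
    finally show ?thesis .
  qed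
  have ct: "christoffel_trace g i x = - Sd - U3"
    by (simp add: christoffel_trace_eq[OF x] Sd_def U3_def)
  have M: "(\<Sum>j\<in>UNIV. ?G i j * ?M j) = Sm" by (simp add: Sm_def mult.commute)
  show ?thesis
    unfolding X \<Gamma> M ct S1_def[symmetric] A' by (simp add: algebra_simps)
qed

text \<open>\<open>laplace_beltrami\<close> takes families indexed by charts; inside one chart
  constant families are used, and c is arbitrary.\<close>

lemma laplace_beltrami_eq:
  "laplace_beltrami (\<lambda>_. g) (\<lambda>_. h) c x
    = (\<Sum>i\<in>UNIV. \<Sum>j\<in>UNIV. ginv g i j x * pd i (pd j h) x) - (\<Sum>k\<in>UNIV. christoffel_trace g k x * pd k h x)"
proof -
  have "(\<Sum>i\<in>UNIV. \<Sum>j\<in>UNIV. \<Sum>k\<in>UNIV. ginv g i j x * (christoffel g k i j x * pd k h x))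
      = (\<Sum>i\<in>UNIV. \<Sum>k\<in>UNIV. \<Sum>j\<in>UNIV. ginv g i j x * (christoffel g k i j x * pd k h x))"
    by (rule sum.cong[OF refl], rule sum.swap)
  also have "\<dots> = (\<Sum>k\<in>UNIV. \<Sum>i\<in>UNIV. \<Sum>j\<in>UNIV. ginv g i j x * (christoffel g k i j x * pd k h x))"
    by (rule sum.swap)
  also have "\<dots> = (\<Sum>k\<in>UNIV. christoffel_trace g k x * pd k h x)"
    by (simp add: christoffel_trace_def sum_distrib_right mult.assoc)
  finally show ?thesis
    by (simp add: laplace_beltrami_def hessian_def right_diff_distrib sum_subtractf sum_distrib_left)
qed

text \<open>The trace of the Christoffel symbols is itself a divergence of the weighted inverse
  metric. The formula turns the gradient terms of the tuple \<open>\<phi>\<close> into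
  Laplacians.\<close>

lemma divergence_gradient:
  assumes h: "smooth_on V h" and x: "x \<in> V"
  shows "(\<Sum>i\<in>UNIV. pd i (\<lambda>y. vol y * (\<Sum>j\<in>UNIV. ginv g i j y * pd j h y)) x) = vol x * laplace_beltrami (\<lambda>_. g) (\<lambda>_. h) c x"
proof -
  note d = diff[OF x smooth_vol] diff[OF x smooth_ginv] diff[OF x smooth_pd[OF h]]
  have "pd i (\<lambda>y. vol y * (\<Sum>j\<in>UNIV. ginv g i j y * pd j h y)) x
    = vol x * ((\<Sum>j\<in>UNIV. W i x * (ginv g i j x * pd j h x)) + (\<Sum>j\<in>UNIV. pd i (ginv g i j) x * pd j h x)
      + (\<Sum>j\<in>UNIV. ginv g i j x * pd i (pd j h) x))" for i
    using d by (simp add: pd_mult pd_sum pd_vol[OF x] sum.distrib sum_distrib_left algebra_simps)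
  then have "(\<Sum>i\<in>UNIV. pd i (\<lambda>y. vol y * (\<Sum>j\<in>UNIV. ginv g i j y * pd j h y)) x)
    = vol x * ((\<Sum>i\<in>UNIV. \<Sum>j\<in>UNIV. W i x * (ginv g i j x * pd j h x)) + (\<Sum>i\<in>UNIV. \<Sum>j\<in>UNIV. pd i (ginv g i j) x * pd j h x)
      + (\<Sum>i\<in>UNIV. \<Sum>j\<in>UNIV. ginv g i j x * pd i (pd j h) x))"
    by (simp add: sum_distrib_left[symmetric] sum.distrib)
  also have "(\<Sum>i\<in>UNIV. \<Sum>j\<in>UNIV. W i x * (ginv g i j x * pd j h x)) = (\<Sum>k\<in>UNIV. (\<Sum>j\<in>UNIV. ginv g k j x * W j x) * pd k h x)"
    by (subst sum.swap) (simp add: sum_distrib_left sum_distrib_right mult_ac ginv_sym[OF x])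
  also have "(\<Sum>i\<in>UNIV. \<Sum>j\<in>UNIV. pd i (ginv g i j) x * pd j h x) = (\<Sum>k\<in>UNIV. (\<Sum>j\<in>UNIV. pd j (ginv g k j) x) * pd k h x)"
    by (subst sum.swap) (simp add: sum_distrib_right pd_ginv_sym[OF x])
  finally show ?thesis
    by (simp add: laplace_beltrami_eq christoffel_trace_eq[OF x] left_diff_distrib sum_subtractf sum_negf algebra_simps)
qed

lemma divergence_vol:
  assumes \<xi>: "smooth_on V \<xi>" and x: "x \<in> V"
  shows "(\<Sum>i\<in>UNIV. pd i (\<lambda>y. vol y * \<xi> y $ i) x) = vol x * divergence \<xi> x"
  using diff[OF x smooth_vol] diff[OF x smooth_on_vec_nth[OF open_V \<xi>]]
  by (simp add: pd_mult pd_vol[OF x] divergence_def sum.distrib sum_distrib_left algebra_simps)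

end

section \<open>Prolongation and the variation of the Lagrangian\<close>

text \<open>A function of x and u has order zero, so only the multiset \<open>{#}\<close>
  contributes.\<close>

lemma total_deriv_xu:
  "total_deriv i (\<lambda>x j. h x (j {#})) x j = pd i (\<lambda>y. h y (j {#})) x + j {#i#} * deriv (h x) (j {#})"
proof -
  have "order_le 0 UNIV (\<lambda>x j. h x (j {#}))" by (simp add: order_le_def)
  from total_deriv_sum[OF this UNIV_I, of i x j] show ?thesis
    by (simp add: pd_x_def pd_u_def)
qed

lemma total_deriv_xi_fun:
  "total_deriv i (xi_fun \<xi> k) x j = pd i (\<lambda>y. \<xi> y (j {#}) $ k) x + j {#i#} * deriv (\<lambda>t. \<xi> x t $ k) (j {#})"
  using total_deriv_xu[of i "\<lambda>y t. \<xi> y t $ k" x j] by (simp add: xi_fun_def[abs_def])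

lemma total_deriv_eta_fun:
  "total_deriv i (eta_fun \<eta>) x j = pd i (\<lambda>y. \<eta> y (j {#})) x + j {#i#} * deriv (\<eta> x) (j {#})"
  using total_deriv_xu[of i \<eta> x j] by (simp add: eta_fun_def[abs_def])

lemma eta1_eq:
  "eta1 \<xi> \<eta> i x j = pd i (\<lambda>y. \<eta> y (j {#})) x + j {#i#} * deriv (\<eta> x) (j {#})
    - (\<Sum>k\<in>UNIV. j {#k#} * (pd i (\<lambda>y. \<xi> y (j {#}) $ k) x + j {#i#} * deriv (\<lambda>t. \<xi> x t $ k) (j {#})))"
  unfolding eta1_def total_deriv_xi_fun total_deriv_eta_fun ..

lemma pd_cdivide: "f differentiable (at x) \<Longrightarrow> pd i (\<lambda>y. f y / c) x = pd i f x / c"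
  using pd_cmult[of f x i "1 / c"] by simp

lemma DERIV_jet_coordinate:
  "((\<lambda>t. (j(I := t)) K) has_real_derivative (if K = I then 1 else 0)) (at (j I))"
  by auto

text \<open>Values at four points determine a cubic. It serves to compare coefficients in a scaling
  parameter t.\<close>

lemma cubic_zero:
  fixes a b c d :: real
  assumes "\<And>t. a * t ^ 3 + b * t ^ 2 + c * t + d = 0"
  shows "a = 0" "b = 0" "c = 0" "d = 0"
  using assms[of 0] assms[of 1] assms[of "-1"] assms[of 2] by simp_all

text \<open>The sum stands for extracting the element of a singleton multiset; coordinates of higher
  order become zero.\<close>

definition jet1 :: "real \<Rightarrow> ('n::finite \<Rightarrow> real) \<Rightarrow> 'n jet" where
  "jet1 u p I = (if I = {#} then u else (\<Sum>i\<in>UNIV. if I = {#i#} then p i else 0))"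

lemma jet1_simps [simp]: "jet1 u p {#} = u" "jet1 u p {#i#} = p i"
  by (simp_all add: jet1_def)

section \<open>The variation of the Lagrangian in a chart\<close>

context chart_metric
begin

definition qform :: "real^'n \<Rightarrow> ('n \<Rightarrow> real) \<Rightarrow> real" where
  "qform x p = (\<Sum>i\<in>UNIV. \<Sum>l\<in>UNIV. ginv g i l x * p i * p l)"

lemma lagrangian_eq:
  "lagrangian g F x j = vol x * (1/2 * qform x (\<lambda>i. j {#i#})) - vol x * F (j {#})"
  by (simp add: lagrangian_def vol_def qform_def)

lemma pd_x_lagrangian:
  assumes x: "x \<in> V"
  shows "pd_x k (lagrangian g F) x j = vol x * W k x * (1/2 * qform x (\<lambda>i. j {#i#}) - F (j {#}))
    + vol x * (1/2 * (\<Sum>i\<in>UNIV. \<Sum>l\<in>UNIV. pd k (ginv g i l) x * j {#i#} * j {#l#}))"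
proof -
  note d = diff[OF x smooth_vol] diff[OF x smooth_ginv]
  have "pd_x k (lagrangian g F) x j
    = pd k (\<lambda>y. vol y * (1/2 * (\<Sum>i\<in>UNIV. \<Sum>l\<in>UNIV. ginv g i l y * j {#i#} * j {#l#})) - vol y * F (j {#})) x"
    by (simp add: pd_x_def lagrangian_eq qform_def)
  also have "\<dots> = vol x * W k x * (1/2 * (\<Sum>i\<in>UNIV. \<Sum>l\<in>UNIV. ginv g i l x * j {#i#} * j {#l#}))
    + vol x * (1/2 * (\<Sum>i\<in>UNIV. \<Sum>l\<in>UNIV. pd k (ginv g i l) x * j {#i#} * j {#l#})) - vol x * W k x * F (j {#})"
    using d by (simp add: pd_diff pd_mult pd_sum pd_cdivide pd_vol[OF x])
  finally show ?thesis by (simp add: qform_def algebra_simps)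
qed

lemma pd_u_lagrangian_0:
  assumes "(F has_real_derivative f (j {#})) (at (j {#}))"
  shows "pd_u {#} (lagrangian g F) x j = - vol x * f (j {#})"
proof -
  have "((\<lambda>t. vol x * (1/2 * qform x (\<lambda>i. j {#i#})) - vol x * F t) has_real_derivative 0 - vol x * f (j {#})) (at (j {#}))"
    by (intro DERIV_diff DERIV_const DERIV_cmult assms)
  then show ?thesis unfolding pd_u_def lagrangian_eq
    by (intro DERIV_imp_deriv) simp
qed

lemma DERIV_qform:
  assumes x: "x \<in> V"
  shows "((\<lambda>t. qform x (\<lambda>a. (j({#i#} := t)) {#a#})) has_real_derivative 2 * (\<Sum>l\<in>UNIV. ginv g i l x * j {#l#})) (at (j {#i#}))"
proof -
  let ?\<delta> = "\<lambda>a. if {#a#} = {#i#} then 1 else (0::real)"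
  have "((\<lambda>t. ginv g a l x * (j({#i#} := t)) {#a#} * (j({#i#} := t)) {#l#}) has_real_derivative
      ginv g a l x * ?\<delta> a * (j({#i#} := j {#i#})) {#l#} + ?\<delta> l * (ginv g a l x * (j({#i#} := j {#i#})) {#a#})) (at (j {#i#}))" for a l
    by (rule DERIV_mult) (rule DERIV_cmult DERIV_jet_coordinate)+
  then have "((\<lambda>t. qform x (\<lambda>a. (j({#i#} := t)) {#a#})) has_real_derivative (\<Sum>a\<in>UNIV. \<Sum>l\<in>UNIV.
      ginv g a l x * ?\<delta> a * j {#l#} + ?\<delta> l * (ginv g a l x * j {#a#}))) (at (j {#i#}))"
    unfolding qform_def fun_upd_triv by (intro DERIV_sum)
  moreover have "(\<Sum>a\<in>UNIV. \<Sum>l\<in>UNIV. ginv g a l x * ?\<delta> a * j {#l#} + ?\<delta> l * (ginv g a l x * j {#a#}))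
      = (\<Sum>a\<in>UNIV. ?\<delta> a * (\<Sum>l\<in>UNIV. ginv g a l x * j {#l#})) + (\<Sum>a\<in>UNIV. ginv g a i x * j {#a#})"
    by (simp add: sum.distrib sum_distrib_left mult_ac if_distrib[of "\<lambda>u. _ * u"] cong: if_cong)
  moreover have "(\<Sum>a\<in>UNIV. ?\<delta> a * (\<Sum>l\<in>UNIV. ginv g a l x * j {#l#})) = (\<Sum>l\<in>UNIV. ginv g i l x * j {#l#})"
    by (simp add: if_distrib[of "\<lambda>u. u * _"] cong: if_cong)
  moreover have "(\<Sum>a\<in>UNIV. ginv g a i x * j {#a#}) = (\<Sum>l\<in>UNIV. ginv g i l x * j {#l#})"
    by (simp add: ginv_sym[OF x])
  ultimately show ?thesis by simp
qed

lemma pd_u_lagrangian_1: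
  assumes x: "x \<in> V"
  shows "pd_u {#i#} (lagrangian g F) x j = vol x * (\<Sum>l\<in>UNIV. ginv g i l x * j {#l#})"
proof -
  have "((\<lambda>t. vol x * (1/2 * qform x (\<lambda>a. (j({#i#} := t)) {#a#})) - vol x * F (j {#})) has_real_derivative
      vol x * (1/2 * (2 * (\<Sum>l\<in>UNIV. ginv g i l x * j {#l#}))) - 0) (at (j {#i#}))"
    by (intro DERIV_diff DERIV_const DERIV_cmult DERIV_qform x)
  then show ?thesis unfolding pd_u_def lagrangian_eq
    by (intro DERIV_imp_deriv) simp
qed

text \<open>The cubic term has coefficient -1/2 because the prolongation contributes -1 and the
  product of the Lagrangian with D_i \<xi>^i contributes 1/2. The derivatives of the inverse metric
  combine with those of \<xi> into \<open>raised_lie\<close>.\<close>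

lemma lagrangian_variation_eq:
  assumes x: "x \<in> V" and F: "(F has_real_derivative f (j {#})) (at (j {#}))"
  shows "lagrangian_variation g F \<xi> \<eta> x j = vol x *
    (qform x (\<lambda>i. j {#i#}) * (1/2 * divergence (\<lambda>y. \<xi> y (j {#})) x + deriv (\<eta> x) (j {#})
        - 1/2 * (\<Sum>k\<in>UNIV. j {#k#} * deriv (\<lambda>t. \<xi> x t $ k) (j {#})))
     - 1/2 * (\<Sum>i\<in>UNIV. \<Sum>l\<in>UNIV. raised_lie (\<lambda>y. \<xi> y (j {#})) i l x * j {#i#} * j {#l#})
     + (\<Sum>i\<in>UNIV. \<Sum>l\<in>UNIV. ginv g i l x * j {#l#} * pd i (\<lambda>y. \<eta> y (j {#})) x)
     - F (j {#}) * (divergence (\<lambda>y. \<xi> y (j {#})) x + (\<Sum>k\<in>UNIV. j {#k#} * deriv (\<lambda>t. \<xi> x t $ k) (j {#})))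
     - f (j {#}) * \<eta> x (j {#}))"
proof -
  define u where "u = j {#}"
  define p where "p i = j {#i#}" for i
  define \<sigma> where "\<sigma> k = deriv (\<lambda>t. \<xi> x t $ k) u" for k
  define P where "P i k = pd i (\<lambda>y. \<xi> y u $ k) x" for i k
  define D where "D k i l = pd k (ginv g i l) x" for k i l
  define G where "G i l = ginv g i l x" for i l
  define X where "X k = \<xi> x u $ k" for k
  define e where "e i = pd i (\<lambda>y. \<eta> y u) x" for i
  define eu where "eu = deriv (\<eta> x) u"
  define Q where "Q = (\<Sum>i\<in>UNIV. \<Sum>l\<in>UNIV. G i l * p i * p l)"
  define S where "S = (\<Sum>k\<in>UNIV. p k * \<sigma> k)"
  define dv where "dv = divergence (\<lambda>y. \<xi> y u) x"
  define R where "R = (\<Sum>i\<in>UNIV. \<Sum>l\<in>UNIV. raised_lie (\<lambda>y. \<xi> y u) i l x * p i * p l)"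
  have Gs: "G i l = G l i" for i l unfolding G_def by (rule ginv_sym[OF x])
  have Q': "qform x p = Q" by (simp add: qform_def Q_def G_def)
  have dv': "dv = (\<Sum>k\<in>UNIV. X k * W k x) + (\<Sum>k\<in>UNIV. P k k)"
    by (simp add: dv_def divergence_def X_def P_def)
  define N where "N = (\<Sum>i\<in>UNIV. \<Sum>l\<in>UNIV. \<Sum>k\<in>UNIV. G i l * p l * (p k * P i k))"
  define K where "K = (\<Sum>k\<in>UNIV. X k * (\<Sum>i\<in>UNIV. \<Sum>l\<in>UNIV. D k i l * p i * p l))"
  \<comment> \<open>By symmetry the two terms of \<open>raised_lie\<close> with derivatives of \<xi>
    contribute equally, whence the factor 2.\<close>
  have R': "R = 2 * N - K"
  proof -
    have "R = - (\<Sum>i\<in>UNIV. \<Sum>l\<in>UNIV. \<Sum>k\<in>UNIV. X k * D k i l * p i * p l)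
        + (\<Sum>i\<in>UNIV. \<Sum>l\<in>UNIV. \<Sum>k\<in>UNIV. G i k * P k l * p i * p l)
        + (\<Sum>i\<in>UNIV. \<Sum>l\<in>UNIV. \<Sum>k\<in>UNIV. G l k * P k i * p i * p l)"
      unfolding R_def raised_lie_def X_def[symmetric] D_def[symmetric] G_def[symmetric] P_def[symmetric]
      by (simp add: algebra_simps sum_distrib_left sum.distrib sum_negf sum_subtractf)
    also have "(\<Sum>i\<in>UNIV. \<Sum>l\<in>UNIV. \<Sum>k\<in>UNIV. X k * D k i l * p i * p l) = K"
    proof -
      have "(\<Sum>i\<in>UNIV. \<Sum>l\<in>UNIV. \<Sum>k\<in>UNIV. X k * D k i l * p i * p l) = (\<Sum>i\<in>UNIV. \<Sum>k\<in>UNIV. \<Sum>l\<in>UNIV. X k * D k i l * p i * p l)"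
        by (rule sum.cong[OF refl], rule sum.swap)
      also have "\<dots> = (\<Sum>k\<in>UNIV. \<Sum>i\<in>UNIV. \<Sum>l\<in>UNIV. X k * D k i l * p i * p l)" by (rule sum.swap)
      finally show ?thesis by (simp add: K_def sum_distrib_left mult.assoc)
    qed
    also have "(\<Sum>i\<in>UNIV. \<Sum>l\<in>UNIV. \<Sum>k\<in>UNIV. G l k * P k i * p i * p l) = (\<Sum>i\<in>UNIV. \<Sum>l\<in>UNIV. \<Sum>k\<in>UNIV. G i k * P k l * p i * p l)"
      by (subst sum.swap) (simp add: mult_ac)
    also have "(\<Sum>i\<in>UNIV. \<Sum>l\<in>UNIV. \<Sum>k\<in>UNIV. G i k * P k l * p i * p l) = N"
    proof -
      have "(\<Sum>i\<in>UNIV. \<Sum>l\<in>UNIV. \<Sum>k\<in>UNIV. G i k * P k l * p i * p l) = (\<Sum>i\<in>UNIV. \<Sum>k\<in>UNIV. \<Sum>l\<in>UNIV. G i k * P k l * p i * p l)"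
        by (rule sum.cong[OF refl], rule sum.swap)
      also have "\<dots> = (\<Sum>k\<in>UNIV. \<Sum>i\<in>UNIV. \<Sum>l\<in>UNIV. G i k * P k l * p i * p l)" by (rule sum.swap)
      finally show ?thesis by (simp add: N_def Gs mult_ac)
    qed
    finally show ?thesis by simp
  qed
  have "lagrangian_variation g F \<xi> \<eta> x j
     = (\<Sum>k\<in>UNIV. X k * (vol x * W k x * (1/2 * Q - F u) + vol x * (1/2 * (\<Sum>i\<in>UNIV. \<Sum>l\<in>UNIV. D k i l * p i * p l))))
     + \<eta> x u * (- vol x * f u)
     + (\<Sum>i\<in>UNIV. (e i + p i * eu - (\<Sum>k\<in>UNIV. p k * (P i k + p i * \<sigma> k))) * (vol x * (\<Sum>l\<in>UNIV. G i l * p l)))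
     + (vol x * (1/2 * Q) - vol x * F u) * (\<Sum>i\<in>UNIV. P i i + p i * \<sigma> i)"
    unfolding lagrangian_variation_def prolong1_def eta1_eq pd_x_lagrangian[OF x] pd_u_lagrangian_0[where f = f and F = F and j = j, OF F] pd_u_lagrangian_1[OF x]
      total_deriv_xi_fun xi_fun_def eta_fun_def lagrangian_eq
      p_def[symmetric] Q' u_def[symmetric] \<sigma>_def[symmetric] P_def[symmetric] D_def[symmetric] G_def[symmetric]
      X_def[symmetric] e_def[symmetric] eu_def[symmetric] ..
  also have "(\<Sum>k\<in>UNIV. X k * (vol x * W k x * (1/2 * Q - F u) + vol x * (1/2 * (\<Sum>i\<in>UNIV. \<Sum>l\<in>UNIV. D k i l * p i * p l))))
      = vol x * (1/2 * Q - F u) * (\<Sum>k\<in>UNIV. X k * W k x) + vol x * (1/2 * K)"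
    unfolding K_def sum_distrib_left sum.distrib[symmetric]
    by (rule sum.cong[OF refl]) (simp add: algebra_simps sum_distrib_left)
  also have "(\<Sum>i\<in>UNIV. P i i + p i * \<sigma> i) = (\<Sum>i\<in>UNIV. P i i) + S"
    by (simp add: sum.distrib S_def)
  also have "(\<Sum>i\<in>UNIV. (e i + p i * eu - (\<Sum>k\<in>UNIV. p k * (P i k + p i * \<sigma> k))) * (vol x * (\<Sum>l\<in>UNIV. G i l * p l)))
      = vol x * ((\<Sum>i\<in>UNIV. \<Sum>l\<in>UNIV. G i l * p l * e i) + eu * Q - N - S * Q)"
  proof -
    have "(\<Sum>k\<in>UNIV. p k * (P i k + p i * \<sigma> k)) = (\<Sum>k\<in>UNIV. p k * P i k) + p i * S" for i
      by (simp add: algebra_simps sum.distrib S_def sum_distrib_left)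
    then show ?thesis
      unfolding Q_def N_def
      by (simp add: algebra_simps sum.distrib sum_subtractf sum_distrib_left sum_distrib_right)
  qed
  finally have "lagrangian_variation g F \<xi> \<eta> x j = vol x * (Q * (1/2 * dv + eu - 1/2 * S) - 1/2 * R
     + (\<Sum>i\<in>UNIV. \<Sum>l\<in>UNIV. G i l * p l * e i) - F u * (dv + S) - f u * \<eta> x u)"
    unfolding dv' R' by (simp add: algebra_simps add_divide_distrib)
  then show ?thesis
    unfolding R_def dv_def S_def G_def e_def eu_def Q'[symmetric] \<sigma>_def p_def u_def .
qed

lemma qform_scale: "qform x (\<lambda>i. t * p i) = t ^ 2 * qform x p"
  by (simp add: qform_def sum_distrib_left power2_eq_square mult_ac)

text \<open>Polarization with the unit vectors e_a, e_b and their sum.\<close>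

lemma quadratic_form_zero:
  fixes S :: "'n \<Rightarrow> 'n \<Rightarrow> real"
  assumes sym: "\<And>i l. S i l = S l i" and 0: "\<And>p. (\<Sum>i\<in>UNIV. \<Sum>l\<in>UNIV. S i l * p i * p l) = 0"
  shows "S a b = 0"
proof -
  let ?e = "\<lambda>a i. if i = a then 1 else (0::real)"
  have B: "(\<Sum>i\<in>UNIV. \<Sum>l\<in>UNIV. S i l * ?e a i * ?e b l) = S a b" for a b
    by (simp add: if_distrib[of "\<lambda>u. _ * u"] cong: if_cong)
  have "(\<Sum>i\<in>UNIV. \<Sum>l\<in>UNIV. S i l * (?e a i + ?e b i) * (?e a l + ?e b l))
     = (\<Sum>i\<in>UNIV. \<Sum>l\<in>UNIV. S i l * ?e a i * ?e a l) + (\<Sum>i\<in>UNIV. \<Sum>l\<in>UNIV. S i l * ?e a i * ?e b l)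
     + (\<Sum>i\<in>UNIV. \<Sum>l\<in>UNIV. S i l * ?e b i * ?e a l) + (\<Sum>i\<in>UNIV. \<Sum>l\<in>UNIV. S i l * ?e b i * ?e b l)"
    unfolding sum.distrib[symmetric] by (intro sum.cong refl) (simp only: algebra_simps)
  then have "S a a + S a b + S b a + S b b = 0" unfolding B 0 by simp
  moreover have "S a a = 0" "S b b = 0" using 0[of "?e a"] 0[of "?e b"] unfolding B by auto
  ultimately show ?thesis using sym[of a b] by simp
qed

lemma ginv_nonzero:
  assumes x: "x \<in> V" and "\<And>k l. c * ginv g k l x = 0"
  shows "c = 0"
proof -
  obtain a :: 'n where True by simp
  have "c = (\<Sum>b\<in>UNIV. c * ginv g a b x * g x $ b $ a)"
    using ginv_g[OF x, of a a] by (simp add: sum_distrib_left[symmetric] mult.assoc)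
  then show ?thesis by (simp only: assms(2)) simp
qed

text \<open>Even an indefinite form cannot vanish everywhere: by polarization all entries of the
  inverse metric would be zero.\<close>

lemma qform_nonzero:
  assumes x: "x \<in> V"
  obtains p where "qform x p \<noteq> 0"
proof (rule ccontr)
  assume a: "\<not> thesis"
  have "ginv g k l x = 0" for k l
    by (rule quadratic_form_zero[of "\<lambda>k l. ginv g k l x"])
      (use a that ginv_sym[OF x] in \<open>auto simp: qform_def[symmetric]\<close>)
  then show False using ginv_nonzero[OF x, of 1] by simp
qed

text \<open>Where the linear form is nonzero, the quadratic form vanishes; the coefficient of t
  along p + t q then puts p into the radical of the nondegenerate form. Hence p = 0, where the
  linear form vanishes after all.\<close>

lemma qform_mult_linear_zero:
  assumes x: "x \<in> V" and 0: "\<And>p. qform x p * (\<Sum>k\<in>UNIV. p k * s k) = 0"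
  shows "(\<Sum>k\<in>UNIV. p k * s k) = 0"
proof (rule ccontr)
  assume ne: "(\<Sum>k\<in>UNIV. p k * s k) \<noteq> 0"
  have "(\<Sum>i\<in>UNIV. p i * ginv g i m x) = 0" for m
  proof -
    define q where "q i = (if i = m then 1 else (0::real))" for i
    let ?B = "\<lambda>p q. \<Sum>i\<in>UNIV. \<Sum>l\<in>UNIV. ginv g i l x * p i * q l" and ?s = "\<lambda>p. \<Sum>k\<in>UNIV. p k * s k"
    have "?B q p = ?B p q"
      by (subst sum.swap) (simp add: ginv_sym[OF x] mult_ac)
    moreover have "qform x (\<lambda>i. p i + t * q i) = qform x p + t * ?B p q + t * ?B q p + t ^ 2 * qform x q" for t
      unfolding qform_def sum_distrib_left sum.distrib[symmetric]
      by (intro sum.cong refl) (simp add: algebra_simps power2_eq_square)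
    ultimately have exp: "qform x (\<lambda>i. p i + t * q i) = qform x p + 2 * t * ?B p q + t ^ 2 * qform x q" for t
      by simp
    have s: "?s (\<lambda>i. p i + t * q i) = ?s p + t * ?s q" for t
      by (simp add: algebra_simps sum.distrib sum_distrib_left)
    have "qform x p = 0" using 0[of p] ne by simp
    then have "(qform x q * ?s q) * t ^ 3 + (qform x q * ?s p + 2 * ?B p q * ?s q) * t ^ 2 + (2 * ?B p q * ?s p) * t + 0 = 0" for t
      using 0[of "\<lambda>i. p i + t * q i"] unfolding exp s by (simp add: algebra_simps power3_eq_cube power2_eq_square)
    from cubic_zero(3)[OF this] have "?B p q = 0" using ne by simp
    then have "(\<Sum>i\<in>UNIV. ginv g i m x * p i) = 0" by (simp add: q_def if_distrib[of "\<lambda>u. _ * u"] cong: if_cong)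
    then show ?thesis by (simp add: mult.commute)
  qed
  then have "(\<Sum>m\<in>UNIV. (\<Sum>i\<in>UNIV. p i * ginv g i m x) * g x $ m $ k) = 0" for k by simp
  moreover have "(\<Sum>m\<in>UNIV. (\<Sum>i\<in>UNIV. p i * ginv g i m x) * g x $ m $ k) = p k" for k
  proof -
    have "(\<Sum>m\<in>UNIV. (\<Sum>i\<in>UNIV. p i * ginv g i m x) * g x $ m $ k) = (\<Sum>i\<in>UNIV. p i * (\<Sum>m\<in>UNIV. ginv g i m x * g x $ m $ k))"
      by (simp add: sum_distrib_left sum_distrib_right mult.assoc) (rule sum.swap)
    then show ?thesis by (simp add: ginv_g[OF x] if_distrib cong: if_cong)
  qed
  ultimately have "p k = 0" for k by simp
  then show False using ne by simp
qed

lemma raised_lie_sym: "x \<in> V \<Longrightarrow> raised_lie \<xi> i j x = raised_lie \<xi> j i x"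
  by (simp add: raised_lie_def pd_ginv_sym[of x _ i j])

text \<open>Along the jets with u_i = t p_i the variation is a cubic in t, and each claim comes from
  one of its coefficients. Only jets over the single point (x, u) enter.\<close>

lemma lagrangian_variation_zero:
  assumes x: "x \<in> V" and F: "(F has_real_derivative f u) (at u)"
    and 0: "\<And>j. j {#} = u \<Longrightarrow> lagrangian_variation g F \<xi> \<eta> x j = 0"
  shows "deriv (\<lambda>t. \<xi> x t $ k) u = 0"
    and "\<forall>i j. lie_metric g (\<lambda>y. \<xi> y u) i j x = (divergence (\<lambda>y. \<xi> y u) x + 2 * deriv (\<eta> x) u) * g x $ i $ j"
    and "F u * divergence (\<lambda>y. \<xi> y u) x + f u * \<eta> x u = 0"
proof -
  let ?d = "divergence (\<lambda>y. \<xi> y u) x" and ?s = "\<lambda>k. deriv (\<lambda>t. \<xi> x t $ k) u"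
  let ?R = "\<lambda>p. \<Sum>i\<in>UNIV. \<Sum>l\<in>UNIV. raised_lie (\<lambda>y. \<xi> y u) i l x * p i * p l"
  let ?c = "\<lambda>p. \<Sum>k\<in>UNIV. p k * ?s k"
  let ?e = "\<lambda>p. \<Sum>i\<in>UNIV. \<Sum>l\<in>UNIV. ginv g i l x * p l * pd i (\<lambda>y. \<eta> y u) x"
  have *: "(- 1/2 * (qform x p * ?c p)) * t ^ 3 + (qform x p * (1/2 * ?d + deriv (\<eta> x) u) - 1/2 * ?R p) * t ^ 2
      + (?e p - F u * ?c p) * t + (- (F u * ?d + f u * \<eta> x u)) = 0" for p t
  proof -
    let ?j = "jet1 u (\<lambda>i. t * p i)"
    have "lagrangian_variation g F \<xi> \<eta> x ?j = 0" by (rule 0) simp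
    then have "qform x (\<lambda>i. t * p i) * (1/2 * ?d + deriv (\<eta> x) u - 1/2 * ?c (\<lambda>i. t * p i))
      - 1/2 * ?R (\<lambda>i. t * p i) + ?e (\<lambda>i. t * p i) - F u * (?d + ?c (\<lambda>i. t * p i)) - f u * \<eta> x u = 0"
      using lagrangian_variation_eq[OF x, of F f ?j \<xi> \<eta>] F vol_pos[OF x] by simp
    moreover have "?R (\<lambda>i. t * p i) = t ^ 2 * ?R p" "?c (\<lambda>i. t * p i) = t * ?c p" "?e (\<lambda>i. t * p i) = t * ?e p"
      by (simp_all add: sum_distrib_left power2_eq_square mult_ac)
    ultimately show ?thesis
      unfolding qform_scale by (simp add: algebra_simps power3_eq_cube power2_eq_square)
  qed
  have "qform x p * ?c p = 0" for p using cubic_zero(1)[OF *, of p] by simp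
  then have c: "?c p = 0" for p by (rule qform_mult_linear_zero[OF x])
  show "?s k = 0"
    using c[of "\<lambda>i. if i = k then 1 else 0"] by (simp add: if_distrib[of "\<lambda>u. u * _"] cong: if_cong)
  show "F u * ?d + f u * \<eta> x u = 0" using cubic_zero(4)[OF *] by simp
  have "?R p = (?d + 2 * deriv (\<eta> x) u) * qform x p" for p
    using cubic_zero(2)[OF *, of p] by (simp add: algebra_simps)
  then have "(\<Sum>i\<in>UNIV. \<Sum>l\<in>UNIV. (raised_lie (\<lambda>y. \<xi> y u) i l x - (?d + 2 * deriv (\<eta> x) u) * ginv g i l x) * p i * p l) = 0" for p
    by (simp add: qform_def left_diff_distrib sum_subtractf sum_distrib_left mult.assoc)
  then have "raised_lie (\<lambda>y. \<xi> y u) i l x - (?d + 2 * deriv (\<eta> x) u) * ginv g i l x = 0" for i l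
    by (rule quadratic_form_zero[rotated]) (simp add: raised_lie_sym[OF x, of _ i] raised_lie_sym[OF x, of _ _ i] ginv_sym[OF x] raised_lie_sym[OF x])
  then show "\<forall>i j. lie_metric g (\<lambda>y. \<xi> y u) i j x = (?d + 2 * deriv (\<eta> x) u) * g x $ i $ j"
    unfolding conformal_iff_raised[OF x] by simp
qed

text \<open>Here div \<xi>/2 - m/2 = (n - 2)/4 m, so the coefficient of the quadratic form vanishes
  exactly for a = (2 - n)/4 m.\<close>

lemma lagrangian_variation_conformal:
  assumes x: "x \<in> V" and F: "(F has_real_derivative f (j {#})) (at (j {#}))"
    and a: "smooth_on V a" and \<beta>: "smooth_on V \<beta>"
    and conf: "\<forall>i j. lie_metric g \<xi> i j x = m * g x $ i $ j"
  shows "lagrangian_variation g F (\<lambda>y _. \<xi> y) (\<lambda>y u. a y * u + \<beta> y) x j = vol x *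
    ((a x - (2 - real CARD('n)) / 4 * m) * qform x (\<lambda>i. j {#i#})
     + (\<Sum>i\<in>UNIV. \<Sum>l\<in>UNIV. ginv g i l x * j {#l#} * (pd i a x * j {#} + pd i \<beta> x))
     - F (j {#}) * (real CARD('n) * m / 2) - f (j {#}) * (a x * j {#} + \<beta> x))"
proof -
  have r: "raised_lie \<xi> i l x = m * ginv g i l x" for i l
    using conf conformal_iff_raised[OF x] by blast
  have "pd i (\<lambda>y. a y * j {#} + \<beta> y) x = pd i a x * j {#} + pd i \<beta> x" for i
    using diff[OF x a] diff[OF x \<beta>] by (simp add: pd_add pd_mult)
  moreover have "deriv (\<lambda>u. a x * u + \<beta> x) (j {#}) = a x"
    by (rule DERIV_imp_deriv) (auto intro!: derivative_eq_intros)
  moreover have "(\<Sum>i\<in>UNIV. \<Sum>l\<in>UNIV. raised_lie \<xi> i l x * j {#i#} * j {#l#}) = m * qform x (\<lambda>i. j {#i#})"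
    by (simp add: r qform_def sum_distrib_left mult.assoc)
  ultimately show ?thesis
    unfolding lagrangian_variation_eq[OF x, where f = f and F = F and j = j, OF F] conformal_divergence[OF x conf] by (simp add: field_simps)
qed

text \<open>\<open>C\<close> is the difference between the given primitive \<open>F\<close> and a
  convenient one. Being locally constant in u, it multiplies sqrt g div \<xi> in the variation,
  which the last term of the tuple accounts for. The assumption \<open>eq\<close> says that the rest
  of order zero vanishes.\<close>

lemma lagrangian_variation_divergence:
  assumes J: "open J" and x: "x \<in> V" and u: "j {#} \<in> J"
    and F: "(F has_real_derivative f (j {#})) (at (j {#}))"
    and C: "(C has_real_derivative 0) (at (j {#}))"
    and \<xi>: "smooth_on V \<xi>" and a: "smooth_on V a" and \<beta>: "smooth_on V \<beta>"
    and conf: "\<forall>i j. lie_metric g \<xi> i j x = m * g x $ i $ j"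
    and am: "a x = (2 - real CARD('n)) / 4 * m"
    and eq: "1/2 * (j {#})\<^sup>2 * laplace_beltrami (\<lambda>_. g) (\<lambda>_. a) c x + j {#} * laplace_beltrami (\<lambda>_. g) (\<lambda>_. \<beta>) c x
      + (a x * j {#} + \<beta> x) * f (j {#}) + real CARD('n) * m / 2 * (F (j {#}) - C (j {#})) = 0"
  shows "lagrangian_variation g F (\<lambda>y _. \<xi> y) (\<lambda>y u. a y * u + \<beta> y) x j = (\<Sum>i\<in>UNIV. total_deriv i
    (\<lambda>x j. vol x * (\<Sum>l\<in>UNIV. ginv g i l x * pd l a x) * (1/2 * (j {#})\<^sup>2)
      + vol x * (\<Sum>l\<in>UNIV. ginv g i l x * pd l \<beta> x) * j {#} - vol x * \<xi> x $ i * C (j {#})) x j)"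
proof -
  let ?u = "j {#}"
  let ?A = "\<lambda>i y. vol y * (\<Sum>l\<in>UNIV. ginv g i l y * pd l a y)" and ?B = "\<lambda>i y. vol y * (\<Sum>l\<in>UNIV. ginv g i l y * pd l \<beta> y)"
  let ?R = "\<lambda>i y. vol y * \<xi> y $ i"
  note sm = open_V smooth_vol smooth_ginv smooth_pd[OF a] smooth_pd[OF \<beta>] smooth_on_vec_nth[OF open_V \<xi>]
  have d: "?A i differentiable (at x)" "?B i differentiable (at x)" "?R i differentiable (at x)" for i
    by (intro diff[OF x] smooth_on_mult smooth_on_sum sm)+
  have T: "total_deriv i (\<lambda>x j. ?A i x * (1/2 * (j {#})\<^sup>2) + ?B i x * j {#} - ?R i x * C (j {#})) x j
      = pd i (?A i) x * (1/2 * ?u\<^sup>2) + pd i (?B i) x * ?u - pd i (?R i) x * C ?u + j {#i#} * (?A i x * ?u + ?B i x)" for i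
  proof -
    have "pd i (\<lambda>y. ?A i y * (1/2 * ?u\<^sup>2) + ?B i y * ?u - ?R i y * C ?u) x
        = pd i (?A i) x * (1/2 * ?u\<^sup>2) + pd i (?B i) x * ?u - pd i (?R i) x * C ?u"
    proof (rule pdI)
      show "((\<lambda>t. ?A i (x + t *\<^sub>R axis i 1) * (1/2 * ?u\<^sup>2) + ?B i (x + t *\<^sub>R axis i 1) * ?u - ?R i (x + t *\<^sub>R axis i 1) * C ?u)
        has_real_derivative pd i (?A i) x * (1/2 * ?u\<^sup>2) + pd i (?B i) x * ?u - pd i (?R i) x * C ?u) (at 0)"
        by (intro DERIV_add DERIV_diff DERIV_cmult_right pd_has_deriv[of "?A i"] pd_has_deriv[of "?B i"] pd_has_deriv[of "?R i"] d)
    qed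
    moreover have "deriv (\<lambda>t. ?A i x * (1/2 * t\<^sup>2) + ?B i x * t - ?R i x * C t) ?u = ?A i x * ?u + ?B i x"
      by (rule DERIV_imp_deriv) (use C in \<open>auto intro!: derivative_eq_intros\<close>)
    ultimately show ?thesis
      using total_deriv_xu[of i "\<lambda>x t. ?A i x * (1/2 * t\<^sup>2) + ?B i x * t - ?R i x * C t" x j] by simp
  qed
  have "(\<Sum>i\<in>UNIV. pd i (?A i) x * (1/2 * ?u\<^sup>2) + pd i (?B i) x * ?u - pd i (?R i) x * C ?u + j {#i#} * (?A i x * ?u + ?B i x))
     = (\<Sum>i\<in>UNIV. pd i (?A i) x) * (1/2 * ?u\<^sup>2) + (\<Sum>i\<in>UNIV. pd i (?B i) x) * ?u - (\<Sum>i\<in>UNIV. pd i (?R i) x) * C ?u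
       + (\<Sum>i\<in>UNIV. j {#i#} * (?A i x * ?u + ?B i x))"
    by (simp add: sum.distrib sum_subtractf sum_distrib_right)
  also have "(\<Sum>i\<in>UNIV. pd i (?A i) x) = vol x * laplace_beltrami (\<lambda>_. g) (\<lambda>_. a) c x"
    by (rule divergence_gradient[OF a x])
  also have "(\<Sum>i\<in>UNIV. pd i (?B i) x) = vol x * laplace_beltrami (\<lambda>_. g) (\<lambda>_. \<beta>) c x"
    by (rule divergence_gradient[OF \<beta> x])
  also have "(\<Sum>i\<in>UNIV. pd i (?R i) x) = vol x * (real CARD('n) * m / 2)"
    by (simp add: divergence_vol[OF \<xi> x] conformal_divergence[OF x conf])
  also have "(\<Sum>i\<in>UNIV. j {#i#} * (?A i x * ?u + ?B i x))
      = vol x * (\<Sum>l\<in>UNIV. \<Sum>i\<in>UNIV. ginv g i l x * j {#l#} * (pd i a x * ?u + pd i \<beta> x))"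
    by (simp add: sum_distrib_left sum_distrib_right sum.distrib algebra_simps ginv_sym[OF x])
  also have "(\<Sum>l\<in>UNIV. \<Sum>i\<in>UNIV. ginv g i l x * j {#l#} * (pd i a x * ?u + pd i \<beta> x))
      = (\<Sum>i\<in>UNIV. \<Sum>l\<in>UNIV. ginv g i l x * j {#l#} * (pd i a x * ?u + pd i \<beta> x))"
    by (rule sum.swap)
  finally have S: "(\<Sum>i\<in>UNIV. pd i (?A i) x * (1/2 * ?u\<^sup>2) + pd i (?B i) x * ?u - pd i (?R i) x * C ?u + j {#i#} * (?A i x * ?u + ?B i x))
    = vol x * laplace_beltrami (\<lambda>_. g) (\<lambda>_. a) c x * (1/2 * ?u\<^sup>2) + vol x * laplace_beltrami (\<lambda>_. g) (\<lambda>_. \<beta>) c x * ?u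
      - vol x * (real CARD('n) * m / 2) * C ?u
      + vol x * (\<Sum>i\<in>UNIV. \<Sum>l\<in>UNIV. ginv g i l x * j {#l#} * (pd i a x * ?u + pd i \<beta> x))" .
  have z: "a x - (2 - real CARD('n)) / 4 * m = 0" using am by simp
  have "vol x * (1/2 * ?u\<^sup>2 * laplace_beltrami (\<lambda>_. g) (\<lambda>_. a) c x + ?u * laplace_beltrami (\<lambda>_. g) (\<lambda>_. \<beta>) c x
      + (a x * ?u + \<beta> x) * f ?u + real CARD('n) * m / 2 * (F ?u - C ?u)) = 0"
    unfolding eq by simp
  then show ?thesis
    unfolding T S z lagrangian_variation_conformal[OF x, where f = f and F = F and j = j, OF F a \<beta> conf]
    by (simp add: field_simps)
qed

text \<open>The Euler-Lagrange identity is compared at two jets that differ only in one second order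
  coordinate u_kl. Every term of order one is the same at both, so only the second derivative of the
  quadratic part is left, a positive multiple of c0 g^{kl}.\<close>

lemma divergence_imp_no_quadratic_part:
  fixes \<phi> :: "'n \<Rightarrow> 'n dfun"
  assumes x: "x \<in> V" and \<phi>: "\<And>i. differential_function V UNIV (\<phi> i)"
    and L: "\<And>x j. x \<in> V \<Longrightarrow> L x j = vol x * (c0 * qform x (\<lambda>i. j {#i#})
      + (\<Sum>i\<in>UNIV. \<Sum>l\<in>UNIV. ginv g i l x * j {#l#} * B i x (j {#})) + E x (j {#}))"
    and div: "\<And>x j. x \<in> V \<Longrightarrow> L x j = (\<Sum>i\<in>UNIV. total_deriv i (\<phi> i) x j)"
  shows "c0 = 0"
proof (rule ginv_nonzero[OF x])
  fix k l
  have o: "order_le 1 V L"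
    unfolding order_le_def by (auto simp: L qform_def)
  \<comment> \<open>Zero except for u_kl, so it agrees with the zero jet up to first order.\<close>
  define j1 :: "'n jet" where "j1 = (\<lambda>_. 0)({#k, l#} := 1)"
  let ?j0 = "\<lambda>_ :: 'n multiset. 0 :: real"
  have agree: "P x j1 = P x ?j0" if "order_le 1 V P" for P
    by (rule order_leD[OF that x]) (auto simp: j1_def)
  have dL: "pd_u {#i#} L y j = vol y * (c0 * (2 * (\<Sum>l\<in>UNIV. ginv g i l y * j {#l#})) + (\<Sum>a\<in>UNIV. ginv g a i y * B a y (j {#})))"
    if y: "y \<in> V" for i y j
  proof -
    have lin: "((\<lambda>t. \<Sum>a\<in>UNIV. \<Sum>l\<in>UNIV. ginv g a l y * (j({#i#} := t)) {#l#} * B a y (j {#})) has_real_derivative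
        (\<Sum>a\<in>UNIV. \<Sum>l\<in>UNIV. ginv g a l y * (if {#l#} = {#i#} then 1 else 0) * B a y (j {#}))) (at (j {#i#}))"
      by (intro DERIV_sum DERIV_cmult_right DERIV_cmult DERIV_jet_coordinate)
    have "((\<lambda>t. vol y * (c0 * qform y (\<lambda>a. (j({#i#} := t)) {#a#})
        + (\<Sum>a\<in>UNIV. \<Sum>l\<in>UNIV. ginv g a l y * (j({#i#} := t)) {#l#} * B a y (j {#})) + E y (j {#}))) has_real_derivative
       vol y * (c0 * (2 * (\<Sum>l\<in>UNIV. ginv g i l y * j {#l#}))
        + (\<Sum>a\<in>UNIV. \<Sum>l\<in>UNIV. ginv g a l y * (if {#l#} = {#i#} then 1 else 0) * B a y (j {#})) + 0)) (at (j {#i#}))"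
      by (intro DERIV_add DERIV_const DERIV_cmult DERIV_qform lin y)
    moreover have "(\<lambda>t. L y (j({#i#} := t))) = (\<lambda>t. vol y * (c0 * qform y (\<lambda>a. (j({#i#} := t)) {#a#})
        + (\<Sum>a\<in>UNIV. \<Sum>l\<in>UNIV. ginv g a l y * (j({#i#} := t)) {#l#} * B a y (j {#})) + E y (j {#})))"
      by (simp add: L[OF y])
    moreover have "(\<Sum>a\<in>UNIV. \<Sum>l\<in>UNIV. ginv g a l y * (if {#l#} = {#i#} then 1 else 0) * B a y (j {#})) = (\<Sum>a\<in>UNIV. ginv g a i y * B a y (j {#}))"
      by (simp add: if_distrib[of "\<lambda>u. _ * u"] if_distrib[of "\<lambda>u. u * _"] cong: if_cong)
    ultimately show ?thesis unfolding pd_u_def by (intro DERIV_imp_deriv) simp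
  qed
  have ddL: "pd_u {#m#} (pd_u {#i#} L) x j = vol x * (c0 * (2 * ginv g i m x))" for i m j
  proof -
    have "((\<lambda>t. vol x * (c0 * (2 * (\<Sum>l\<in>UNIV. ginv g i l x * (j({#m#} := t)) {#l#})) + (\<Sum>a\<in>UNIV. ginv g a i x * B a x (j {#}))))
      has_real_derivative vol x * (c0 * (2 * (\<Sum>l\<in>UNIV. ginv g i l x * (if {#l#} = {#m#} then 1 else 0))) + 0)) (at (j {#m#}))"
      by (intro DERIV_add DERIV_const DERIV_cmult DERIV_sum DERIV_jet_coordinate)
    moreover have "(\<lambda>t. pd_u {#i#} L x (j({#m#} := t))) = (\<lambda>t. vol x * (c0 * (2 * (\<Sum>l\<in>UNIV. ginv g i l x * (j({#m#} := t)) {#l#})) + (\<Sum>a\<in>UNIV. ginv g a i x * B a x (j {#}))))"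
      by (simp add: dL[OF x])
    moreover have "(\<Sum>l\<in>UNIV. ginv g i l x * (if {#l#} = {#m#} then 1 else 0)) = ginv g i m x"
      by (simp add: if_distrib[of "\<lambda>u. _ * u"] cong: if_cong)
    ultimately show ?thesis unfolding pd_u_def[of "{#m#}"] by (intro DERIV_imp_deriv) simp
  qed
  have EL: "pd_u {#} L x j = (\<Sum>i\<in>UNIV. total_deriv i (pd_u {#i#} L) x j)" for j
    by (rule euler_lagrange_divergence[OF open_V \<phi> div o x])
  have td: "total_deriv i (pd_u {#i#} L) x j1 - total_deriv i (pd_u {#i#} L) x ?j0
      = (\<Sum>m\<in>UNIV. j1 {#i, m#} * (vol x * (c0 * (2 * ginv g i m x))))" for i
    using agree[OF pd_x_order[OF open_V pd_u_order[OF o]]]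
    by (simp add: order_1_total_deriv[OF pd_u_order[OF o] x] ddL j1_def)
  have "(\<Sum>i\<in>UNIV. \<Sum>m\<in>UNIV. j1 {#i, m#} * (vol x * (c0 * (2 * ginv g i m x)))) = 0"
    unfolding td[symmetric] sum_subtractf EL[symmetric] using agree[OF pd_u_order[OF o]] by simp
  moreover have "j1 {#i, m#} * (vol x * (c0 * (2 * ginv g i m x))) = j1 {#i, m#} * (vol x * (c0 * (2 * ginv g k l x)))" for i m
    using ginv_sym[OF x, of k l] by (auto simp: j1_def add_eq_conv_ex)
  ultimately have "(\<Sum>i\<in>UNIV. \<Sum>m\<in>UNIV. j1 {#i, m#}) * (vol x * (c0 * (2 * ginv g k l x))) = 0"
    by (simp add: sum_distrib_right)
  \<comment> \<open>The double sum meets u_kl once or twice, according to whether k = l; a lower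
    bound suffices.\<close>
  moreover have "(\<Sum>i\<in>UNIV. \<Sum>m\<in>UNIV. j1 {#i, m#}) \<ge> 1"
  proof -
    have nn: "j1 I \<ge> 0" for I by (simp add: j1_def)
    have "1 = j1 {#k, l#}" by (simp add: j1_def)
    also have "\<dots> \<le> (\<Sum>m\<in>UNIV. j1 {#k, m#})" by (rule member_le_sum) (auto simp: nn)
    also have "\<dots> \<le> (\<Sum>i\<in>UNIV. \<Sum>m\<in>UNIV. j1 {#i, m#})"
      by (rule member_le_sum[of k UNIV "\<lambda>i. \<Sum>m\<in>UNIV. j1 {#i, m#}"]) (auto simp: nn sum_nonneg)
    finally show ?thesis .
  qed
  ultimately show "c0 * ginv g k l x = 0" using vol_pos[OF x] by auto
qed

end

text \<open>Second derivatives of rank one, r_i r_l, are enough, since polarization recovers a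
  symmetric form from its quadratic form. The product over the multiset is a convenient extension to
  higher orders.\<close>

definition jet2 :: "real \<Rightarrow> ('n::finite \<Rightarrow> real) \<Rightarrow> ('n \<Rightarrow> real) \<Rightarrow> 'n jet" where
  "jet2 u p r I = (if size I \<le> 1 then jet1 u p I else \<Prod>i\<in>#I. r i)"

lemma jet2_simps [simp]: "jet2 u p r {#} = u" "jet2 u p r {#i#} = p i" "jet2 u p r {#i, l#} = r i * r l"
  by (simp_all add: jet2_def)

lemma prolong_cong:
  assumes VJ: "open V" "open J" and eq: "\<And>x u. x \<in> V \<Longrightarrow> u \<in> J \<Longrightarrow> \<xi> x u = \<xi>' x u" "\<And>x u. x \<in> V \<Longrightarrow> u \<in> J \<Longrightarrow> \<eta> x u = \<eta>' x u"
    and xj: "(x, j) \<in> jet_dom V J"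
  shows "prolong1 \<xi> \<eta> P x j = prolong1 \<xi>' \<eta>' P x j" "prolong2 \<xi> \<eta> P x j = prolong2 \<xi>' \<eta>' P x j"
    "lagrangian_variation h F \<xi> \<eta> x j = lagrangian_variation h F \<xi>' \<eta>' x j"
proof -
  have xi: "xi_fun \<xi> k x j = xi_fun \<xi>' k x j" and eta: "eta_fun \<eta> x j = eta_fun \<eta>' x j" if "(x, j) \<in> jet_dom V J" for k x j
    using eq that by (auto simp: xi_fun_def eta_fun_def jet_dom_def)
  have txi: "total_deriv i (xi_fun \<xi> k) x j = total_deriv i (xi_fun \<xi>' k) x j"
    and teta: "total_deriv i (eta_fun \<eta>) x j = total_deriv i (eta_fun \<eta>') x j" if "(x, j) \<in> jet_dom V J" for i k x j
    by (auto intro: total_deriv_cong[OF VJ that] xi eta)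
  have e1: "eta1 \<xi> \<eta> i x j = eta1 \<xi>' \<eta>' i x j" if "(x, j) \<in> jet_dom V J" for i x j
    by (simp add: eta1_def txi[OF that] teta[OF that])
  have e2: "eta2 \<xi> \<eta> i l x j = eta2 \<xi>' \<eta>' i l x j" for i l
    using total_deriv_cong[OF VJ xj, of "eta1 \<xi> \<eta> i" "eta1 \<xi>' \<eta>' i" l] e1 by (simp add: eta2_def txi[OF xj])
  show p1: "prolong1 \<xi> \<eta> P x j = prolong1 \<xi>' \<eta>' P x j" for P
    by (simp add: prolong1_def xi[OF xj] eta[OF xj] e1[OF xj])
  show "prolong2 \<xi> \<eta> P x j = prolong2 \<xi>' \<eta>' P x j"
    by (simp add: prolong2_def p1 e2)
  show "lagrangian_variation h F \<xi> \<eta> x j = lagrangian_variation h F \<xi>' \<eta>' x j"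
    by (simp add: lagrangian_variation_def p1 txi[OF xj])
qed

lemma order_le_eta1: "order_le 1 V (eta1 \<xi> \<eta> i)"
  unfolding order_le_def eta1_eq by simp

section \<open>The second prolongation and the determining equations\<close>

context chart_metric
begin

lemma DERIV_poisson:
  assumes "I = {#} \<Longrightarrow> (f has_real_derivative f') (at (j {#}))"
  shows "((\<lambda>t. poisson g f x (j(I := t))) has_real_derivative
    (\<Sum>a\<in>UNIV. \<Sum>b\<in>UNIV. ginv g a b x * (if {#a, b#} = I then 1 else 0))
    - (\<Sum>a\<in>UNIV. christoffel_trace g a x * (if {#a#} = I then 1 else 0)) + (if I = {#} then f' else 0)) (at (j I))"
proof -
  have "((\<lambda>t. f ((j(I := t)) {#})) has_real_derivative (if I = {#} then f' else 0)) (at (j I))"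
    using assms by (cases "I = {#}") auto
  then show ?thesis
    unfolding poisson_def by (intro DERIV_add DERIV_diff DERIV_sum DERIV_cmult DERIV_jet_coordinate)
qed

lemma pd_u_poisson_0:
  assumes "(f has_real_derivative f') (at (j {#}))"
  shows "pd_u {#} (poisson g f) x j = f'"
  using DERIV_imp_deriv[OF DERIV_poisson[of "{#}" f f' j x]] assms by (simp add: pd_u_def)

lemma pd_u_poisson_1: "pd_u {#i#} (poisson g f) x j = - christoffel_trace g i x"
  using DERIV_imp_deriv[OF DERIV_poisson[of "{#i#}" f 0 j x]]
  by (simp add: pd_u_def if_distrib[of "\<lambda>u. _ * u"] cong: if_cong)

text \<open>The double sum in the equation meets u_il twice when i and l differ; the weight in
  \<open>prolong2\<close> compensates for this.\<close>

lemma pd_u_poisson_2: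
  assumes x: "x \<in> V"
  shows "(if i = l then 1 else 1/2) * pd_u {#i, l#} (poisson g f) x j = ginv g i l x"
proof -
  have "pd_u {#i, l#} (poisson g f) x j = (\<Sum>a\<in>UNIV. \<Sum>b\<in>UNIV. ginv g a b x * (if {#a, b#} = {#i, l#} then 1 else 0))"
    using DERIV_imp_deriv[OF DERIV_poisson[of "{#i, l#}" f 0 j x]] by (simp add: pd_u_def)
  also have "\<dots> = (\<Sum>a\<in>UNIV. \<Sum>b\<in>UNIV. (if a = i then if b = l then ginv g i l x else 0 else 0)
      + (if i = l then 0 else if a = l then if b = i then ginv g l i x else 0 else 0))"
    by (intro sum.cong refl) (auto simp: add_eq_conv_ex)
  also have "\<dots> = ginv g i l x + (if i = l then 0 else ginv g l i x)"
  proof -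
    have D: "(\<Sum>a\<in>UNIV. \<Sum>b\<in>UNIV. if a = i then if b = l then c else 0 else 0) = c" for i l :: 'n and c :: real
    proof -
      have "(\<Sum>b\<in>UNIV. if a = i then if b = l then c else 0 else 0) = (if a = i then c else 0)" for a by simp
      then show ?thesis by simp
    qed
    show ?thesis by (cases "i = l") (simp_all add: sum.distrib D)
  qed
  finally show ?thesis by (auto simp: ginv_sym[OF x, of l i])
qed

lemma pd_x_poisson:
  assumes x: "x \<in> V"
  shows "pd_x k (poisson g f) x j = (\<Sum>i\<in>UNIV. \<Sum>l\<in>UNIV. pd k (ginv g i l) x * j {#i, l#})
    - (\<Sum>i\<in>UNIV. pd k (christoffel_trace g i) x * j {#i#})"
proof -
  note d = diff[OF x smooth_ginv] diff[OF x smooth_christoffel_trace]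
  show ?thesis
    unfolding pd_x_def poisson_def
    using d by (simp add: pd_add pd_diff pd_sum pd_mult)
qed

lemma prolong2_poisson:
  assumes x: "x \<in> V" and f: "(f has_real_derivative f') (at (j {#}))"
  shows "prolong2 \<xi> \<eta> (poisson g f) x j =
    (\<Sum>k\<in>UNIV. \<xi> x (j {#}) $ k * ((\<Sum>i\<in>UNIV. \<Sum>l\<in>UNIV. pd k (ginv g i l) x * j {#i, l#})
      - (\<Sum>i\<in>UNIV. pd k (christoffel_trace g i) x * j {#i#})))
    + \<eta> x (j {#}) * f' - (\<Sum>i\<in>UNIV. eta1 \<xi> \<eta> i x j * christoffel_trace g i x)
    + (\<Sum>i\<in>UNIV. \<Sum>l\<in>UNIV. ginv g i l x * eta2 \<xi> \<eta> i l x j)"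
proof -
  have "(if i = l then 1 else 1/2) * eta2 \<xi> \<eta> i l x j * pd_u {#i, l#} (poisson g f) x j = ginv g i l x * eta2 \<xi> \<eta> i l x j" for i l
    using pd_u_poisson_2[OF x, of i l f j] by (simp add: mult_ac)
  then show ?thesis
    by (simp only: prolong2_def prolong1_def pd_x_poisson[OF x] pd_u_poisson_0[where f = f and f' = f' and j = j, OF f] pd_u_poisson_1 xi_fun_def eta_fun_def)
      (simp add: sum_negf)
qed

text \<open>As \<xi> does not involve u and \<eta> is affine in u, no products of derivatives of u
  occur.\<close>

lemma eta2_projectable:
  assumes x: "x \<in> V" and \<xi>: "smooth_on V \<xi>" and a: "smooth_on V a" and \<beta>: "smooth_on V \<beta>"
  shows "eta2 (\<lambda>y _. \<xi> y) (\<lambda>y u. a y * u + \<beta> y) i l x j =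
    pd l (pd i a) x * j {#} + pd l (pd i \<beta>) x + pd l a x * j {#i#} + pd i a x * j {#l#}
    - (\<Sum>k\<in>UNIV. j {#k#} * pd l (pd i (\<lambda>y. \<xi> y $ k)) x) + a x * j {#i, l#}
    - (\<Sum>k\<in>UNIV. j {#l, k#} * pd i (\<lambda>y. \<xi> y $ k) x) - (\<Sum>k\<in>UNIV. j {#i, k#} * pd l (\<lambda>y. \<xi> y $ k) x)"
proof -
  let ?E = "\<lambda>x (j :: 'n jet). pd i a x * j {#} + pd i \<beta> x + a x * j {#i#} - (\<Sum>k\<in>UNIV. j {#k#} * pd i (\<lambda>y. \<xi> y $ k) x)"
  have s: "smooth_on V (\<lambda>y. \<xi> y $ k)" for k by (rule smooth_on_vec_nth[OF open_V \<xi>])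
  note d = diff[OF x a] diff[OF x smooth_pd[OF a]] diff[OF x smooth_pd[OF \<beta>]] diff[OF x smooth_pd[OF s]]
  have E: "eta1 (\<lambda>y _. \<xi> y) (\<lambda>y u. a y * u + \<beta> y) i y j = ?E y j" if y: "y \<in> V" for y j
  proof -
    have "pd i (\<lambda>y. a y * j {#} + \<beta> y) y = pd i a y * j {#} + pd i \<beta> y"
      using diff[OF y a] diff[OF y \<beta>] by (simp add: pd_add pd_mult)
    moreover have "deriv (\<lambda>u. a y * u + \<beta> y) (j {#}) = a y"
      by (rule DERIV_imp_deriv) (auto intro!: derivative_eq_intros)
    ultimately show ?thesis by (simp add: eta1_eq)
  qed
  have pk: "pd_u {#k#} ?E x j = a x * (if k = i then 1 else 0) - pd i (\<lambda>y. \<xi> y $ k) x" for k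
  proof -
    have "((\<lambda>t. ?E x (j({#k#} := t))) has_real_derivative
        0 + 0 + a x * (if {#i#} = {#k#} then 1 else 0) - (\<Sum>m\<in>UNIV. (if {#m#} = {#k#} then 1 else 0) * pd i (\<lambda>y. \<xi> y $ m) x)) (at (j {#k#}))"
      by (intro DERIV_add DERIV_diff DERIV_sum DERIV_cmult_right DERIV_cmult DERIV_jet_coordinate) auto
    then show ?thesis unfolding pd_u_def
      by (intro DERIV_imp_deriv) (auto simp: if_distrib[of "\<lambda>u. u * _"] cong: if_cong)
  qed
  have "total_deriv l (eta1 (\<lambda>y _. \<xi> y) (\<lambda>y u. a y * u + \<beta> y) i) x j = total_deriv l ?E x j"
    by (rule total_deriv_cong[OF open_V open_UNIV, of x j]) (use x E in auto)
  also have "\<dots> = pd_x l ?E x j + j {#l#} * pd_u {#} ?E x j + (\<Sum>k\<in>UNIV. j {#l, k#} * pd_u {#k#} ?E x j)"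
    by (rule order_1_total_deriv[OF _ x]) (simp add: order_le_def)
  also have "pd_x l ?E x j = pd l (pd i a) x * j {#} + pd l (pd i \<beta>) x + pd l a x * j {#i#}
      - (\<Sum>k\<in>UNIV. j {#k#} * pd l (pd i (\<lambda>y. \<xi> y $ k)) x)"
    unfolding pd_x_def using d by (simp add: pd_add pd_diff pd_sum pd_mult)
  also have "pd_u {#} ?E x j = pd i a x"
    unfolding pd_u_def by (rule DERIV_imp_deriv) (auto intro!: derivative_eq_intros)
  also have "(\<Sum>k\<in>UNIV. j {#l, k#} * pd_u {#k#} ?E x j)
      = a x * j {#i, l#} - (\<Sum>k\<in>UNIV. j {#l, k#} * pd i (\<lambda>y. \<xi> y $ k) x)"
    unfolding pk
    by (simp add: right_diff_distrib sum_subtractf add_mset_commute[of l i] if_distrib[of "\<lambda>u. _ * u"] cong: if_cong)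
  finally show ?thesis
    unfolding eta2_def total_deriv_xi_fun by simp
qed

text \<open>The second order terms scale with a - \<mu> by the raised conformal equation, the first
  order ones by \<open>conformal_christoffel_trace\<close>. The gradient of \<mu> drops out because
  twice (2 - n)/4, from the mixed terms of \<open>eta2\<close>, equals the 1 - n/2 of that
  identity.\<close>

lemma prolong2_poisson_conformal:
  assumes x: "x \<in> V" and f: "(f has_real_derivative f') (at (j {#}))"
    and \<xi>: "smooth_on V \<xi>" and \<mu>: "smooth_on V \<mu>" and a: "smooth_on V a" and \<beta>: "smooth_on V \<beta>"
    and conf: "\<And>x. x \<in> V \<Longrightarrow> \<forall>i j. lie_metric g \<xi> i j x = \<mu> x * g x $ i $ j"
    and a\<mu>: "\<And>i. pd i a x = (2 - real CARD('n)) / 4 * pd i \<mu> x"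
  shows "prolong2 (\<lambda>y _. \<xi> y) (\<lambda>y u. a y * u + \<beta> y) (poisson g f) x j =
    (a x - \<mu> x) * (poisson g f x j - f (j {#})) + j {#} * laplace_beltrami (\<lambda>_. g) (\<lambda>_. a) c x
    + laplace_beltrami (\<lambda>_. g) (\<lambda>_. \<beta>) c x + (a x * j {#} + \<beta> x) * f'"
proof -
  define u where "u = j {#}"
  define p where "p i = j {#i#}" for i
  define q where "q i l = j {#i, l#}" for i l
  define G where "G i l = ginv g i l x" for i l
  define P where "P i k = pd i (\<lambda>y. \<xi> y $ k) x" for i k
  define PP where "PP l i k = pd l (pd i (\<lambda>y. \<xi> y $ k)) x" for l i k
  define \<Gamma> where "\<Gamma> k = christoffel_trace g k x" for k
  define X where "X k = \<xi> x $ k" for k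
  define D\<Gamma> where "D\<Gamma> k i = pd k (christoffel_trace g i) x" for k i
  have qs: "q i l = q l i" for i l by (simp add: q_def add_mset_commute)
  have Gs: "G i l = G l i" for i l unfolding G_def by (rule ginv_sym[OF x])
  have PPs: "PP l i k = PP i l k" for i l k
    unfolding PP_def by (rule pd_pd_commute[OF open_V smooth_on_vec_nth[OF open_V \<xi>] x])
  define N where "N = (\<Sum>i\<in>UNIV. \<Sum>l\<in>UNIV. \<Sum>k\<in>UNIV. q i l * G i k * P k l)"
  define Gq where "Gq = (\<Sum>i\<in>UNIV. \<Sum>l\<in>UNIV. G i l * q i l)"
  define \<Gamma>p where "\<Gamma>p = (\<Sum>k\<in>UNIV. \<Gamma> k * p k)"
  define Gm where "Gm = (\<Sum>i\<in>UNIV. \<Sum>l\<in>UNIV. G i l * pd l \<mu> x * p i)"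
  define M where "M k = (\<Sum>l\<in>UNIV. G k l * pd l \<mu> x)" for k
  define Y where "Y k = (\<Sum>i\<in>UNIV. \<Sum>l\<in>UNIV. G i l * PP i l k)" for k
  have I: "(\<Sum>k\<in>UNIV. X k * pd k (ginv g i l) x) = (\<Sum>k\<in>UNIV. G i k * P k l) + (\<Sum>k\<in>UNIV. G l k * P k i) - \<mu> x * G i l" for i l
  proof -
    have "raised_lie \<xi> i l x = \<mu> x * ginv g i l x"
      using conformal_iff_raised[OF x] conf[OF x] by blast
    then show ?thesis by (simp add: raised_lie_def G_def P_def X_def)
  qed
  have II: "Y k + (\<Sum>m\<in>UNIV. X m * D\<Gamma> m k) - (\<Sum>m\<in>UNIV. \<Gamma> m * P m k)
      = - \<mu> x * \<Gamma> k + (1 - real CARD('n) / 2) * M k" for k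
    using conformal_christoffel_trace[OF \<xi> \<mu> conf x, of k]
    unfolding Y_def G_def P_def X_def PP_def \<Gamma>_def D\<Gamma>_def M_def .
  have T1: "(\<Sum>k\<in>UNIV. X k * (\<Sum>i\<in>UNIV. \<Sum>l\<in>UNIV. pd k (ginv g i l) x * q i l)) = 2 * N - \<mu> x * Gq"
  proof -
    have "(\<Sum>k\<in>UNIV. X k * (\<Sum>i\<in>UNIV. \<Sum>l\<in>UNIV. pd k (ginv g i l) x * q i l))
       = (\<Sum>k\<in>UNIV. \<Sum>i\<in>UNIV. \<Sum>l\<in>UNIV. X k * pd k (ginv g i l) x * q i l)"
      by (simp add: sum_distrib_left mult.assoc)
    also have "\<dots> = (\<Sum>i\<in>UNIV. \<Sum>k\<in>UNIV. \<Sum>l\<in>UNIV. X k * pd k (ginv g i l) x * q i l)" by (rule sum.swap)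
    also have "\<dots> = (\<Sum>i\<in>UNIV. \<Sum>l\<in>UNIV. \<Sum>k\<in>UNIV. X k * pd k (ginv g i l) x * q i l)"
      by (rule sum.cong[OF refl], rule sum.swap)
    also have "\<dots> = (\<Sum>i\<in>UNIV. \<Sum>l\<in>UNIV. ((\<Sum>k\<in>UNIV. G i k * P k l) + (\<Sum>k\<in>UNIV. G l k * P k i) - \<mu> x * G i l) * q i l)"
      by (simp add: sum_distrib_right[symmetric] I)
    also have "\<dots> = N + (\<Sum>i\<in>UNIV. \<Sum>l\<in>UNIV. \<Sum>k\<in>UNIV. q i l * G l k * P k i) - \<mu> x * Gq"
      unfolding N_def Gq_def
      by (simp add: algebra_simps sum.distrib sum_subtractf sum_distrib_left)
    also have "(\<Sum>i\<in>UNIV. \<Sum>l\<in>UNIV. \<Sum>k\<in>UNIV. q i l * G l k * P k i) = N"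
      unfolding N_def by (subst sum.swap) (simp add: qs)
    finally show ?thesis by simp
  qed
  have T2: "(\<Sum>k\<in>UNIV. X k * (\<Sum>i\<in>UNIV. D\<Gamma> k i * p i)) = (\<Sum>k\<in>UNIV. p k * (\<Sum>m\<in>UNIV. X m * D\<Gamma> m k))"
    by (simp add: sum_distrib_left mult_ac) (rule sum.swap)
  have T3: "(\<Sum>i\<in>UNIV. (\<Sum>k\<in>UNIV. p k * P i k) * \<Gamma> i) = (\<Sum>k\<in>UNIV. p k * (\<Sum>m\<in>UNIV. \<Gamma> m * P m k))"
    by (simp add: sum_distrib_left mult_ac) (rule sum.swap)
  have "deriv (\<lambda>u. a x * u + \<beta> x) u = a x"
    by (rule DERIV_imp_deriv) (auto intro!: derivative_eq_intros)
  moreover have "pd i (\<lambda>y. a y * u + \<beta> y) x = pd i a x * u + pd i \<beta> x" for i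
    using diff[OF x a] diff[OF x \<beta>] by (simp add: pd_add pd_mult)
  ultimately have e1: "eta1 (\<lambda>y _. \<xi> y) (\<lambda>y u. a y * u + \<beta> y) i x j = pd i a x * u + pd i \<beta> x + p i * a x - (\<Sum>k\<in>UNIV. p k * P i k)" for i
    by (simp add: eta1_eq u_def p_def P_def)
  have S1: "(\<Sum>i\<in>UNIV. eta1 (\<lambda>y _. \<xi> y) (\<lambda>y u. a y * u + \<beta> y) i x j * \<Gamma> i)
      = u * (\<Sum>i\<in>UNIV. \<Gamma> i * pd i a x) + (\<Sum>i\<in>UNIV. \<Gamma> i * pd i \<beta> x) + a x * \<Gamma>p - (\<Sum>k\<in>UNIV. p k * (\<Sum>m\<in>UNIV. \<Gamma> m * P m k))"
    unfolding e1 T3[symmetric] \<Gamma>p_def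
    by (simp add: algebra_simps sum.distrib sum_subtractf sum_distrib_left)
  have S2: "(\<Sum>i\<in>UNIV. \<Sum>l\<in>UNIV. G i l * eta2 (\<lambda>y _. \<xi> y) (\<lambda>y u. a y * u + \<beta> y) i l x j)
      = u * (\<Sum>i\<in>UNIV. \<Sum>l\<in>UNIV. G i l * pd i (pd l a) x) + (\<Sum>i\<in>UNIV. \<Sum>l\<in>UNIV. G i l * pd i (pd l \<beta>) x)
        + (2 - real CARD('n)) / 2 * Gm - (\<Sum>k\<in>UNIV. p k * Y k) + a x * Gq - 2 * N"
  proof -
    have "(\<Sum>i\<in>UNIV. \<Sum>l\<in>UNIV. G i l * eta2 (\<lambda>y _. \<xi> y) (\<lambda>y u. a y * u + \<beta> y) i l x j)
      = u * (\<Sum>i\<in>UNIV. \<Sum>l\<in>UNIV. G i l * pd l (pd i a) x) + (\<Sum>i\<in>UNIV. \<Sum>l\<in>UNIV. G i l * pd l (pd i \<beta>) x)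
        + (\<Sum>i\<in>UNIV. \<Sum>l\<in>UNIV. G i l * pd l a x * p i) + (\<Sum>i\<in>UNIV. \<Sum>l\<in>UNIV. G i l * pd i a x * p l)
        - (\<Sum>i\<in>UNIV. \<Sum>l\<in>UNIV. \<Sum>k\<in>UNIV. p k * (G i l * PP l i k)) + a x * Gq
        - (\<Sum>i\<in>UNIV. \<Sum>l\<in>UNIV. \<Sum>k\<in>UNIV. q l k * G i l * P i k) - (\<Sum>i\<in>UNIV. \<Sum>l\<in>UNIV. \<Sum>k\<in>UNIV. q i k * G i l * P l k)"
      unfolding eta2_projectable[OF x \<xi> a \<beta>] u_def[symmetric] p_def[symmetric] q_def[symmetric] P_def[symmetric] PP_def[symmetric] Gq_def
      by (simp add: algebra_simps sum.distrib sum_subtractf sum_distrib_left)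
    also have "(\<Sum>i\<in>UNIV. \<Sum>l\<in>UNIV. \<Sum>k\<in>UNIV. q l k * G i l * P i k) = N"
    proof -
      have "(\<Sum>i\<in>UNIV. \<Sum>l\<in>UNIV. \<Sum>k\<in>UNIV. q l k * G i l * P i k) = (\<Sum>l\<in>UNIV. \<Sum>i\<in>UNIV. \<Sum>k\<in>UNIV. q l k * G i l * P i k)"
        by (rule sum.swap)
      also have "\<dots> = (\<Sum>l\<in>UNIV. \<Sum>k\<in>UNIV. \<Sum>i\<in>UNIV. q l k * G i l * P i k)"
        by (rule sum.cong[OF refl], rule sum.swap)
      finally show ?thesis by (simp add: N_def Gs)
    qed
    also have "(\<Sum>i\<in>UNIV. \<Sum>l\<in>UNIV. \<Sum>k\<in>UNIV. q i k * G i l * P l k) = N"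
      unfolding N_def by (rule sum.cong[OF refl], rule sum.swap)
    also have "(\<Sum>i\<in>UNIV. \<Sum>l\<in>UNIV. G i l * pd i a x * p l) = (\<Sum>i\<in>UNIV. \<Sum>l\<in>UNIV. G i l * pd l a x * p i)"
      by (subst sum.swap) (simp add: Gs)
    also have "(\<Sum>i\<in>UNIV. \<Sum>l\<in>UNIV. G i l * pd l a x * p i) = (2 - real CARD('n)) / 4 * Gm"
      by (simp add: a\<mu> Gm_def sum_distrib_left mult_ac)
    also have "(\<Sum>i\<in>UNIV. \<Sum>l\<in>UNIV. \<Sum>k\<in>UNIV. p k * (G i l * PP l i k)) = (\<Sum>k\<in>UNIV. p k * Y k)"
    proof -
      have "(\<Sum>i\<in>UNIV. \<Sum>l\<in>UNIV. \<Sum>k\<in>UNIV. p k * (G i l * PP l i k)) = (\<Sum>i\<in>UNIV. \<Sum>k\<in>UNIV. \<Sum>l\<in>UNIV. p k * (G i l * PP l i k))"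
        by (rule sum.cong[OF refl], rule sum.swap)
      also have "\<dots> = (\<Sum>k\<in>UNIV. \<Sum>i\<in>UNIV. \<Sum>l\<in>UNIV. p k * (G i l * PP l i k))" by (rule sum.swap)
      also have "\<dots> = (\<Sum>k\<in>UNIV. p k * Y k)"
        unfolding Y_def sum_distrib_left by (intro sum.cong refl) (simp only: PPs)
      finally show ?thesis .
    qed
    also have "(\<Sum>i\<in>UNIV. \<Sum>l\<in>UNIV. G i l * pd l (pd i a) x) = (\<Sum>i\<in>UNIV. \<Sum>l\<in>UNIV. G i l * pd i (pd l a) x)"
      by (intro sum.cong refl arg_cong2[where f = "(*)"] pd_pd_commute[OF open_V a x])
    also have "(\<Sum>i\<in>UNIV. \<Sum>l\<in>UNIV. G i l * pd l (pd i \<beta>) x) = (\<Sum>i\<in>UNIV. \<Sum>l\<in>UNIV. G i l * pd i (pd l \<beta>) x)"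
      by (intro sum.cong refl arg_cong2[where f = "(*)"] pd_pd_commute[OF open_V \<beta> x])
    finally show ?thesis by (simp add: field_simps)
  qed
  \<comment> \<open>The identity for the Christoffel trace, contracted with the first derivatives
    u_k.\<close>
  have K: "(\<Sum>k\<in>UNIV. p k * Y k) + (\<Sum>k\<in>UNIV. p k * (\<Sum>m\<in>UNIV. X m * D\<Gamma> m k)) - (\<Sum>k\<in>UNIV. p k * (\<Sum>m\<in>UNIV. \<Gamma> m * P m k))
      = - \<mu> x * \<Gamma>p + (1 - real CARD('n) / 2) * Gm"
  proof -
    have "(\<Sum>k\<in>UNIV. p k * Y k) + (\<Sum>k\<in>UNIV. p k * (\<Sum>m\<in>UNIV. X m * D\<Gamma> m k)) - (\<Sum>k\<in>UNIV. p k * (\<Sum>m\<in>UNIV. \<Gamma> m * P m k))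
      = (\<Sum>k\<in>UNIV. p k * (Y k + (\<Sum>m\<in>UNIV. X m * D\<Gamma> m k) - (\<Sum>m\<in>UNIV. \<Gamma> m * P m k)))"
      by (simp add: distrib_left right_diff_distrib sum.distrib sum_subtractf)
    also have "\<dots> = - \<mu> x * (\<Sum>k\<in>UNIV. \<Gamma> k * p k) + (1 - real CARD('n) / 2) * (\<Sum>k\<in>UNIV. p k * M k)"
      unfolding II sum_distrib_left[of "- \<mu> x"] sum_distrib_left[of "1 - real CARD('n) / 2"] sum.distrib[symmetric]
      by (rule sum.cong[OF refl]) (simp add: algebra_simps)
    also have "(\<Sum>k\<in>UNIV. p k * M k) = Gm"
      by (simp add: Gm_def M_def sum_distrib_left mult_ac)
    finally show ?thesis by (simp add: \<Gamma>p_def)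
  qed
  have "prolong2 (\<lambda>y _. \<xi> y) (\<lambda>y u. a y * u + \<beta> y) (poisson g f) x j
    = (\<Sum>k\<in>UNIV. X k * (\<Sum>i\<in>UNIV. \<Sum>l\<in>UNIV. pd k (ginv g i l) x * q i l)) - (\<Sum>k\<in>UNIV. X k * (\<Sum>i\<in>UNIV. D\<Gamma> k i * p i))
      + (a x * u + \<beta> x) * f' - (\<Sum>i\<in>UNIV. eta1 (\<lambda>y _. \<xi> y) (\<lambda>y u. a y * u + \<beta> y) i x j * \<Gamma> i)
      + (\<Sum>i\<in>UNIV. \<Sum>l\<in>UNIV. G i l * eta2 (\<lambda>y _. \<xi> y) (\<lambda>y u. a y * u + \<beta> y) i l x j)"
    unfolding prolong2_poisson[OF x, where f = f and f' = f' and j = j, OF f] X_def q_def D\<Gamma>_def p_def u_def \<Gamma>_def G_def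
    by (simp add: right_diff_distrib sum_subtractf)
  also have "\<dots> = (a x - \<mu> x) * (Gq - \<Gamma>p) + u * laplace_beltrami (\<lambda>_. g) (\<lambda>_. a) c x
      + laplace_beltrami (\<lambda>_. g) (\<lambda>_. \<beta>) c x + (a x * u + \<beta> x) * f'"
    using K unfolding T1 T2 S1 S2 laplace_beltrami_eq G_def[symmetric] \<Gamma>_def[symmetric] by (simp add: field_simps)
  also have "Gq - \<Gamma>p = poisson g f x j - f u"
    by (simp add: poisson_def Gq_def \<Gamma>p_def G_def q_def \<Gamma>_def p_def u_def)
  finally show ?thesis unfolding u_def .
qed

text \<open>
  For constant \<open>f\<close> the value of \<open>f\<close> can be adapted to the jet, so that the equation holds at every
  jet; comparing with an affine \<open>f\<close> of the same value at \<open>u\<close> isolates \<open>\<eta>\<close>.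
\<close>

lemma lie_symmetry_all_equations_eta:
  assumes x: "x \<in> V"
    and sym: "\<And>c m j. poisson g (\<lambda>t. c + m * t) x j = 0 \<Longrightarrow> prolong2 \<xi> \<eta> (poisson g (\<lambda>t. c + m * t)) x j = 0"
  shows "\<eta> x u = 0"
proof -
  define j :: "'n jet" where "j = jet1 u (\<lambda>_. 0)"
  have ju: "j {#} = u" by (simp add: j_def)
  define c where "c = - poisson g (\<lambda>_. 0) x j"
  have p: "poisson g (\<lambda>t. (c - m * u) + m * t) x j = 0" for m
    by (simp add: c_def poisson_def ju)
  have d: "((\<lambda>t. (c - m * u) + m * t) has_real_derivative m) (at (j {#}))" for m
    by (auto intro!: derivative_eq_intros)
  have "prolong2 \<xi> \<eta> (poisson g (\<lambda>t. (c - 1 * u) + 1 * t)) x j - prolong2 \<xi> \<eta> (poisson g (\<lambda>t. (c - 0 * u) + 0 * t)) x j = \<eta> x u"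
    unfolding prolong2_poisson[OF x, where f = "\<lambda>t. (c - 1 * u) + 1 * t" and f' = 1 and j = j, OF d]
      prolong2_poisson[OF x, where f = "\<lambda>t. (c - 0 * u) + 0 * t" and f' = 0 and j = j, OF d]
    by (simp add: ju)
  moreover have "prolong2 \<xi> \<eta> (poisson g (\<lambda>t. (c - 1 * u) + 1 * t)) x j = 0"
    "prolong2 \<xi> \<eta> (poisson g (\<lambda>t. (c - 0 * u) + 0 * t)) x j = 0"
    by (rule sym[OF p])+
  ultimately show ?thesis by linarith
qed

text \<open>Some constant source makes the equation hold at any given jet, so the prolongation
  vanishes without restriction. Comparing jets with and without second derivatives r_i r_l leaves an
  identity in r and p: p = 0 gives the Killing equation, p = r excludes a u-derivative of
  \<xi>.\<close>

lemma lie_symmetry_all_equations: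
  assumes x: "x \<in> V"
    and sym: "\<And>x c j. x \<in> V \<Longrightarrow> poisson g (\<lambda>_. c) x j = 0 \<Longrightarrow> prolong2 \<xi> (\<lambda>_ _. 0) (poisson g (\<lambda>_. c)) x j = 0"
  shows "\<forall>i j. lie_metric g (\<lambda>y. \<xi> y u) i j x = 0 * g x $ i $ j" and "deriv (\<lambda>t. \<xi> x t $ k) u = 0"
proof -
  define \<sigma> where "\<sigma> k = deriv (\<lambda>t. \<xi> x t $ k) u" for k
  define P where "P i k = pd i (\<lambda>y. \<xi> y u $ k) x" for i k
  define G where "G i l = ginv g i l x" for i l
  have Gs: "G i l = G l i" for i l unfolding G_def by (rule ginv_sym[OF x])
  define D where "D i l = (\<Sum>k\<in>UNIV. \<xi> x u $ k * pd k (ginv g i l) x)" for i l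
  let ?e = "eta1 \<xi> (\<lambda>_ _. 0)"
  have Z: "prolong2 \<xi> (\<lambda>_ _. 0) (poisson g (\<lambda>_. 0)) x j = 0" for j
  proof -
    have d: "((\<lambda>_. c) has_real_derivative 0) (at (j {#}))" for c :: real by simp
    \<comment> \<open>The constant source for which j solves the equation; the prolongation involves
      only its derivative, which is zero.\<close>
    define c where "c = - poisson g (\<lambda>_. 0) x j"
    have "prolong2 \<xi> (\<lambda>_ _. 0) (poisson g (\<lambda>_. c)) x j = 0"
      by (rule sym[OF x]) (simp add: c_def poisson_def)
    then show ?thesis
      unfolding prolong2_poisson[OF x, where f = "\<lambda>_. c" and f' = 0 and j = j, OF d]
        prolong2_poisson[OF x, where f = "\<lambda>_. 0" and f' = 0 and j = j, OF d] .
  qed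
  have du: "pd_u {#m#} (?e i) x j = - (P i m + j {#i#} * \<sigma> m) - (if i = m then 1 else 0) * (\<Sum>k\<in>UNIV. j {#k#} * \<sigma> k)"
    if "j {#} = u" for i m j
  proof -
    have e: "?e i x (j({#m#} := t)) = - (\<Sum>k\<in>UNIV. (j({#m#} := t)) {#k#} * P i k)
        - (j({#m#} := t)) {#i#} * (\<Sum>k\<in>UNIV. (j({#m#} := t)) {#k#} * \<sigma> k)" for t
      using that by (simp add: eta1_eq P_def \<sigma>_def algebra_simps sum.distrib sum_distrib_left)
    have D: "((\<lambda>t. - (\<Sum>k\<in>UNIV. (j({#m#} := t)) {#k#} * P i k)
        - (j({#m#} := t)) {#i#} * (\<Sum>k\<in>UNIV. (j({#m#} := t)) {#k#} * \<sigma> k)) has_real_derivative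
      - (\<Sum>k\<in>UNIV. (if {#k#} = {#m#} then 1 else 0) * P i k)
        - ((if {#i#} = {#m#} then 1 else 0) * (\<Sum>k\<in>UNIV. (j({#m#} := j {#m#})) {#k#} * \<sigma> k)
          + (\<Sum>k\<in>UNIV. (if {#k#} = {#m#} then 1 else 0) * \<sigma> k) * (j({#m#} := j {#m#})) {#i#})) (at (j {#m#}))"
      by (intro DERIV_diff DERIV_minus DERIV_mult DERIV_sum DERIV_cmult_right DERIV_jet_coordinate)
    show ?thesis unfolding pd_u_def e DERIV_imp_deriv[OF D]
      by (simp add: if_distrib[of "\<lambda>u. u * _"] cong: if_cong)
  qed
  let ?B = "\<lambda>r p. \<Sum>i\<in>UNIV. \<Sum>l\<in>UNIV. G i l * r l * p i" and ?s = "\<lambda>p. \<Sum>k\<in>UNIV. p k * \<sigma> k"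
  have e2: "eta2 \<xi> (\<lambda>_ _. 0) i l x (jet2 u p r) - eta2 \<xi> (\<lambda>_ _. 0) i l x (jet2 u p (\<lambda>_. 0))
     = - r l * (\<Sum>m\<in>UNIV. r m * P i m) - r l * p i * ?s r - r l * r i * ?s p - r i * (\<Sum>k\<in>UNIV. r k * P l k) - r i * p l * ?s r" for i l p r
  proof -
    have "pd_x l (?e i) x (jet2 u p r) = pd_x l (?e i) x (jet2 u p (\<lambda>_. 0))"
      by (rule order_leD[OF pd_x_order[OF open_V order_le_eta1] x]) (simp add: jet2_def)
    moreover have "pd_u {#} (?e i) x (jet2 u p r) = pd_u {#} (?e i) x (jet2 u p (\<lambda>_. 0))"
      by (rule order_leD[OF pd_u_order[OF order_le_eta1] x]) (simp add: jet2_def)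
    ultimately have "eta2 \<xi> (\<lambda>_ _. 0) i l x (jet2 u p r) - eta2 \<xi> (\<lambda>_ _. 0) i l x (jet2 u p (\<lambda>_. 0))
      = (\<Sum>m\<in>UNIV. r l * r m * (- (P i m + p i * \<sigma> m) - (if i = m then 1 else 0) * ?s p))
        - (\<Sum>k\<in>UNIV. r i * r k * (P l k + p l * \<sigma> k))"
      unfolding eta2_def order_1_total_deriv[OF order_le_eta1 x] total_deriv_xi_fun by (simp add: du P_def \<sigma>_def)
    also have "(\<Sum>m\<in>UNIV. r l * r m * (- (P i m + p i * \<sigma> m) - (if i = m then 1 else 0) * ?s p))
       = - r l * (\<Sum>m\<in>UNIV. r m * P i m) - r l * p i * ?s r - r l * r i * ?s p"
    proof -
      have "(\<Sum>m\<in>UNIV. r l * r m * ((if i = m then 1 else 0) * ?s p)) = r l * r i * ?s p"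
        by (simp add: if_distrib[of "\<lambda>u. u * _"] if_distrib[of "\<lambda>u. _ * u"] cong: if_cong)
      then show ?thesis
        by (simp add: right_diff_distrib distrib_left sum.distrib sum_subtractf sum_negf sum_distrib_left mult_ac)
    qed
    also have "(\<Sum>k\<in>UNIV. r i * r k * (P l k + p l * \<sigma> k)) = r i * (\<Sum>k\<in>UNIV. r k * P l k) + r i * p l * ?s r"
      by (simp add: distrib_left sum.distrib sum_distrib_left mult_ac)
    finally show ?thesis by simp
  qed
  \<comment> \<open>The difference of the prolongations at the two jets, quadratic in r and affine
    in p.\<close>
  have main: "(\<Sum>i\<in>UNIV. \<Sum>l\<in>UNIV. raised_lie (\<lambda>y. \<xi> y u) i l x * r i * r l) + 2 * ?B r p * ?s r + qform x r * ?s p = 0" for p r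
  proof -
    note pp = prolong2_poisson[OF x, where f = "\<lambda>_. 0" and f' = 0 and j = "jet2 u p r", OF DERIV_const]
      prolong2_poisson[OF x, where f = "\<lambda>_. 0" and f' = 0 and j = "jet2 u p (\<lambda>_. 0)", OF DERIV_const]
    have e1: "?e i x (jet2 u p r) = ?e i x (jet2 u p (\<lambda>_. 0))" for i
      by (rule order_leD[OF order_le_eta1 x]) (simp add: jet2_def)
    have "0 = prolong2 \<xi> (\<lambda>_ _. 0) (poisson g (\<lambda>_. 0)) x (jet2 u p r) - prolong2 \<xi> (\<lambda>_ _. 0) (poisson g (\<lambda>_. 0)) x (jet2 u p (\<lambda>_. 0))"
      by (simp add: Z)
    also have "\<dots> = (\<Sum>k\<in>UNIV. \<xi> x u $ k * (\<Sum>i\<in>UNIV. \<Sum>l\<in>UNIV. pd k (ginv g i l) x * (r i * r l)))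
      + (\<Sum>i\<in>UNIV. \<Sum>l\<in>UNIV. G i l * (eta2 \<xi> (\<lambda>_ _. 0) i l x (jet2 u p r) - eta2 \<xi> (\<lambda>_ _. 0) i l x (jet2 u p (\<lambda>_. 0))))"
      unfolding pp e1 G_def
      by (simp add: right_diff_distrib sum_subtractf sum_negf)
    also have "(\<Sum>k\<in>UNIV. \<xi> x u $ k * (\<Sum>i\<in>UNIV. \<Sum>l\<in>UNIV. pd k (ginv g i l) x * (r i * r l))) = (\<Sum>i\<in>UNIV. \<Sum>l\<in>UNIV. D i l * r i * r l)"
    proof -
      have "(\<Sum>k\<in>UNIV. \<xi> x u $ k * (\<Sum>i\<in>UNIV. \<Sum>l\<in>UNIV. pd k (ginv g i l) x * (r i * r l)))
        = (\<Sum>k\<in>UNIV. \<Sum>i\<in>UNIV. \<Sum>l\<in>UNIV. \<xi> x u $ k * pd k (ginv g i l) x * (r i * r l))"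
        by (simp add: sum_distrib_left mult.assoc)
      also have "\<dots> = (\<Sum>i\<in>UNIV. \<Sum>k\<in>UNIV. \<Sum>l\<in>UNIV. \<xi> x u $ k * pd k (ginv g i l) x * (r i * r l))" by (rule sum.swap)
      also have "\<dots> = (\<Sum>i\<in>UNIV. \<Sum>l\<in>UNIV. \<Sum>k\<in>UNIV. \<xi> x u $ k * pd k (ginv g i l) x * (r i * r l))"
        by (rule sum.cong[OF refl], rule sum.swap)
      finally show ?thesis by (simp add: D_def sum_distrib_right mult.assoc)
    qed
    also have "(\<Sum>i\<in>UNIV. \<Sum>l\<in>UNIV. G i l * (eta2 \<xi> (\<lambda>_ _. 0) i l x (jet2 u p r) - eta2 \<xi> (\<lambda>_ _. 0) i l x (jet2 u p (\<lambda>_. 0))))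
      = - (\<Sum>i\<in>UNIV. \<Sum>l\<in>UNIV. G i l * r l * (\<Sum>m\<in>UNIV. r m * P i m)) - ?B r p * ?s r - (\<Sum>i\<in>UNIV. \<Sum>l\<in>UNIV. G i l * r l * r i) * ?s p
        - (\<Sum>i\<in>UNIV. \<Sum>l\<in>UNIV. G i l * r i * (\<Sum>k\<in>UNIV. r k * P l k)) - (\<Sum>i\<in>UNIV. \<Sum>l\<in>UNIV. G i l * r i * p l) * ?s r"
      unfolding e2 sum_distrib_right[of _ _ "?s r"] sum_distrib_right[of _ _ "?s p"]
      by (simp only: right_diff_distrib sum_subtractf sum_negf mult_minus_left mult_minus_right mult.assoc)
    also have "(\<Sum>i\<in>UNIV. \<Sum>l\<in>UNIV. G i l * r i * p l) = ?B r p"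
      by (subst sum.swap) (simp add: Gs)
    also have "(\<Sum>i\<in>UNIV. \<Sum>l\<in>UNIV. G i l * r l * r i) = qform x r"
      by (simp add: qform_def G_def mult_ac)
    also have "(\<Sum>i\<in>UNIV. \<Sum>l\<in>UNIV. G i l * r l * (\<Sum>m\<in>UNIV. r m * P i m)) = (\<Sum>i\<in>UNIV. \<Sum>l\<in>UNIV. G i l * r i * (\<Sum>k\<in>UNIV. r k * P l k))"
      by (subst sum.swap) (simp add: Gs)
    finally have *: "(\<Sum>i\<in>UNIV. \<Sum>l\<in>UNIV. D i l * r i * r l) - 2 * (\<Sum>i\<in>UNIV. \<Sum>l\<in>UNIV. G i l * r i * (\<Sum>k\<in>UNIV. r k * P l k))
      - 2 * ?B r p * ?s r - qform x r * ?s p = 0" by (simp add: algebra_simps)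
    have N: "(\<Sum>i\<in>UNIV. \<Sum>l\<in>UNIV. (\<Sum>k\<in>UNIV. G i k * P k l) * r i * r l) = (\<Sum>i\<in>UNIV. \<Sum>l\<in>UNIV. G i l * r i * (\<Sum>k\<in>UNIV. r k * P l k))"
      unfolding sum_distrib_left sum_distrib_right
      by (rule sum.cong[OF refl], rule trans[OF sum.swap]) (simp add: mult_ac)
    have N': "(\<Sum>i\<in>UNIV. \<Sum>l\<in>UNIV. (\<Sum>k\<in>UNIV. G l k * P k i) * r i * r l) = (\<Sum>i\<in>UNIV. \<Sum>l\<in>UNIV. (\<Sum>k\<in>UNIV. G i k * P k l) * r i * r l)"
      by (subst sum.swap) (simp add: mult_ac)
    have "(\<Sum>i\<in>UNIV. \<Sum>l\<in>UNIV. raised_lie (\<lambda>y. \<xi> y u) i l x * r i * r l)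
      = - (\<Sum>i\<in>UNIV. \<Sum>l\<in>UNIV. D i l * r i * r l) + (\<Sum>i\<in>UNIV. \<Sum>l\<in>UNIV. (\<Sum>k\<in>UNIV. G i k * P k l) * r i * r l)
        + (\<Sum>i\<in>UNIV. \<Sum>l\<in>UNIV. (\<Sum>k\<in>UNIV. G l k * P k i) * r i * r l)"
      unfolding raised_lie_def D_def[symmetric] G_def[symmetric] P_def[symmetric]
      by (simp add: distrib_right left_diff_distrib sum.distrib sum_negf sum_subtractf)
    then show ?thesis using * unfolding N N' by simp
  qed
  have "raised_lie (\<lambda>y. \<xi> y u) i l x = 0" for i l
  proof (rule quadratic_form_zero[of "\<lambda>i l. raised_lie (\<lambda>y. \<xi> y u) i l x"])
    show "(\<Sum>i\<in>UNIV. \<Sum>l\<in>UNIV. raised_lie (\<lambda>y. \<xi> y u) i l x * r i * r l) = 0" for r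
      using main[of r "\<lambda>_. 0"] by simp
  qed (rule raised_lie_sym[OF x])
  then show "\<forall>i j. lie_metric g (\<lambda>y. \<xi> y u) i j x = 0 * g x $ i $ j"
    unfolding conformal_iff_raised[OF x] by simp
  then have r0: "raised_lie (\<lambda>y. \<xi> y u) i l x = 0" for i l
    unfolding conformal_iff_raised[OF x] by simp
  \<comment> \<open>For p = r and vanishing \<open>raised_lie\<close>, the identity is three times
    this product.\<close>
  have "qform x r * ?s r = 0" for r
  proof -
    have "?B r r = qform x r" by (simp add: qform_def G_def mult_ac)
    then show ?thesis using main[of r r] by (simp add: r0)
  qed
  then have "?s p = 0" for p by (rule qform_mult_linear_zero[OF x])
  from this[of "\<lambda>i. if i = k then 1 else 0"] show "deriv (\<lambda>t. \<xi> x t $ k) u = 0"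
    by (simp add: \<sigma>_def if_distrib[of "\<lambda>u. u * _"] cong: if_cong)
qed

lemma smooth_laplace_beltrami:
  assumes "smooth_on V h"
  shows "smooth_on V (laplace_beltrami (\<lambda>_. g) (\<lambda>_. h) c)"
  unfolding laplace_beltrami_eq[abs_def]
  by (intro smooth_on_diff smooth_on_sum smooth_on_mult open_V smooth_ginv smooth_pd smooth_christoffel_trace assms)

lemma laplace_beltrami_zero:
  assumes "\<And>x. x \<in> V \<Longrightarrow> h x = 0" "x \<in> V"
  shows "laplace_beltrami (\<lambda>_. g) (\<lambda>_. h) c x = 0"
proof -
  have p: "pd k h y = 0" if "y \<in> V" for k y
    using pd_cong[OF open_V that, of h "\<lambda>_. 0" k] assms(1) by simp
  have "pd i (pd k h) x = 0" for i k
    using pd_cong[OF open_V assms(2), of "pd k h" "\<lambda>_. 0" i] p by simp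
  then show ?thesis by (simp add: laplace_beltrami_eq p assms(2))
qed

end

section \<open>Symmetries on the manifold\<close>

lemma laplace_beltrami_chart: "laplace_beltrami g h c x = laplace_beltrami (\<lambda>_. g c) (\<lambda>_. h c) c x"
  by (simp add: laplace_beltrami_def)

lemma chart_metric_chart: "pseudo_riemannian_manifold A g \<Longrightarrow> c \<in> A \<Longrightarrow> chart_metric (coord_dom c) (g c)"
  by unfold_locales (auto simp: pseudo_riemannian_manifold_def smooth_manifold_def is_chart_def)

lemma conformal_fieldD:
  assumes "conformal_field A g \<xi> \<mu>" "c \<in> A"
  shows "smooth_on (coord_dom c) (\<xi> c)"
    "x \<in> coord_dom c \<Longrightarrow> \<forall>i j. lie_metric (g c) (\<xi> c) i j x = \<mu> c x * g c x $ i $ j"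
  using assms by (auto simp: conformal_field_def vector_field_def)

lemma lift_field_chart: "lift_field \<xi> c = (\<lambda>y _. \<xi> c y)"
  by (simp add: fun_eq_iff lift_field_def)

lemma (in chart_metric) laplace_beltrami_cmult:
  assumes h: "smooth_on V h" and x: "x \<in> V"
  shows "laplace_beltrami (\<lambda>_. g) (\<lambda>_ y. k * h y) c x = k * laplace_beltrami (\<lambda>_. g) (\<lambda>_. h) c x"
proof -
  have p: "pd i (\<lambda>y. k * h y) y = k * pd i h y" if "y \<in> V" for i y
    by (rule pd_cmult[OF diff[OF that h]])
  have "pd i (pd l (\<lambda>y. k * h y)) x = k * pd i (pd l h) x" for i l
    using pd_cong[OF open_V x, of "pd l (\<lambda>y. k * h y)" "\<lambda>y. k * pd l h y" i] p
      pd_cmult[OF diff[OF x smooth_pd[OF h]]] by simp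
  then show ?thesis
    by (simp add: laplace_beltrami_eq p[OF x] algebra_simps sum_distrib_left)
qed

lemma lie_point_symmetry_iff:
  "lie_point_symmetry A g J f \<xi> \<eta> \<longleftrightarrow> (\<forall>c\<in>A. \<forall>x\<in>coord_dom c. \<forall>j. j {#} \<in> J \<longrightarrow>
     poisson (g c) f x j = 0 \<longrightarrow> prolong2 (\<xi> c) (\<eta> c) (poisson (g c) f) x j = 0)"
  unfolding lie_point_symmetry_def jet_dom_def by fastforce

lemma variational_symmetry_iff:
  "variational_symmetry A g J f F \<xi> \<eta> \<longleftrightarrow> lie_point_symmetry A g J f \<xi> \<eta> \<and>
     (\<forall>c\<in>A. \<forall>x\<in>coord_dom c. \<forall>j. j {#} \<in> J \<longrightarrow> lagrangian_variation (g c) F (\<xi> c) (\<eta> c) x j = 0)"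
  unfolding variational_symmetry_def jet_dom_def by fastforce

lemma divergence_symmetry_with_iff:
  "divergence_symmetry_with A g J f F \<xi> \<eta> \<phi> \<longleftrightarrow> lie_point_symmetry A g J f \<xi> \<eta> \<and>
     (\<forall>c\<in>A. (\<forall>i. differential_function (coord_dom c) J (\<phi> c i)) \<and>
       (\<forall>x\<in>coord_dom c. \<forall>j. j {#} \<in> J \<longrightarrow>
          lagrangian_variation (g c) F (\<xi> c) (\<eta> c) x j = (\<Sum>i\<in>UNIV. total_deriv i (\<phi> c i) x j)))"
  unfolding divergence_symmetry_with_def jet_dom_def by fastforce

text \<open>Outside the coordinate domains and outside \<open>J\<close> the components are arbitrary
  values, which the prolongations, being local, do not see. \<open>isometry_generator\<close> fixes
  fields only inside.\<close>

lemma lie_point_symmetry_cong: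
  assumes M: "pseudo_riemannian_manifold A g" and J: "open J"
    and eq: "\<And>c x u. c \<in> A \<Longrightarrow> x \<in> coord_dom c \<Longrightarrow> u \<in> J \<Longrightarrow> \<xi> c x u = \<xi>' c x u"
      "\<And>c x u. c \<in> A \<Longrightarrow> x \<in> coord_dom c \<Longrightarrow> u \<in> J \<Longrightarrow> \<eta> c x u = \<eta>' c x u"
  shows "lie_point_symmetry A g J f \<xi> \<eta> \<longleftrightarrow> lie_point_symmetry A g J f \<xi>' \<eta>'"
    and "variational_symmetry A g J f F \<xi> \<eta> \<longleftrightarrow> variational_symmetry A g J f F \<xi>' \<eta>'"
proof -
  have o: "open (coord_dom c)" if "c \<in> A" for c
    using chart_metric_chart[OF M that] by (rule chart_metric.open_V)
  have 1: "prolong2 (\<xi> c) (\<eta> c) P x j = prolong2 (\<xi>' c) (\<eta>' c) P x j"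
    and 2: "lagrangian_variation (g c) F (\<xi> c) (\<eta> c) x j = lagrangian_variation (g c) F (\<xi>' c) (\<eta>' c) x j"
    if "c \<in> A" "x \<in> coord_dom c" "j {#} \<in> J" for c x j P
    by (rule prolong_cong(2)[OF o[OF that(1)] J] prolong_cong(3)[OF o[OF that(1)] J];
        use that eq in \<open>auto simp: jet_dom_def\<close>)+
  show l: "lie_point_symmetry A g J f \<xi> \<eta> \<longleftrightarrow> lie_point_symmetry A g J f \<xi>' \<eta>'"
    unfolding lie_point_symmetry_iff using 1 by simp
  show "variational_symmetry A g J f F \<xi> \<eta> \<longleftrightarrow> variational_symmetry A g J f F \<xi>' \<eta>'"
    unfolding variational_symmetry_iff l using 2 by simp
qed

text \<open>
  What remains of the variation of the Lagrangian after subtracting total derivatives, for the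
  symmetry with \<open>\<eta> = (2 - n)/4 \<mu> u + \<beta>\<close> and a primitive \<open>Fp\<close> of \<open>f\<close> of convenient normalization.  Its
  derivative with respect to \<open>u\<close> is the determining equation of the Lie point symmetries.
\<close>

definition noether_condition ::
  "('m, 'n::finite) chart set \<Rightarrow> ('m, 'n, real^'n^'n) local_expr \<Rightarrow> real set \<Rightarrow> (real \<Rightarrow> real) \<Rightarrow> (real \<Rightarrow> real) \<Rightarrow>
   ('m, 'n, real) local_expr \<Rightarrow> ('m, 'n, real) local_expr \<Rightarrow> bool" where
  "noether_condition A g J f Fp \<mu> \<beta> \<longleftrightarrow> (\<forall>c\<in>A. \<forall>x\<in>coord_dom c. \<forall>u\<in>J.
     (2 - real CARD('n)) / 8 * u\<^sup>2 * laplace_beltrami g \<mu> c x + u * laplace_beltrami g \<beta> c x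
     + ((2 - real CARD('n)) / 4 * \<mu> c x * u + \<beta> c x) * f u + real CARD('n) / 2 * \<mu> c x * Fp u = 0)"

text \<open>At a solution jet, -f is multiplied by a - \<mu> = - (n + 2)/4 \<mu>; differentiating
  the condition in u produces the same coefficient of \<mu> f as (2 - n)/4 + n/2.\<close>

lemma conformal_lie_point_symmetry:
  fixes A :: "('m::{t2_space,second_countable_topology}, 'n::finite) chart set"
  assumes M: "pseudo_riemannian_manifold A g" and J: "open J" and conf: "conformal_field A g \<xi> \<mu>"
    and sm: "\<And>c. c \<in> A \<Longrightarrow> smooth_on (coord_dom c) (\<mu> c)" "\<And>c. c \<in> A \<Longrightarrow> smooth_on (coord_dom c) (\<beta> c)"
    and F: "\<And>u. u \<in> J \<Longrightarrow> (Fp has_real_derivative f u) (at u)" and f: "\<And>u. u \<in> J \<Longrightarrow> (f has_real_derivative f' u) (at u)"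
    and cond: "noether_condition A g J f Fp \<mu> \<beta>"
  shows "lie_point_symmetry A g J f (lift_field \<xi>) (\<lambda>c x u. (2 - real CARD('n)) / 4 * \<mu> c x * u + \<beta> c x)"
  unfolding lie_point_symmetry_iff
proof (intro ballI allI impI)
  let ?n = "real CARD('n)"
  fix c x and j :: "'n jet"
  assume c: "c \<in> A" and x: "x \<in> coord_dom c" and u: "j {#} \<in> J" and p0: "poisson (g c) f x j = 0"
  interpret chart_metric "coord_dom c" "g c" by (rule chart_metric_chart[OF M c])
  let ?L = "laplace_beltrami g \<mu> c x" and ?B = "laplace_beltrami g \<beta> c x" and ?u = "j {#}"
  let ?K = "\<lambda>u. (2 - ?n) / 8 * u\<^sup>2 * ?L + u * ?B + ((2 - ?n) / 4 * \<mu> c x * u + \<beta> c x) * f u + ?n / 2 * \<mu> c x * Fp u"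
  have "(?K has_real_derivative (2 - ?n) / 4 * ?u * ?L + ?B + ((2 - ?n) / 4 * \<mu> c x * f ?u
      + ((2 - ?n) / 4 * \<mu> c x * ?u + \<beta> c x) * f' ?u) + ?n / 2 * \<mu> c x * f ?u) (at ?u)"
    by (rule derivative_eq_intros F[OF u] f[OF u] refl)+ (simp add: field_simps)
  moreover have "(?K has_real_derivative 0) (at ?u)"
    by (rule has_field_derivative_transform_within_open[OF DERIV_const[of 0] J u])
      (use cond c x in \<open>simp add: noether_condition_def\<close>)
  ultimately have K: "(2 - ?n) / 4 * ?u * ?L + ?B + ((2 - ?n) / 4 * \<mu> c x * f ?u
      + ((2 - ?n) / 4 * \<mu> c x * ?u + \<beta> c x) * f' ?u) + ?n / 2 * \<mu> c x * f ?u = 0"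
    by (rule DERIV_unique)
  have sa: "smooth_on (coord_dom c) (\<lambda>y. (2 - ?n) / 4 * \<mu> c y)"
    by (intro smooth_on_mult smooth_on_const open_V sm c)
  have "prolong2 (\<lambda>y _. \<xi> c y) (\<lambda>y u. (2 - ?n) / 4 * \<mu> c y * u + \<beta> c y) (poisson (g c) f) x j
    = ((2 - ?n) / 4 * \<mu> c x - \<mu> c x) * (poisson (g c) f x j - f ?u)
      + ?u * laplace_beltrami (\<lambda>_. g c) (\<lambda>_ y. (2 - ?n) / 4 * \<mu> c y) c x
      + laplace_beltrami (\<lambda>_. g c) (\<lambda>_. \<beta> c) c x + ((2 - ?n) / 4 * \<mu> c x * ?u + \<beta> c x) * f' ?u"
    by (rule prolong2_poisson_conformal[OF x, where f = f and f' = "f' (j {#})" and j = j, OF f[OF u] conformal_fieldD(1)[OF conf c] sm(1)[OF c] sa sm(2)[OF c] conformal_fieldD(2)[OF conf c]])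
      (assumption | rule pd_cmult[OF diff[OF x sm(1)[OF c]]])+
  also have "\<dots> = 0"
    using K unfolding laplace_beltrami_cmult[OF sm(1)[OF c] x] laplace_beltrami_chart[of g _ c] p0
    by (simp add: field_simps)
  finally show "prolong2 (lift_field \<xi> c) (\<lambda>x u. (2 - ?n) / 4 * \<mu> c x * u + \<beta> c x) (poisson (g c) f) x j = 0"
    by (simp add: lift_field_chart)
qed

text \<open>\<open>F\<close> is prescribed, while the condition is checked for a normalized
  primitive \<open>Fp\<close>; their difference is absorbed by the divergence.\<close>

lemma conformal_divergence_symmetry:
  fixes A :: "('m::{t2_space,second_countable_topology}, 'n::finite) chart set"
  assumes M: "pseudo_riemannian_manifold A g" and J: "open J" and conf: "conformal_field A g \<xi> \<mu>"
    and sm: "\<And>c. c \<in> A \<Longrightarrow> smooth_on (coord_dom c) (\<mu> c)" "\<And>c. c \<in> A \<Longrightarrow> smooth_on (coord_dom c) (\<beta> c)"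
    and F: "primitive_on J f F" and Fp: "\<And>u. u \<in> J \<Longrightarrow> (Fp has_real_derivative f u) (at u)"
    and f: "\<And>u. u \<in> J \<Longrightarrow> (f has_real_derivative f' u) (at u)"
    and cond: "noether_condition A g J f Fp \<mu> \<beta>"
  shows "divergence_symmetry A g J f F (lift_field \<xi>) (\<lambda>c x u. (2 - real CARD('n)) / 4 * \<mu> c x * u + \<beta> c x)"
proof -
  let ?n = "real CARD('n)"
  let ?a = "\<lambda>c y. (2 - ?n) / 4 * \<mu> c y"
  \<comment> \<open>\<open>J\<close> may be disconnected, so the difference is kept as a function
    with zero derivative rather than as a constant.\<close>
  define C where "C u = F u - Fp u" for u
  have C: "(C has_real_derivative 0) (at u)" if "u \<in> J" for u
    using DERIV_diff[OF _ Fp[OF that]] F that unfolding C_def primitive_on_def by fastforce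
  define \<phi> where "\<phi> c i x j = chart_metric.vol (g c) x * (\<Sum>l\<in>UNIV. ginv (g c) i l x * pd l (?a c) x) * (1/2 * (j {#})\<^sup>2)
      + chart_metric.vol (g c) x * (\<Sum>l\<in>UNIV. ginv (g c) i l x * pd l (\<beta> c) x) * j {#}
      - chart_metric.vol (g c) x * \<xi> c x $ i * C (j {#})" for c i x and j :: "'n jet"
  have "divergence_symmetry_with A g J f F (lift_field \<xi>) (\<lambda>c x u. ?a c x * u + \<beta> c x) \<phi>"
    unfolding divergence_symmetry_with_iff
  proof (intro conjI ballI allI impI)
    show "lie_point_symmetry A g J f (lift_field \<xi>) (\<lambda>c x u. ?a c x * u + \<beta> c x)"
      by (rule conformal_lie_point_symmetry[OF M J conf sm Fp f cond])
  next
    fix c i assume c: "c \<in> A"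
    interpret chart_metric "coord_dom c" "g c" by (rule chart_metric_chart[OF M c])
    have sa: "smooth_on (coord_dom c) (?a c)"
      by (intro smooth_on_mult smooth_on_const open_V sm c)
    have s\<xi>: "smooth_on (coord_dom c) (\<lambda>x. \<xi> c x $ i)"
      by (rule smooth_on_vec_nth[OF open_V conformal_fieldD(1)[OF conf c]])
    have sC: "smooth_jet (coord_dom c) J (\<lambda>x j. C (j {#}))"
      using smooth_jet_fun_u[OF open_V J, of "\<lambda>m. if m = 0 then C else (\<lambda>_. 0)" 0] C by simp
    have sg: "smooth_jet (coord_dom c) J (\<lambda>x j. vol x * (\<Sum>l\<in>UNIV. ginv (g c) i l x * pd l h x))"
      if "smooth_on (coord_dom c) h" for h
      by (rule smooth_on_imp_smooth_jet[OF open_V J])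
        (intro smooth_on_mult smooth_on_sum smooth_vol smooth_ginv smooth_pd open_V that)
    have s\<xi>': "smooth_jet (coord_dom c) J (\<lambda>x j. vol x * \<xi> c x $ i)"
      by (rule smooth_on_imp_smooth_jet[OF open_V J]) (intro smooth_on_mult smooth_vol open_V s\<xi>)
    have "smooth_jet (coord_dom c) J (\<lambda>x j. vol x * (\<Sum>l\<in>UNIV. ginv (g c) i l x * pd l (?a c) x) * (1/2 * (j {#} * j {#}))
      + vol x * (\<Sum>l\<in>UNIV. ginv (g c) i l x * pd l (\<beta> c) x) * j {#} + - (vol x * \<xi> c x $ i * C (j {#})))"
      by (intro smooth_jet_add smooth_jet_uminus smooth_jet_mult smooth_jet_const smooth_jet_coordinate open_V J sC s\<xi>' sg sa sm c)
    then have "smooth_jet (coord_dom c) J (\<phi> c i)"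
      by (simp add: \<phi>_def[abs_def] power2_eq_square)
    moreover have "\<exists>r. \<forall>x\<in>coord_dom c. \<forall>j j'. j {#} \<in> J \<longrightarrow> (\<forall>I. size I \<le> r \<longrightarrow> j I = j' I) \<longrightarrow> \<phi> c i x j = \<phi> c i x j'"
      by (rule exI[of _ 0]) (simp add: \<phi>_def)
    ultimately show "differential_function (coord_dom c) J (\<phi> c i)"
      by (simp add: differential_function_def smooth_jet_def)
  next
    fix c x and j :: "'n jet"
    assume c: "c \<in> A" and x: "x \<in> coord_dom c" and u: "j {#} \<in> J"
    interpret chart_metric "coord_dom c" "g c" by (rule chart_metric_chart[OF M c])
    have sa: "smooth_on (coord_dom c) (?a c)"
      by (intro smooth_on_mult smooth_on_const open_V sm c)
    have Fd: "(F has_real_derivative f (j {#})) (at (j {#}))" using F u by (simp add: primitive_on_def)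
    have "lagrangian_variation (g c) F (\<lambda>y _. \<xi> c y) (\<lambda>y u. ?a c y * u + \<beta> c y) x j = (\<Sum>i\<in>UNIV. total_deriv i (\<phi> c i) x j)"
      unfolding \<phi>_def[abs_def]
    proof (rule lagrangian_variation_divergence[where J = J and m = "\<mu> c x" and c = c])
      show "1/2 * (j {#})\<^sup>2 * laplace_beltrami (\<lambda>_. g c) (\<lambda>_. ?a c) c x + j {#} * laplace_beltrami (\<lambda>_. g c) (\<lambda>_. \<beta> c) c x
          + (?a c x * j {#} + \<beta> c x) * f (j {#}) + ?n * \<mu> c x / 2 * (F (j {#}) - C (j {#})) = 0"
      proof -
        have "(2 - ?n) / 8 * (j {#})\<^sup>2 * laplace_beltrami g \<mu> c x + j {#} * laplace_beltrami g \<beta> c x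
          + (?a c x * j {#} + \<beta> c x) * f (j {#}) + ?n / 2 * \<mu> c x * Fp (j {#}) = 0"
          using cond c x u by (simp add: noether_condition_def)
        then show ?thesis
          unfolding laplace_beltrami_cmult[OF sm(1)[OF c] x] laplace_beltrami_chart[of g _ c]
          by (simp add: C_def mult_ac)
      qed
      show "\<forall>i j. lie_metric (g c) (\<xi> c) i j x = \<mu> c x * g c x $ i $ j"
        by (rule conformal_fieldD(2)[OF conf c x])
    qed (use J x u Fd C sa sm c conformal_fieldD(1)[OF conf c] in auto)
    then show "lagrangian_variation (g c) F (lift_field \<xi> c) (\<lambda>x u. ?a c x * u + \<beta> c x) x j
        = (\<Sum>i\<in>UNIV. total_deriv i (\<phi> c i) x j)"
      by (simp add: lift_field_chart)
  qed
  then show ?thesis unfolding divergence_symmetry_def by blast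
qed

text \<open>For a constant conformal factor the gradient terms vanish. What remains is the order
  zero condition, imposed on \<open>F\<close> itself because no divergence is at hand to absorb an
  additive constant.\<close>

lemma homothety_variational_symmetry:
  fixes A :: "('m::{t2_space,second_countable_topology}, 'n::finite) chart set"
  assumes M: "pseudo_riemannian_manifold A g" and J: "open J" and conf: "conformal_field A g \<xi> (\<lambda>_ _. m)"
    and F: "primitive_on J f F" and f: "\<And>u. u \<in> J \<Longrightarrow> (f has_real_derivative f' u) (at u)"
    and cond: "\<And>u. u \<in> J \<Longrightarrow> (2 - real CARD('n)) / 4 * m * u * f u + real CARD('n) / 2 * m * F u = 0"
  shows "variational_symmetry A g J f F (lift_field \<xi>) (\<lambda>c x u. (2 - real CARD('n)) / 4 * m * u)"
  unfolding variational_symmetry_iff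
proof (intro conjI ballI allI impI)
  let ?n = "real CARD('n)"
  have lb: "laplace_beltrami g (\<lambda>_ _. k) c x = 0" for k c x
  proof -
    have "pd i (\<lambda>_. k) = (\<lambda>_. 0)" for i :: 'n by (simp add: fun_eq_iff)
    then show ?thesis by (simp add: laplace_beltrami_def hessian_def)
  qed
  have "lie_point_symmetry A g J f (lift_field \<xi>) (\<lambda>c x u. (2 - ?n) / 4 * m * u + 0)"
    by (rule conformal_lie_point_symmetry[OF M J conf])
      (use F f cond in \<open>auto simp: smooth_on_const primitive_on_def noether_condition_def lb mult_ac\<close>)
  then show "lie_point_symmetry A g J f (lift_field \<xi>) (\<lambda>c x u. (2 - ?n) / 4 * m * u)" by simp
  fix c x and j :: "'n jet"
  assume c: "c \<in> A" and x: "x \<in> coord_dom c" and u: "j {#} \<in> J"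
  interpret chart_metric "coord_dom c" "g c" by (rule chart_metric_chart[OF M c])
  have Fd: "(F has_real_derivative f (j {#})) (at (j {#}))" using F u by (simp add: primitive_on_def)
  have "lagrangian_variation (g c) F (\<lambda>y _. \<xi> c y) (\<lambda>y u. (\<lambda>_. (2 - ?n) / 4 * m) y * u + (\<lambda>_. 0) y) x j = 0"
    unfolding lagrangian_variation_conformal[OF x, where f = f and F = F and j = j, OF Fd smooth_on_const smooth_on_const conformal_fieldD(2)[OF conf c x]]
    using cond[OF u] by (simp add: field_simps)
  then show "lagrangian_variation (g c) F (lift_field \<xi> c) (\<lambda>x u. (2 - ?n) / 4 * m * u) x j = 0"
    by (simp add: lift_field_chart)
qed

lemma isometry_variational_symmetry:
  fixes A :: "('m::{t2_space,second_countable_topology}, 'n::finite) chart set"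
  assumes M: "pseudo_riemannian_manifold A g" and J: "open J" and iso: "isometry_generator A g J \<xi> \<eta>"
    and F: "primitive_on J f F" and f: "\<And>u. u \<in> J \<Longrightarrow> (f has_real_derivative f' u) (at u)"
  shows "variational_symmetry A g J f F \<xi> \<eta>"
proof -
  obtain \<zeta> where \<zeta>: "conformal_field A g \<zeta> (\<lambda>_ _. 0)"
    and eq: "\<And>c x u. c \<in> A \<Longrightarrow> x \<in> coord_dom c \<Longrightarrow> u \<in> J \<Longrightarrow> \<xi> c x u = lift_field \<zeta> c x u \<and> \<eta> c x u = 0"
    using iso unfolding isometry_generator_def by blast
  have "variational_symmetry A g J f F (lift_field \<zeta>) (\<lambda>c x u. (2 - real CARD('n)) / 4 * 0 * u)"
    by (rule homothety_variational_symmetry[OF M J \<zeta> F f]) auto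
  then show ?thesis
    using lie_point_symmetry_cong(2)[OF M J, of \<xi> "lift_field \<zeta>" \<eta> "\<lambda>c x u. (2 - real CARD('n)) / 4 * 0 * u" f F] eq by auto
qed

section \<open>Necessary conditions for symmetries\<close>

lemma manifold_point:
  assumes "pseudo_riemannian_manifold A g"
  obtains c x where "c \<in> A" "x \<in> coord_dom c"
  using assms by (auto simp: pseudo_riemannian_manifold_def smooth_manifold_def carrier_def coord_dom_def)

lemma differential_function_zero: "open V \<Longrightarrow> differential_function V UNIV (\<lambda>_ _. 0)"
  by (auto simp: differential_function_def intro: jet_Ck_const)

lemma total_deriv_zero [simp]: "total_deriv i (\<lambda>_ _. 0) x j = 0"
  by (simp add: total_deriv_def pd_x_def pd_u_def)

text \<open>\<open>c0\<close> is the coefficient left over in the quadratic part. A variational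
  symmetry is treated as a divergence symmetry with tuple zero, and one chart decides, since
  \<open>c0\<close> is a global constant.\<close>

lemma noether_symmetry_no_scaling:
  fixes A :: "('m::{t2_space,second_countable_topology}, 'n::finite) chart set"
  assumes M: "pseudo_riemannian_manifold A g" and conf: "conformal_field A g \<xi> \<mu>"
    and sm: "\<And>c. c \<in> A \<Longrightarrow> smooth_on (coord_dom c) (a c)" "\<And>c. c \<in> A \<Longrightarrow> smooth_on (coord_dom c) (\<beta> c)"
    and a: "\<And>c x. c \<in> A \<Longrightarrow> x \<in> coord_dom c \<Longrightarrow> a c x = (2 - real CARD('n)) / 4 * \<mu> c x + c0"
    and F: "primitive_on UNIV f F"
    and N: "noether_symmetry A g UNIV f F (lift_field \<xi>) (\<lambda>c x u. a c x * u + \<beta> c x)"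
  shows "c0 = 0"
proof -
  obtain c x where c: "c \<in> A" and x: "x \<in> coord_dom c" using manifold_point[OF M] .
  interpret chart_metric "coord_dom c" "g c" by (rule chart_metric_chart[OF M c])
  let ?L = "lagrangian_variation (g c) F (\<lambda>y _. \<xi> c y) (\<lambda>y u. a c y * u + \<beta> c y)"
  obtain \<phi> where \<phi>: "\<And>i. differential_function (coord_dom c) UNIV (\<phi> i)"
    and div: "\<And>x j. x \<in> coord_dom c \<Longrightarrow> ?L x j = (\<Sum>i\<in>UNIV. total_deriv i (\<phi> i) x j)"
    using N unfolding noether_symmetry_def
  proof
    assume "variational_symmetry A g UNIV f F (lift_field \<xi>) (\<lambda>c x u. a c x * u + \<beta> c x)"
    then have "\<And>x j. x \<in> coord_dom c \<Longrightarrow> ?L x j = (\<Sum>i\<in>UNIV. total_deriv i (\<lambda>_ _. 0) x j)"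
      using c by (simp add: variational_symmetry_iff lift_field_chart)
    then show thesis using that[OF differential_function_zero[OF open_V]] by blast
  next
    assume "divergence_symmetry A g UNIV f F (lift_field \<xi>) (\<lambda>c x u. a c x * u + \<beta> c x)"
    then obtain \<phi> where "divergence_symmetry_with A g UNIV f F (lift_field \<xi>) (\<lambda>c x u. a c x * u + \<beta> c x) \<phi>"
      unfolding divergence_symmetry_def by blast
    then show thesis using c
      by (intro that[of "\<phi> c"]) (simp_all add: divergence_symmetry_with_iff lift_field_chart)
  qed
  show ?thesis
  proof (rule divergence_imp_no_quadratic_part[OF x \<phi> _ div])
    fix x and j :: "'n jet" assume x: "x \<in> coord_dom c"
    have Fd: "(F has_real_derivative f (j {#})) (at (j {#}))" using F by (simp add: primitive_on_def)
    show "?L x j = vol x * (c0 * qform x (\<lambda>i. j {#i#})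
      + (\<Sum>i\<in>UNIV. \<Sum>l\<in>UNIV. ginv (g c) i l x * j {#l#} * (\<lambda>i x u. pd i (a c) x * u + pd i (\<beta> c) x) i x (j {#}))
      + (\<lambda>x u. - F u * (real CARD('n) * \<mu> c x / 2) - f u * (a c x * u + \<beta> c x)) x (j {#}))"
      unfolding lagrangian_variation_conformal[OF x, where f = f and F = F and j = j, OF Fd sm(1)[OF c] sm(2)[OF c] conformal_fieldD(2)[OF conf c x]]
      by (simp add: a[OF c x])
  qed
qed

text \<open>A zero value of \<open>deriv\<close> alone says nothing about differentiability; joint
  smoothness supplies it, and u ranges over a connected line.\<close>

lemma field_constant_in_u:
  assumes vf: "vector_field_prod A UNIV \<xi> \<eta>" and c: "c \<in> A" and x: "x \<in> coord_dom c"
    and d: "\<And>u k. deriv (\<lambda>t. \<xi> c x t $ k) u = 0"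
  shows "\<xi> c x u = \<xi> c x v"
proof -
  have s: "smooth_on (coord_dom c \<times> UNIV) (\<lambda>(x, u). \<xi> c x u)"
    using vf c by (simp add: vector_field_prod_def)
  have "\<xi> c x u $ k = \<xi> c x v $ k" for k
  proof (rule DERIV_isconst_all[of "\<lambda>t. \<xi> c x t $ k"], rule allI)
    fix t
    have "(\<lambda>(x, u). \<xi> c x u) differentiable (at (x, t))"
      by (rule smooth_on_differentiable[OF s]) (simp add: x)
    then obtain D where "((\<lambda>(x, u). \<xi> c x u) has_derivative D) (at (x, t))" by (auto simp: differentiable_def)
    moreover have "((\<lambda>t. (x, t)) has_derivative (\<lambda>t. (0, t))) (at t)"
      by (auto intro!: derivative_eq_intros)
    ultimately have "((\<lambda>t. (\<lambda>(x, u). \<xi> c x u) (x, t)) has_derivative (\<lambda>t. D (0, t))) (at t)"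
      by (rule has_derivative_compose[rotated])
    then have "((\<lambda>t. \<xi> c x t $ k) has_derivative (\<lambda>t. D (0, t) $ k)) (at t)"
      by (auto intro: bounded_linear.has_derivative[OF bounded_linear_vec_nth])
    then have "(\<lambda>t. \<xi> c x t $ k) differentiable (at t)" by (auto simp: differentiable_def)
    then show "((\<lambda>t. \<xi> c x t $ k) has_real_derivative 0) (at t)"
      using d[of k t] by (metis DERIV_deriv_iff_real_differentiable)
  qed
  then show ?thesis by (simp add: vec_eq_iff)
qed

text \<open>Since \<xi> does not depend on u, its slice at u = 0 serves as the field on the manifold
  and inherits the transformation law.\<close>

lemma isometry_generatorI:
  assumes M: "pseudo_riemannian_manifold A g" and vf: "vector_field_prod A UNIV \<xi> \<eta>"
    and d: "\<And>c x u k. c \<in> A \<Longrightarrow> x \<in> coord_dom c \<Longrightarrow> deriv (\<lambda>t. \<xi> c x t $ k) u = 0"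
    and lie: "\<And>c x. c \<in> A \<Longrightarrow> x \<in> coord_dom c \<Longrightarrow> \<forall>i j. lie_metric (g c) (\<lambda>y. \<xi> c y 0) i j x = 0"
    and \<eta>: "\<And>c x u. c \<in> A \<Longrightarrow> x \<in> coord_dom c \<Longrightarrow> \<eta> c x u = 0"
  shows "isometry_generator A g UNIV \<xi> \<eta>"
  unfolding isometry_generator_def
proof (intro exI conjI ballI)
  have o: "open (coord_dom c)" if "c \<in> A" for c
    using chart_metric_chart[OF M that] by (rule chart_metric.open_V)
  have s: "smooth_on (coord_dom c \<times> UNIV) (\<lambda>(x, u). \<xi> c x u)" if "c \<in> A" for c
    using vf that by (simp add: vector_field_prod_def)
  have "smooth_on (coord_dom c) (\<lambda>x. \<xi> c x 0)" if "c \<in> A" for c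
    using smooth_on_slice[OF o[OF that] open_UNIV UNIV_I s[OF that], of 0] by simp
  then show "conformal_field A g (\<lambda>c x. \<xi> c x 0) (\<lambda>_ _. 0)"
    using vf lie by (auto simp: conformal_field_def vector_field_def vector_field_prod_def)
  fix c x u assume c: "c \<in> A" and x: "x \<in> coord_dom c"
  show "\<eta> c x u = 0" by (rule \<eta>[OF c x])
  show "\<xi> c x u = lift_field (\<lambda>c x. \<xi> c x 0) c x u"
    using field_constant_in_u[OF vf c x d[OF c x]] by (simp add: lift_field_def)
qed

text \<open>The factor c makes the induction go through: the derivative in direction v has the same
  shape with v c.\<close>

lemma smooth_on_exp: "smooth_on UNIV (exp :: real \<Rightarrow> real)"
proof -
  have "Ck_on k UNIV (\<lambda>x :: real. exp x * c)" for k c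
  proof (induction k arbitrary: c)
    case (Suc k)
    have d: "((\<lambda>x. exp x * c) has_derivative (\<lambda>v. exp x * (v * c))) (at x)" for x :: real
      by (auto intro!: derivative_eq_intros)
    have "(\<lambda>x. frechet_derivative (\<lambda>x. exp x * c) (at x) v) = (\<lambda>x. exp x * (v * c))" for v
      using frechet_derivative_at[OF d] by (auto simp: fun_eq_iff dest: fun_cong)
    then show ?case using Suc d by (auto simp: differentiable_def)
  qed (auto intro!: continuous_intros)
  from this[of _ 1] show ?thesis by (simp add: smooth_on_def)
qed

lemma smooth_on_affine: "smooth_on UNIV (\<lambda>t :: real. c + m * t)"
proof -
  have "Ck_on k UNIV (\<lambda>t :: real. t)" for k
    by (cases k) (auto simp: Ck_on_const frechet_derivative_ident)
  then show ?thesis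
    by (intro smooth_on_add smooth_on_mult smooth_on_const) (auto simp: smooth_on_def)
qed

text \<open>Affine f suffice: varying the slope gives \<eta> = 0, and constant f, with \<eta>
  replaced by zero, then give the Killing equation.\<close>

lemma lie_symmetry_all_imp_isometry:
  assumes M: "pseudo_riemannian_manifold A g" and vf: "vector_field_prod A UNIV \<xi> \<eta>"
    and lps: "\<And>f. smooth_on UNIV f \<Longrightarrow> lie_point_symmetry A g UNIV f \<xi> \<eta>"
  shows "isometry_generator A g UNIV \<xi> \<eta>"
proof -
  have s: "prolong2 (\<xi> c) (\<eta> c) (poisson (g c) (\<lambda>t. k + m * t)) x j = 0"
    if "c \<in> A" "x \<in> coord_dom c" "poisson (g c) (\<lambda>t. k + m * t) x j = 0" for c x j k m
    using lps[OF smooth_on_affine[of k m]] that unfolding lie_point_symmetry_iff by blast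
  have \<eta>: "\<eta> c x u = 0" if "c \<in> A" "x \<in> coord_dom c" for c x u
    by (rule chart_metric.lie_symmetry_all_equations_eta[OF chart_metric_chart[OF M that(1)] that(2) s[OF that]])
  have s0: "prolong2 (\<xi> c) (\<lambda>_ _. 0) (poisson (g c) (\<lambda>_. k)) x j = 0"
    if "c \<in> A" "x \<in> coord_dom c" "poisson (g c) (\<lambda>_. k) x j = 0" for c x j k
  proof -
    have "prolong2 (\<xi> c) (\<lambda>_ _. 0) (poisson (g c) (\<lambda>_. k)) x j = prolong2 (\<xi> c) (\<eta> c) (poisson (g c) (\<lambda>_. k)) x j"
      by (rule prolong_cong(2)[OF chart_metric.open_V[OF chart_metric_chart[OF M that(1)]] open_UNIV])
        (use that \<eta> in auto)
    then show ?thesis using s[OF that(1,2), of k 0] that(3) by simp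
  qed
  note iso = chart_metric.lie_symmetry_all_equations[OF chart_metric_chart[OF M] _ s0]
  show ?thesis
  proof (rule isometry_generatorI[OF M vf])
    fix c x u k assume c: "c \<in> A" and x: "x \<in> coord_dom c"
    show "deriv (\<lambda>t. \<xi> c x t $ k) u = 0" by (rule iso(2)[OF c x c])
    show "\<forall>i j. lie_metric (g c) (\<lambda>y. \<xi> c y 0) i j x = 0" using iso(1)[OF c x c] by simp
  qed (rule \<eta>)
qed

text \<open>A primitive of exp is exp + C. The order zero condition determines \<eta> from d = div
  \<xi>, and the trace of the conformal equation becomes (2 - n) d = 2 n d C exp(-u) for all u. This
  forces d C = 0, and then d = 0 as n differs from 2.\<close>

lemma exp_variational_imp_isometry:
  fixes A :: "('m::{t2_space,second_countable_topology}, 'n::finite) chart set"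
  assumes M: "pseudo_riemannian_manifold A g" and n: "CARD('n) \<noteq> 2" and vf: "vector_field_prod A UNIV \<xi> \<eta>"
    and F: "primitive_on UNIV exp F" and var: "variational_symmetry A g UNIV exp F \<xi> \<eta>"
  shows "isometry_generator A g UNIV \<xi> \<eta>"
proof -
  let ?n = "real CARD('n)"
  have Fd: "(F has_real_derivative exp u) (at u)" for u using F by (simp add: primitive_on_def)
  have "\<forall>u. ((\<lambda>u. F u - exp u) has_real_derivative 0) (at u)"
    using DERIV_diff[OF Fd DERIV_exp] by simp
  then obtain C where C: "\<And>u. F u = exp u + C"
    using DERIV_isconst_all[of "\<lambda>u. F u - exp u" _ 0] by (metis add_diff_cancel_left' diff_add_cancel add.commute)
  have z: "lagrangian_variation (g c) F (\<xi> c) (\<eta> c) x j = 0" if "c \<in> A" "x \<in> coord_dom c" for c x j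
    using var that unfolding variational_symmetry_iff by blast
  have \<sigma>: "deriv (\<lambda>t. \<xi> c x t $ k) u = 0" if "c \<in> A" "x \<in> coord_dom c" for c x k u
    by (rule chart_metric.lagrangian_variation_zero(1)[OF chart_metric_chart[OF M that(1)] that(2) Fd z[OF that]])
  have *: "\<eta> c x u = 0" "\<forall>i j. lie_metric (g c) (\<lambda>y. \<xi> c y u) i j x = 0"
    if c: "c \<in> A" and x: "x \<in> coord_dom c" for c x u
  proof -
    interpret chart_metric "coord_dom c" "g c" by (rule chart_metric_chart[OF M c])
    define d where "d = divergence (\<lambda>y. \<xi> c y 0) x"
    have cst: "\<xi> c y u = \<xi> c y 0" if "y \<in> coord_dom c" for y u
      by (rule field_constant_in_u[OF vf c that \<sigma>[OF c that]])
    have dv: "divergence (\<lambda>y. \<xi> c y u) x = d" for u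
    proof -
      have "pd k (\<lambda>y. \<xi> c y u $ k) x = pd k (\<lambda>y. \<xi> c y 0 $ k) x" for k
        by (rule pd_cong[OF open_V x]) (simp add: cst[where u = u])
      then show ?thesis by (simp add: divergence_def d_def cst[OF x, of u])
    qed
    note lz = lagrangian_variation_zero[where F = F and f = exp, OF x Fd z[OF c x]]
    \<comment> \<open>The order zero condition (exp t + C) d + exp t \<eta> = 0, solved for
      \<eta>.\<close>
    have \<eta>: "\<eta> c x = (\<lambda>t. - d * (1 + C * exp (- t)))"
    proof
      fix t
      have "(exp t + C) * d + exp t * \<eta> c x t = 0" using lz(3)[of t] by (simp add: dv C)
      then have "exp (- t) * ((exp t + C) * d + exp t * \<eta> c x t) = 0" by simp
      moreover have "exp (- t) * exp t = 1" by (simp add: exp_minus)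
      ultimately show "\<eta> c x t = - d * (1 + C * exp (- t))" by algebra
    qed
    have \<eta>': "deriv (\<eta> c x) t = d * C * exp (- t)" for t
      unfolding \<eta> by (rule DERIV_imp_deriv) (auto intro!: derivative_eq_intros)
    have "\<forall>i j. lie_metric (g c) (\<lambda>y. \<xi> c y t) i j x = (d + 2 * (d * C * exp (- t))) * g c x $ i $ j" for t
      using lz(2)[of t] unfolding dv \<eta>' .
    from conformal_divergence[OF x this] have e: "(2 - ?n) * d = 2 * ?n * (d * C * exp (- t))" for t
      by (simp add: dv algebra_simps)
    \<comment> \<open>The left side of the relation does not depend on t; comparing t = 0 with t = 1
      removes it.\<close>
    have "2 * ?n * (d * C) * (1 - exp (- 1)) = 0" using e[of 0] e[of 1] by (simp add: algebra_simps)
    then have "d * C = 0" by simp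
    then have "d = 0" using e[of 0] n by auto
    then show "\<eta> c x u = 0" "\<forall>i j. lie_metric (g c) (\<lambda>y. \<xi> c y u) i j x = 0"
      using lz(2)[of u] unfolding dv \<eta>' by (simp_all add: \<eta>)
  qed
  show ?thesis
    by (rule isometry_generatorI[OF M vf \<sigma> *(2) *(1)])
qed

text \<open>The homogeneity relation u f' = p f is free of division, so it covers u = 0 and both
  readings of the power.\<close>

lemma power_function_on_deriv:
  assumes J: "power_function_on J p f" and u: "u \<in> J"
  shows "(f has_real_derivative deriv f u) (at u)" "u * deriv f u = p * f u"
proof -
  have "\<exists>d. (f has_real_derivative d) (at u) \<and> u * d = p * f u"
  proof (cases "J \<subseteq> {0<..} \<and> (\<forall>u\<in>J. f u = u powr p)")
    case True
    then have pos: "u > 0" using u by auto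
    have "(f has_real_derivative p * u powr (p - 1)) (at u)"
      by (rule has_field_derivative_transform_within_open[OF has_real_derivative_powr[OF pos] _ u])
        (use True J in \<open>auto simp: power_function_on_def\<close>)
    moreover have "u * (p * u powr (p - 1)) = p * f u"
      using True u pos by (simp add: powr_diff)
    ultimately show ?thesis by blast
  next
    case False
    then obtain k :: int where k: "p = of_int k" "k \<ge> 0 \<or> 0 \<notin> J" "\<forall>u\<in>J. f u = u powi k"
      using J by (auto simp: power_function_on_def)
    have "((\<lambda>u. u powi k) has_real_derivative of_int k * u powi (k - 1) * 1) (at u)"
      by (rule DERIV_power_int[OF DERIV_ident]) (use k u in auto)
    then have "(f has_real_derivative of_int k * u powi (k - 1) * 1) (at u)"
      by (rule has_field_derivative_transform_within_open[OF _ _ u]) (use k J in \<open>auto simp: power_function_on_def\<close>)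
    moreover have "u * (of_int k * u powi (k - 1) * 1) = p * f u"
    proof (cases "u = 0")
      \<comment> \<open>At u = 0 the exponent is nonnegative: for k = 0 the factor p vanishes, for k
        > 0 the value of f.\<close>
      case True
      then show ?thesis using k u by (cases "k = 0") (auto simp: power_int_0_left_if)
    next
      case False
      then show ?thesis using k u by (simp add: power_int_diff)
    qed
    ultimately show ?thesis by blast
  qed
  then show "(f has_real_derivative deriv f u) (at u)" "u * deriv f u = p * f u"
    using DERIV_imp_deriv by blast+
qed

lemma power_function_on_2:
  assumes "power_function_on J 2 f" "u \<in> J"
  shows "f u = u\<^sup>2"
proof -
  have "k = 2" if "(2::real) = of_int k" for k :: int using that by linarith
  then show ?thesis using assms by (auto simp: power_function_on_def subset_iff powr_numeral)
qed

text \<open>At a fixed u, the jet with zero gradient shows that the part of order zero vanishes;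
  subtracting it isolates the coefficient of the quadratic form, which is nonzero for some
  gradient.\<close>

lemma power_variational_exponent:
  fixes A :: "('m::{t2_space,second_countable_topology}, 'n::finite) chart set"
  assumes M: "pseudo_riemannian_manifold A g" and conf: "conformal_field A g \<xi> (\<lambda>_ _. \<mu>)"
    and u: "u \<in> J" and F: "(F has_real_derivative f u) (at u)"
    and var: "variational_symmetry A g J f F (lift_field \<xi>) (\<lambda>c x u. a * u)"
  shows "a = (2 - real CARD('n)) / 4 * \<mu>"
proof -
  obtain c x where c: "c \<in> A" and x: "x \<in> coord_dom c" using manifold_point[OF M] .
  interpret chart_metric "coord_dom c" "g c" by (rule chart_metric_chart[OF M c])
  obtain p where p: "qform x p \<noteq> 0" using qform_nonzero[OF x] .
  have *: "(a - (2 - real CARD('n)) / 4 * \<mu>) * qform x q - F u * (real CARD('n) * \<mu> / 2) - f u * (a * u) = 0" for q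
  proof -
    have Fd: "(F has_real_derivative f (jet1 u q {#})) (at (jet1 u q {#}))" using F by simp
    have "lagrangian_variation (g c) F (\<lambda>y _. \<xi> c y) (\<lambda>y u. (\<lambda>_. a) y * u + (\<lambda>_. 0) y) x (jet1 u q) = 0"
      using var c x u by (simp add: variational_symmetry_iff lift_field_chart)
    then show ?thesis
      unfolding lagrangian_variation_conformal[OF x, where f = f and F = F and j = "jet1 u q", OF Fd smooth_on_const smooth_on_const conformal_fieldD(2)[OF conf c x]]
      using vol_pos[OF x] by simp
  qed
  have q0: "qform x (\<lambda>_. 0) = 0" by (simp add: qform_def)
  have "0 - F u * (real CARD('n) * \<mu> / 2) - f u * (a * u) = 0"
    using *[of "\<lambda>_. 0"] unfolding q0 mult_zero_right .
  then have "(a - (2 - real CARD('n)) / 4 * \<mu>) * qform x p = 0" using *[of p] by linarith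
  then show ?thesis using p by simp
qed

text \<open>At the zero jet a total derivative reduces to its x-derivative, and
  \<open>\<phi>\<close> vanishes there for all x, so its divergence is zero. The variation at that
  jet is - k \<beta> sqrt g.\<close>

lemma constant_source_reduced:
  fixes A :: "('m::{t2_space,second_countable_topology}, 'n::finite) chart set"
  assumes M: "pseudo_riemannian_manifold A g" and k: "k \<noteq> 0" and conf: "conformal_field A g \<xi> \<mu>"
    and sm: "\<And>c. c \<in> A \<Longrightarrow> smooth_on (coord_dom c) (a c)" "\<And>c. c \<in> A \<Longrightarrow> smooth_on (coord_dom c) (\<beta> c)"
    and red: "reduced_noether_symmetry A g UNIV (\<lambda>_. k) (\<lambda>u. k * u) (lift_field \<xi>) (\<lambda>c x u. a c x * u + \<beta> c x)"
    and c: "c \<in> A" and x: "x \<in> coord_dom c"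
  shows "\<beta> c x = 0"
proof -
  interpret chart_metric "coord_dom c" "g c" by (rule chart_metric_chart[OF M c])
  let ?F = "\<lambda>u. k * u" and ?j = "\<lambda>_ :: 'n multiset. 0 :: real"
  let ?L = "lagrangian_variation (g c) ?F (\<lambda>y _. \<xi> c y) (\<lambda>y u. a c y * u + \<beta> c y)"
  have "?L x ?j = 0"
    using red unfolding reduced_noether_symmetry_def
  proof
    assume "variational_symmetry A g UNIV (\<lambda>_. k) ?F (lift_field \<xi>) (\<lambda>c x u. a c x * u + \<beta> c x)"
    then show ?thesis using c x by (simp add: variational_symmetry_iff lift_field_chart)
  next
    assume "\<exists>\<phi>. divergence_symmetry_with A g UNIV (\<lambda>_. k) ?F (lift_field \<xi>) (\<lambda>c x u. a c x * u + \<beta> c x) \<phi>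
      \<and> (\<forall>c\<in>A. \<forall>x\<in>coord_dom c. \<forall>i. \<phi> c i x (\<lambda>_. 0) = 0)"
    then obtain \<phi> where \<phi>: "divergence_symmetry_with A g UNIV (\<lambda>_. k) ?F (lift_field \<xi>) (\<lambda>c x u. a c x * u + \<beta> c x) \<phi>"
      and 0: "\<And>x i. x \<in> coord_dom c \<Longrightarrow> \<phi> c i x (\<lambda>_. 0) = 0" using c by blast
    have "total_deriv i (\<phi> c i) x ?j = 0" for i
      using pd_cong[OF open_V x, of "\<lambda>y. \<phi> c i y ?j" "\<lambda>_. 0" i] 0 by (simp add: total_deriv_def pd_x_def)
    then show ?thesis using \<phi> c x by (simp add: divergence_symmetry_with_iff lift_field_chart)
  qed
  moreover have "(?F has_real_derivative (\<lambda>_. k) (?j {#})) (at (?j {#}))"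
    by (auto intro!: derivative_eq_intros)
  ultimately have "vol x * (k * \<beta> c x) = 0"
    using lagrangian_variation_conformal[OF x, where f = "\<lambda>_. k" and F = ?F and j = ?j, OF _ sm(1)[OF c] sm(2)[OF c] conformal_fieldD(2)[OF conf c x]]
    by (simp add: qform_def)
  then show ?thesis using vol_pos[OF x] k by simp
qed

lemma coord_inv_chart:
  assumes "pseudo_riemannian_manifold A g" "c \<in> A" "m \<in> fst c"
  shows "snd c m \<in> coord_dom c" "loc b c (snd c m) = b m"
  using assms by (auto simp: coord_dom_def loc_def pseudo_riemannian_manifold_def smooth_manifold_def is_chart_def
      intro!: arg_cong[of _ _ b] dest!: homeomorphism_apply1)

text \<open>For \<mu> = 0 the field in 3 is an isometry, hence variational for every p, which
  accounts for the disjunction. In 4.2 a Noether symmetry forces c = 0, whereas b = 0 is tied to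
  \<open>reduced_noether_symmetry\<close>, since the term - k b sqrt g depends on x alone and may be
  a divergence.\<close>

theorem theorem2:
  fixes A :: "('m::{t2_space,second_countable_topology}, 'n::finite) chart set"
    and g :: "('m, 'n, real^'n^'n) local_expr"
    and n :: real
  assumes M: "pseudo_riemannian_manifold A g"
    and n_def: "n = real CARD('n)"
    and n_ge: "CARD('n) \<ge> 3"
  shows
    "(\<forall>\<xi> \<eta>. vector_field_prod A UNIV \<xi> \<eta> \<longrightarrow>
        ((\<forall>f. smooth_on UNIV f \<longrightarrow> lie_point_symmetry A g UNIV f \<xi> \<eta>) \<longrightarrow>
         (\<forall>f F. smooth_on UNIV f \<longrightarrow> primitive_on UNIV f F \<longrightarrow> variational_symmetry A g UNIV f F \<xi> \<eta>)) \<and>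
        (isometry_generator A g UNIV \<xi> \<eta> \<longleftrightarrow>
         (\<forall>f F. smooth_on UNIV f \<longrightarrow> primitive_on UNIV f F \<longrightarrow> variational_symmetry A g UNIV f F \<xi> \<eta>)))
     \<and>
     (\<forall>\<xi> \<eta> F. vector_field_prod A UNIV \<xi> \<eta> \<longrightarrow> primitive_on UNIV exp F \<longrightarrow>
        (variational_symmetry A g UNIV exp F \<xi> \<eta> \<longleftrightarrow> isometry_generator A g UNIV \<xi> \<eta>))
     \<and>
     (\<forall>J p f F \<xi> \<mu>. power_function_on J p f \<longrightarrow> power_primitive_on J p f F \<longrightarrow> p \<noteq> 0 \<longrightarrow> p \<noteq> 1 \<longrightarrow>
        conformal_field A g \<xi> (\<lambda>_ _. \<mu>) \<longrightarrow>
        (variational_symmetry A g J f F (lift_field \<xi>) (\<lambda>c x u. \<mu> / (1 - p) * u)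
           \<longleftrightarrow> \<mu> = 0 \<or> p = (n + 2) / (n - 2)) \<and>
        (p = (n + 2) / (n - 2) \<longleftrightarrow> p + 1 = critical_sobolev_exponent n))
     \<and>
     (\<forall>J f F \<xi> \<mu>. n \<noteq> 6 \<longrightarrow> power_function_on J ((n + 2) / (n - 2)) f \<longrightarrow> primitive_on J f F \<longrightarrow>
        smooth_scalar A \<mu> \<longrightarrow> conformal_field A g \<xi> (loc \<mu>) \<longrightarrow>
        vanishes A (laplace_beltrami g (loc \<mu>)) \<longrightarrow>
        divergence_symmetry A g J f F (lift_field \<xi>) (\<lambda>c x u. (2 - n) / 4 * loc \<mu> c x * u))
     \<and>
     (\<forall>J f F \<xi> \<mu>. n = 6 \<longrightarrow> power_function_on J 2 f \<longrightarrow> primitive_on J f F \<longrightarrow>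
        smooth_scalar A \<mu> \<longrightarrow> conformal_field A g \<xi> (loc \<mu>) \<longrightarrow>
        vanishes A (laplace_beltrami g (laplace_beltrami g (loc \<mu>))) \<longrightarrow>
        divergence_symmetry A g J f F (lift_field \<xi>)
          (\<lambda>c x u. - loc \<mu> c x * u + 1 / 2 * laplace_beltrami g (loc \<mu>) c x))
     \<and>
     (\<forall>F \<xi> \<mu> b c0. primitive_on UNIV (\<lambda>_. 0) F \<longrightarrow> smooth_scalar A \<mu> \<longrightarrow> smooth_scalar A b \<longrightarrow>
        conformal_field A g \<xi> (loc \<mu>) \<longrightarrow>
        vanishes A (laplace_beltrami g (loc \<mu>)) \<longrightarrow> vanishes A (laplace_beltrami g (loc b)) \<longrightarrow>
        (noether_symmetry A g UNIV (\<lambda>_. 0) F (lift_field \<xi>)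
           (\<lambda>c x u. ((2 - n) / 4 * loc \<mu> c x + c0) * u + loc b c x)
         \<longleftrightarrow> c0 = 0))
     \<and>
     (\<forall>k \<xi> b c0. k \<noteq> 0 \<longrightarrow> smooth_scalar A b \<longrightarrow>
        conformal_field A g \<xi> (\<lambda>c x. 4 / (n + 2) * (c0 - 1 / k * laplace_beltrami g (loc b) c x)) \<longrightarrow>
        vanishes A (laplace_beltrami g (laplace_beltrami g (loc b))) \<longrightarrow>
        (reduced_noether_symmetry A g UNIV (\<lambda>_. k) (\<lambda>u. k * u) (lift_field \<xi>)
           (\<lambda>c x u. ((n - 2) / (n + 2) * (1 / k * laplace_beltrami g (loc b) c x - c0) + c0) * u + loc b c x)
         \<longleftrightarrow> (\<forall>m\<in>carrier A. b m = 0) \<and> c0 = 0) \<and>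
        (noether_symmetry A g UNIV (\<lambda>_. k) (\<lambda>u. k * u) (lift_field \<xi>)
           (\<lambda>c x u. ((n - 2) / (n + 2) * (1 / k * laplace_beltrami g (loc b) c x - c0) + c0) * u + loc b c x)
         \<longrightarrow> c0 = 0))
     \<and>
     (\<forall>F \<xi> \<mu> b c0. primitive_on UNIV (\<lambda>u. u) F \<longrightarrow> smooth_scalar A \<mu> \<longrightarrow> smooth_scalar A b \<longrightarrow>
        conformal_field A g \<xi> (loc \<mu>) \<longrightarrow>
        vanishes A (\<lambda>c x. (2 - n) / 4 * laplace_beltrami g (loc \<mu>) c x + loc \<mu> c x) \<longrightarrow>
        vanishes A (\<lambda>c x. laplace_beltrami g (loc b) c x + loc b c x) \<longrightarrow>
        (noether_symmetry A g UNIV (\<lambda>u. u) F (lift_field \<xi>)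
           (\<lambda>c x u. ((2 - n) / 4 * loc \<mu> c x + c0) * u + loc b c x)
         \<longleftrightarrow> c0 = 0))"
proof -
  have n3: "n \<ge> 3" using n_def n_ge by simp
  note sl = chart_metric.smooth_laplace_beltrami[OF chart_metric_chart[OF M]]
  have smooth_lap: "smooth_on (coord_dom c) (laplace_beltrami g h c)" if "c \<in> A" "smooth_on (coord_dom c) (h c)" for h c
    using sl[OF that, of c] unfolding laplace_beltrami_chart[of g h c, abs_def] .
  have lap_cmult: "laplace_beltrami g (\<lambda>c x. k * h c x) c x = k * laplace_beltrami g h c x"
    if "c \<in> A" "x \<in> coord_dom c" "smooth_on (coord_dom c) (h c)" for k h c x
    using chart_metric.laplace_beltrami_cmult[OF chart_metric_chart[OF M that(1)] that(3,2), of k c]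
    unfolding laplace_beltrami_chart[of g _ c] .
  have lap_0: "laplace_beltrami g (\<lambda>_ _. 0) c x = 0" if "c \<in> A" "x \<in> coord_dom c" for c x
    using chart_metric.laplace_beltrami_zero[OF chart_metric_chart[OF M that(1)] _ that(2), of "\<lambda>_. 0" c]
    unfolding laplace_beltrami_chart[of g _ c] by simp
  have sd: "\<And>u. u \<in> UNIV \<Longrightarrow> (f has_real_derivative deriv f u) (at u)" if "smooth_on UNIV f" for f :: "real \<Rightarrow> real"
    using smooth_on_differentiable[OF that] by (simp add: DERIV_deriv_iff_real_differentiable)
  have smooth_a: "smooth_on (coord_dom c) (\<lambda>x. (2 - n) / 4 * loc \<mu> c x + c0)"
    if "smooth_scalar A \<mu>" "c \<in> A" for \<mu> c c0
    using chart_metric.open_V[OF chart_metric_chart[OF M that(2)]] that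
    by (intro smooth_on_add smooth_on_mult smooth_on_const) (auto simp: smooth_scalar_def)
  note iso_var = isometry_variational_symmetry[OF M]
  have exp_prim: "primitive_on UNIV exp (exp :: real \<Rightarrow> real)" by (simp add: primitive_on_def)
  have n2: "CARD('n) \<noteq> 2" using n_ge by simp
  \<comment> \<open>The exponent solves (2 - n)/4 (1 - p) = 1, that is, it makes \<mu>/(1 - p) equal
    to the forced coefficient (2 - n)/4 \<mu>.\<close>
  have crit: "(2 - n) / 4 * (1 - (n + 2) / (n - 2)) = 1" using n3 by (simp add: field_simps)
  have crit1: "(n + 2) / (n - 2) + 1 = 2 * n / (n - 2)" using n3 by (simp add: field_simps)
  show ?thesis
  proof (intro conjI allI impI)
    fix \<xi> \<eta> f F
    assume "vector_field_prod A UNIV \<xi> \<eta>" "\<forall>f. smooth_on UNIV f \<longrightarrow> lie_point_symmetry A g UNIV f \<xi> \<eta>"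
      and f: "smooth_on UNIV f" and F: "primitive_on UNIV f F"
    then have "isometry_generator A g UNIV \<xi> \<eta>" by (intro lie_symmetry_all_imp_isometry[OF M]) auto
    then show "variational_symmetry A g UNIV f F \<xi> \<eta>" by (rule iso_var[OF open_UNIV _ F sd[OF f]])
  next
    fix \<xi> \<eta>
    assume vf: "vector_field_prod A UNIV \<xi> \<eta>"
    show "isometry_generator A g UNIV \<xi> \<eta> \<longleftrightarrow>
      (\<forall>f F. smooth_on UNIV f \<longrightarrow> primitive_on UNIV f F \<longrightarrow> variational_symmetry A g UNIV f F \<xi> \<eta>)"
    proof (intro iffI allI impI)
      fix f F assume "isometry_generator A g UNIV \<xi> \<eta>" and f: "smooth_on UNIV f" and F: "primitive_on UNIV f F"
      then show "variational_symmetry A g UNIV f F \<xi> \<eta>" by (intro iso_var[OF open_UNIV _ F sd[OF f]])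
    next
      assume "\<forall>f F. smooth_on UNIV f \<longrightarrow> primitive_on UNIV f F \<longrightarrow> variational_symmetry A g UNIV f F \<xi> \<eta>"
      \<comment> \<open>The single source exp already forces an isometry.\<close>
      then show "isometry_generator A g UNIV \<xi> \<eta>"
        using exp_variational_imp_isometry[OF M n2 vf exp_prim] smooth_on_exp exp_prim by blast
    qed
  next
    fix \<xi> \<eta> F
    assume vf: "vector_field_prod A UNIV \<xi> \<eta>" and F: "primitive_on UNIV exp F"
    show "variational_symmetry A g UNIV exp F \<xi> \<eta> \<longleftrightarrow> isometry_generator A g UNIV \<xi> \<eta>"
      using exp_variational_imp_isometry[OF M n2 vf F] iso_var[OF open_UNIV _ F sd[OF smooth_on_exp]] by blast
  next
    fix J p f F \<xi> \<mu>
    assume f: "power_function_on J p f" and F: "power_primitive_on J p f F" and p: "p \<noteq> 0" "p \<noteq> 1"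
      and conf: "conformal_field A g \<xi> (\<lambda>_ _. \<mu>)"
    have J: "open J" and F': "primitive_on J f F" using f F by (auto simp: power_function_on_def power_primitive_on_def)
    show "variational_symmetry A g J f F (lift_field \<xi>) (\<lambda>c x u. \<mu> / (1 - p) * u) \<longleftrightarrow> \<mu> = 0 \<or> p = (n + 2) / (n - 2)"
    proof
      assume v: "variational_symmetry A g J f F (lift_field \<xi>) (\<lambda>c x u. \<mu> / (1 - p) * u)"
      obtain u where u: "u \<in> J" using f by (auto simp: power_function_on_def)
      have e: "\<mu> / (1 - p) = (2 - n) / 4 * \<mu>"
        unfolding n_def by (rule power_variational_exponent[OF M conf u _ v]) (use F' u in \<open>simp add: primitive_on_def\<close>)
      have "\<mu> = \<mu> / (1 - p) * (1 - p)" using p by simp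
      then have "\<mu> * ((2 - n) / 4 * (1 - p) - 1) = 0" unfolding e by (simp add: algebra_simps)
      then have "\<mu> = 0 \<or> (2 - n) / 4 * (1 - p) = (2 - n) / 4 * (1 - (n + 2) / (n - 2))"
        unfolding crit by simp
      then show "\<mu> = 0 \<or> p = (n + 2) / (n - 2)" using n3 by auto
    next
      assume a: "\<mu> = 0 \<or> p = (n + 2) / (n - 2)"
      have "\<mu> = 0 \<or> (2 - n) / 4 * (1 - p) = 1" using a crit by auto
      then have "\<mu> = (2 - n) / 4 * \<mu> * (1 - p)" by auto
      then have eq: "\<mu> / (1 - p) = (2 - n) / 4 * \<mu>" using p by (simp add: divide_eq_eq)
      have "(2 - n) / 4 * \<mu> * u * f u + n / 2 * \<mu> * F u = 0" if u: "u \<in> J" for u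
      proof (cases "\<mu> = 0")
        case False
        with a have p': "p = (n + 2) / (n - 2)" by simp
        then have p1: "p + 1 = 2 * n / (n - 2)" using crit1 by simp
        \<comment> \<open>As p + 1 = 2 n/(n - 2) is positive, the primitive is normalized to u f/(p
          + 1).\<close>
        then have "p \<noteq> -1" using n3 by auto
        then have "F u = u * f u / (2 * n / (n - 2))" using F u p1 by (simp add: power_primitive_on_def)
        then have "n / 2 * F u = (n - 2) / 4 * (u * f u)" using n3 by (simp add: field_simps)
        moreover have "(2 - n) / 4 * \<mu> * u * f u + n / 2 * \<mu> * F u = \<mu> * (n / 2 * F u - (n - 2) / 4 * (u * f u))"
          by (simp add: algebra_simps diff_divide_distrib)
        ultimately show ?thesis by simp
      qed simp
      then show "variational_symmetry A g J f F (lift_field \<xi>) (\<lambda>c x u. \<mu> / (1 - p) * u)"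
        unfolding eq unfolding n_def
        by (intro homothety_variational_symmetry[OF M J conf F' power_function_on_deriv(1)[OF f]]) auto
    qed
    show "p = (n + 2) / (n - 2) \<longleftrightarrow> p + 1 = critical_sobolev_exponent n"
      using crit1 by (auto simp: critical_sobolev_exponent_def)
  next
    fix J f F \<xi> \<mu>
    let ?p = "(n + 2) / (n - 2)"
    assume "n \<noteq> 6" and f: "power_function_on J ?p f" and F: "primitive_on J f F"
      and \<mu>: "smooth_scalar A \<mu>" and conf: "conformal_field A g \<xi> (loc \<mu>)" and lap: "vanishes A (laplace_beltrami g (loc \<mu>))"
    have J: "open J" using f by (simp add: power_function_on_def)
    have p1: "?p + 1 \<noteq> 0" using crit1 n3 by auto
    \<comment> \<open>The normalized primitive, by the homogeneity u f' = p f; written through f, it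
      avoids a case split on the kind of power.\<close>
    have F0: "((\<lambda>u. u * f u / (?p + 1)) has_real_derivative f u) (at u)" if u: "u \<in> J" for u
    proof -
      have "((\<lambda>u. u * f u / (?p + 1)) has_real_derivative (1 * f u + deriv f u * u) / (?p + 1)) (at u)"
        by (intro DERIV_cdivide DERIV_mult DERIV_ident power_function_on_deriv(1)[OF f u])
      moreover have "1 * f u + deriv f u * u = (?p + 1) * f u"
        using power_function_on_deriv(2)[OF f u] by (simp add: algebra_simps)
      ultimately show ?thesis using p1 by simp
    qed
    have "divergence_symmetry A g J f F (lift_field \<xi>) (\<lambda>c x u. (2 - real CARD('n)) / 4 * loc \<mu> c x * u + (\<lambda>_ _. 0) c x)"
    proof (rule conformal_divergence_symmetry[OF M J conf _ smooth_on_const F F0 power_function_on_deriv(1)[OF f]])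
      \<comment> \<open>The terms in \<mu> u f cancel, since (2 - n)/4 + (n/2)/(p + 1) = 0 for the
        critical exponent, and both Laplacians vanish.\<close>
      show "noether_condition A g J f (\<lambda>u. u * f u / (?p + 1)) (loc \<mu>) (\<lambda>_ _. 0)"
        unfolding noether_condition_def n_def[symmetric] crit1
        using lap lap_0 n3 by (auto simp: vanishes_def field_simps)
    qed (use \<mu> in \<open>auto simp: smooth_scalar_def\<close>)
    then show "divergence_symmetry A g J f F (lift_field \<xi>) (\<lambda>c x u. (2 - n) / 4 * loc \<mu> c x * u)"
      unfolding n_def by simp
  next
    fix J f F \<xi> \<mu>
    assume n6: "n = 6" and f: "power_function_on J 2 f" and F: "primitive_on J f F"
      and \<mu>: "smooth_scalar A \<mu>" and conf: "conformal_field A g \<xi> (loc \<mu>)"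
      and lap: "vanishes A (laplace_beltrami g (laplace_beltrami g (loc \<mu>)))"
    have J: "open J" using f by (simp add: power_function_on_def)
    have s\<mu>: "smooth_on (coord_dom c) (loc \<mu> c)" if "c \<in> A" for c using \<mu> that by (simp add: smooth_scalar_def)
    let ?b = "\<lambda>c x. 1 / 2 * laplace_beltrami g (loc \<mu>) c x"
    have "divergence_symmetry A g J f F (lift_field \<xi>) (\<lambda>c x u. (2 - real CARD('n)) / 4 * loc \<mu> c x * u + ?b c x)"
    proof (rule conformal_divergence_symmetry[OF M J conf s\<mu> _ F _ power_function_on_deriv(1)[OF f]])
      show "smooth_on (coord_dom c) (?b c)" if "c \<in> A" for c
        using chart_metric.open_V[OF chart_metric_chart[OF M that]]
        by (intro smooth_on_mult smooth_on_const smooth_lap s\<mu> that)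
      show "((\<lambda>u. u ^ 3 / 3) has_real_derivative f u) (at u)" if "u \<in> J" for u
        unfolding power_function_on_2[OF f that] by (auto intro!: derivative_eq_intros)
      \<comment> \<open>For n = 6 the coefficient of \<mu> u is -1. Half the Laplacian of \<mu>, as
        \<beta>, is what cancels the u^2 term; the cubic terms are -\<mu> u^3 and 3 \<mu>
        u^3/3.\<close>
      show "noether_condition A g J f (\<lambda>u. u ^ 3 / 3) (loc \<mu>) ?b"
        unfolding noether_condition_def n_def[symmetric] n6
      proof (intro ballI)
        fix c x u assume c: "c \<in> A" and x: "x \<in> coord_dom c" and u: "u \<in> J"
        have "laplace_beltrami g ?b c x = 0"
          using lap_cmult[OF c x, where h = "laplace_beltrami g (loc \<mu>)" and k = "1/2", OF smooth_lap[where h = "loc \<mu>", OF c s\<mu>[OF c]]] lap c x by (simp add: vanishes_def)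
        then show "(2 - 6) / 8 * u\<^sup>2 * laplace_beltrami g (loc \<mu>) c x + u * laplace_beltrami g ?b c x
          + ((2 - 6) / 4 * loc \<mu> c x * u + ?b c x) * f u + 6 / 2 * loc \<mu> c x * (u ^ 3 / 3) = 0"
          unfolding power_function_on_2[OF f u] by (simp add: field_simps power2_eq_square power3_eq_cube)
      qed
    qed
    then show "divergence_symmetry A g J f F (lift_field \<xi>) (\<lambda>c x u. - loc \<mu> c x * u + 1 / 2 * laplace_beltrami g (loc \<mu>) c x)"
      unfolding n_def[symmetric] n6 by simp
  next
    fix F \<xi> \<mu> b c0
    assume F: "primitive_on UNIV (\<lambda>_. 0) F" and \<mu>: "smooth_scalar A \<mu>" and b: "smooth_scalar A b"
      and conf: "conformal_field A g \<xi> (loc \<mu>)"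
      and lap: "vanishes A (laplace_beltrami g (loc \<mu>))" "vanishes A (laplace_beltrami g (loc b))"
    have s: "smooth_on (coord_dom c) (loc \<mu> c)" "smooth_on (coord_dom c) (loc b c)" if "c \<in> A" for c
      using \<mu> b that by (simp_all add: smooth_scalar_def)
    show "noether_symmetry A g UNIV (\<lambda>_. 0) F (lift_field \<xi>) (\<lambda>c x u. ((2 - n) / 4 * loc \<mu> c x + c0) * u + loc b c x) \<longleftrightarrow> c0 = 0"
    proof
      assume N: "noether_symmetry A g UNIV (\<lambda>_. 0) F (lift_field \<xi>) (\<lambda>c x u. ((2 - n) / 4 * loc \<mu> c x + c0) * u + loc b c x)"
      show "c0 = 0"
        by (rule noether_symmetry_no_scaling[OF M conf smooth_a[OF \<mu>] s(2) _ F N]) (simp_all add: n_def)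
    next
      assume c0: "c0 = 0"
      \<comment> \<open>For f = 0 the normalized primitive is zero; the constant value of
        \<open>F\<close> is left to the divergence.\<close>
      have "divergence_symmetry A g UNIV (\<lambda>_. 0) F (lift_field \<xi>) (\<lambda>c x u. (2 - real CARD('n)) / 4 * loc \<mu> c x * u + loc b c x)"
        by (rule conformal_divergence_symmetry[OF M open_UNIV conf s F, where Fp = "\<lambda>_. 0" and f' = "\<lambda>_. 0"])
          (use lap in \<open>auto simp: noether_condition_def vanishes_def\<close>)
      then show "noether_symmetry A g UNIV (\<lambda>_. 0) F (lift_field \<xi>) (\<lambda>c x u. ((2 - n) / 4 * loc \<mu> c x + c0) * u + loc b c x)"
        unfolding noether_symmetry_def n_def c0 by simp
    qed
  next
    fix k :: real and \<xi> b c0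
    let ?\<mu> = "\<lambda>c x. 4 / (n + 2) * (c0 - 1 / k * laplace_beltrami g (loc b) c x)"
    let ?a = "\<lambda>c x. (n - 2) / (n + 2) * (1 / k * laplace_beltrami g (loc b) c x - c0) + c0"
    assume k: "k \<noteq> 0" and b: "smooth_scalar A b" and conf: "conformal_field A g \<xi> ?\<mu>"
      and lap: "vanishes A (laplace_beltrami g (laplace_beltrami g (loc b)))"
    have sb: "smooth_on (coord_dom c) (loc b c)" if "c \<in> A" for c using b that by (simp add: smooth_scalar_def)
    have sa: "smooth_on (coord_dom c) (?a c)" if "c \<in> A" for c
      using chart_metric.open_V[OF chart_metric_chart[OF M that]]
      by (intro smooth_on_add smooth_on_diff smooth_on_mult smooth_on_const smooth_lap sb that)
    \<comment> \<open>The coefficient splits into (2 - n)/4 times the conformal factor plus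
      \<open>c0\<close>, the form that the Euler argument requires.\<close>
    have a: "?a c x = (2 - real CARD('n)) / 4 * ?\<mu> c x + c0" for c x
    proof -
      have "(n - 2) / (n + 2) * (y - c0) = (2 - n) / 4 * (4 / (n + 2) * (c0 - y))" for y
      proof -
        have "(n - 2) / (n + 2) * (y - c0) = ((n - 2) * (y - c0)) / (n + 2)" by simp
        also have "(n - 2) * (y - c0) = (2 - n) * (c0 - y)" by (simp add: algebra_simps)
        also have "(2 - n) * z / d = (2 - n) / 4 * (4 / d * z)" for d z by simp
        finally show ?thesis .
      qed
      then show ?thesis unfolding n_def[symmetric] by simp
    qed
    have F: "primitive_on UNIV (\<lambda>_. k) (\<lambda>u. k * u)"
      by (auto simp: primitive_on_def intro!: derivative_eq_intros)
    show c00: "c0 = 0" if "noether_symmetry A g UNIV (\<lambda>_. k) (\<lambda>u. k * u) (lift_field \<xi>) (\<lambda>c x u. ?a c x * u + loc b c x)"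
      by (rule noether_symmetry_no_scaling[OF M conf sa sb a F that])
    show "reduced_noether_symmetry A g UNIV (\<lambda>_. k) (\<lambda>u. k * u) (lift_field \<xi>) (\<lambda>c x u. ?a c x * u + loc b c x)
      \<longleftrightarrow> (\<forall>m\<in>carrier A. b m = 0) \<and> c0 = 0"
    proof
      assume r: "reduced_noether_symmetry A g UNIV (\<lambda>_. k) (\<lambda>u. k * u) (lift_field \<xi>) (\<lambda>c x u. ?a c x * u + loc b c x)"
      then have "noether_symmetry A g UNIV (\<lambda>_. k) (\<lambda>u. k * u) (lift_field \<xi>) (\<lambda>c x u. ?a c x * u + loc b c x)"
        unfolding reduced_noether_symmetry_def noether_symmetry_def divergence_symmetry_def by blast
      then have "c0 = 0" by (rule c00)
      moreover have "b m = 0" if m: "m \<in> carrier A" for m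
      proof -
        obtain c where c: "c \<in> A" "m \<in> fst c" using m by (auto simp: carrier_def)
        have "loc b c (snd c m) = 0"
          by (rule constant_source_reduced[OF M k conf sa sb r c(1) coord_inv_chart(1)[OF M c]])
        then show ?thesis by (simp add: coord_inv_chart(2)[OF M c])
      qed
      ultimately show "(\<forall>m\<in>carrier A. b m = 0) \<and> c0 = 0" by blast
    next
      assume bc: "(\<forall>m\<in>carrier A. b m = 0) \<and> c0 = 0"
      have b0: "loc b c x = 0" if "c \<in> A" "x \<in> coord_dom c" for c x
        using bc that coord_inv_chart(2)[OF M that(1), of _ b] by (auto simp: coord_dom_def carrier_def)
      have l0: "laplace_beltrami g (loc b) c x = 0" if "c \<in> A" "x \<in> coord_dom c" for c x
        unfolding laplace_beltrami_chart[of g _ c]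
        by (rule chart_metric.laplace_beltrami_zero[OF chart_metric_chart[OF M that(1)] b0[OF that(1)] that(2)])
      \<comment> \<open>With b = 0 and c = 0 both the conformal factor and \<eta> vanish.\<close>
      have "isometry_generator A g UNIV (lift_field \<xi>) (\<lambda>c x u. ?a c x * u + loc b c x)"
        unfolding isometry_generator_def using conf bc b0 l0
        by (intro exI[of _ \<xi>]) (auto simp: conformal_field_def)
      then have "variational_symmetry A g UNIV (\<lambda>_. k) (\<lambda>u. k * u) (lift_field \<xi>) (\<lambda>c x u. ?a c x * u + loc b c x)"
        by (rule iso_var[OF open_UNIV _ F DERIV_const])
      then show "reduced_noether_symmetry A g UNIV (\<lambda>_. k) (\<lambda>u. k * u) (lift_field \<xi>) (\<lambda>c x u. ?a c x * u + loc b c x)"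
        by (simp add: reduced_noether_symmetry_def)
    qed
  next
    fix F \<xi> \<mu> b c0
    assume F: "primitive_on UNIV (\<lambda>u. u) F" and \<mu>: "smooth_scalar A \<mu>" and b: "smooth_scalar A b"
      and conf: "conformal_field A g \<xi> (loc \<mu>)"
      and lap: "vanishes A (\<lambda>c x. (2 - n) / 4 * laplace_beltrami g (loc \<mu>) c x + loc \<mu> c x)"
        "vanishes A (\<lambda>c x. laplace_beltrami g (loc b) c x + loc b c x)"
    have s: "smooth_on (coord_dom c) (loc \<mu> c)" "smooth_on (coord_dom c) (loc b c)" if "c \<in> A" for c
      using \<mu> b that by (simp_all add: smooth_scalar_def)
    show "noether_symmetry A g UNIV (\<lambda>u. u) F (lift_field \<xi>) (\<lambda>c x u. ((2 - n) / 4 * loc \<mu> c x + c0) * u + loc b c x) \<longleftrightarrow> c0 = 0"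
    proof
      assume N: "noether_symmetry A g UNIV (\<lambda>u. u) F (lift_field \<xi>) (\<lambda>c x u. ((2 - n) / 4 * loc \<mu> c x + c0) * u + loc b c x)"
      show "c0 = 0"
        by (rule noether_symmetry_no_scaling[OF M conf smooth_a[OF \<mu>] s(2) _ F N]) (simp_all add: n_def)
    next
      assume c0: "c0 = 0"
      have "divergence_symmetry A g UNIV (\<lambda>u. u) F (lift_field \<xi>) (\<lambda>c x u. (2 - real CARD('n)) / 4 * loc \<mu> c x * u + loc b c x)"
      proof (rule conformal_divergence_symmetry[OF M open_UNIV conf s F, where Fp = "\<lambda>u. u\<^sup>2 / 2" and f' = "\<lambda>_. 1"])
        \<comment> \<open>The coefficients of \<mu> u^2 add up to -1/2 + (2 - n)/4 + n/4 = 0, those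
          of b u to -1 + 1 = 0.\<close>
        show "noether_condition A g UNIV (\<lambda>u. u) (\<lambda>u. u\<^sup>2 / 2) (loc \<mu>) (loc b)"
          unfolding noether_condition_def n_def[symmetric]
        proof (intro ballI)
          fix c x and u :: real assume c: "c \<in> A" and x: "x \<in> coord_dom c"
          have \<mu>': "(2 - n) / 4 * laplace_beltrami g (loc \<mu>) c x = - loc \<mu> c x"
            and b': "laplace_beltrami g (loc b) c x = - loc b c x"
            using lap c x unfolding vanishes_def eq_neg_iff_add_eq_0 by blast+
          have "(2 - n) / 8 * u\<^sup>2 * laplace_beltrami g (loc \<mu>) c x = 1/2 * u\<^sup>2 * ((2 - n) / 4 * laplace_beltrami g (loc \<mu>) c x)" by simp
          then show "(2 - n) / 8 * u\<^sup>2 * laplace_beltrami g (loc \<mu>) c x + u * laplace_beltrami g (loc b) c x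
            + ((2 - n) / 4 * loc \<mu> c x * u + loc b c x) * u + n / 2 * loc \<mu> c x * (u\<^sup>2 / 2) = 0"
            unfolding \<mu>' b' by (simp add: field_simps power2_eq_square)
        qed
      qed (auto intro!: derivative_eq_intros)
      then show "noether_symmetry A g UNIV (\<lambda>u. u) F (lift_field \<xi>) (\<lambda>c x u. ((2 - n) / 4 * loc \<mu> c x + c0) * u + loc b c x)"
        unfolding noether_symmetry_def n_def c0 by simp
    qed
  qed
qed

end
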